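(* Let $T=T_\gamma$, $\nu=\nu_\gamma$, the empirical measure $\mu_n$ and the Wasserstein distance $W_1$ be as defined in the context. The following results hold: 1. Let $\gamma=1/2$, and let $(a_n)_{n\ge1}$ be a non-decreasing sequence of numbers such that $a_n\ge a$ for some $a>0$, $\sum_{n>0}n^{-1}a_n^{-2}<\infty$, and, for some $c\ge1$, $a_n\le c\,a_{n/2}$ for all even $n$. Then $$\frac{\sqrt n}{a_n\sqrt{\log(n)}}\,W_1(\mu_n,\nu)\quad\text{converges to zero almost everywhere as } n\to\infty.$$ 2. Let $\gamma\in(1/2,1)$, and let $(a_n)_{n\ge1}$ be a non-decreasing sequence of positive numbers such that $\sum_{n>0}n^{-1}a_n^{-1/\gamma}<\infty$ and, for some $c\ge1$, $a_n\le c\,a_{n/2}$ for all even $n$. Then $$\frac{n^{1-\gamma}}{a_n}\,W_1(\mu_n,\nu)\quad\text{converges to zero almost everywhere as } n\to\infty.$$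
   Context: For $\gamma\in(0,1)$, the intermittent map $T=T_\gamma:[0,1]\to[0,1]$ is $T_\gamma(x)=x(1+2^\gamma x^\gamma)$ if $x\in[0,1/2)$ and $T_\gamma(x)=2x-1$ if $x\in[1/2,1]$; $T^k$ denotes its $k$-th iterate. There is a unique $T_\gamma$-invariant probability measure $\nu=\nu_\gamma$ on $[0,1]$ that is absolutely continuous with respect to Lebesgue measure, and it is equivalent to Lebesgue measure (known). The empirical measure is $\mu_n=\frac1n\sum_{k=1}^n\delta_{T^k}$ (at a point $x\in[0,1]$, $\mu_n=\frac1n\sum_{k=1}^n\delta_{T^k(x)}$), and $$W_1(\mu_n,\nu)=\inf_{\pi\in M(\mu_n,\nu)}\int|x-y|\,\pi(dx,dy),$$ where $M(\mu_n,\nu)$ is the set of probability measures on $[0,1]^2$ with marginals $\mu_n$ and $\nu$. *)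

theory Defs
  imports "HOL-Probability.Probability"
begin

abbreviation unit_borel :: "real measure" where
  "unit_borel \<equiv> restrict_space borel {0..1}"

abbreviation unit_lebesgue :: "real measure" where
  "unit_lebesgue \<equiv> restrict_space lborel {0..1}"

(* Only the values on [0,1] are meaningful; note that 0 powr \<gamma> = 0. *)
definition intermittent_map :: "real \<Rightarrow> real \<Rightarrow> real" where
  "intermittent_map \<gamma> x =
     (if x < 1/2 then x * (1 + 2 powr \<gamma> * x powr \<gamma>) else 2 * x - 1)"

lemma intermittent_map_in:
  assumes "0 < \<gamma>" "x \<in> {0..1}"
  shows "intermittent_map \<gamma> x \<in> {0..1}"
proof (cases "x < 1/2")
  case True
  have "2 powr \<gamma> * x powr \<gamma> = (2 * x) powr \<gamma>"
    using assms by (simp add: powr_mult)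
  moreover have "(2 * x) powr \<gamma> \<le> 1"
    using assms True by (intro powr_le1) auto
  ultimately have "1 + 2 powr \<gamma> * x powr \<gamma> \<le> 2" "0 \<le> 1 + 2 powr \<gamma> * x powr \<gamma>"
    by auto
  then have "x * (1 + 2 powr \<gamma> * x powr \<gamma>) \<le> 1/2 * 2" "0 \<le> x * (1 + 2 powr \<gamma> * x powr \<gamma>)"
    using assms True by (intro mult_mono mult_nonneg_nonneg; simp)+
  then show ?thesis using True by (simp add: intermittent_map_def)
next
  case False
  then show ?thesis using assms by (simp add: intermittent_map_def)
qed

lemma intermittent_map_measurable:
  assumes "0 < \<gamma>"
  shows "intermittent_map \<gamma> \<in> measurable unit_borel unit_borel"
proof (rule measurable_restrict_space2)
  show "intermittent_map \<gamma> \<in> space unit_borel \<rightarrow> {0..1}"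
    using intermittent_map_in[OF assms] by (auto simp: space_restrict_space)
  have "intermittent_map \<gamma> \<in> borel_measurable borel"
    unfolding intermittent_map_def by measurable
  then show "intermittent_map \<gamma> \<in> borel_measurable unit_borel"
    by (rule measurable_restrict_space1)
qed

lemma intermittent_map_funpow_in:
  assumes "0 < \<gamma>" "x \<in> {0..1}"
  shows "(intermittent_map \<gamma> ^^ k) x \<in> {0..1}"
  by (induction k) (use assms intermittent_map_in in auto)

definition invariant_ac_prob :: "real \<Rightarrow> real measure \<Rightarrow> bool" where
  "invariant_ac_prob \<gamma> \<nu> \<longleftrightarrow>
     prob_space \<nu> \<and> sets \<nu> = sets unit_borel \<and>
     distr \<nu> \<nu> (intermittent_map \<gamma>) = \<nu> \<and>
     absolutely_continuous unit_lebesgue \<nu>"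

definition empirical_measure :: "real \<Rightarrow> nat \<Rightarrow> real \<Rightarrow> real measure" where
  "empirical_measure \<gamma> n x = measure_of {0..1} (sets unit_borel)
     (\<lambda>A. ennreal (1 / real n) *
        (\<Sum>k=1..n. emeasure (return unit_borel ((intermittent_map \<gamma> ^^ k) x)) A))"

lemma space_empirical_measure [simp]: "space (empirical_measure \<gamma> n x) = {0..1}"
  and sets_empirical_measure [simp]: "sets (empirical_measure \<gamma> n x) = sets unit_borel"
proof -
  have "sets unit_borel \<subseteq> Pow {0..1}"
    using sets.space_closed[of unit_borel] by (simp add: space_restrict_space)
  moreover have "sigma_sets {0..1} (sets unit_borel) = sets unit_borel"
    using sets.sigma_sets_eq[of unit_borel] by (simp add: space_restrict_space)
  ultimately show "space (empirical_measure \<gamma> n x) = {0..1}"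
    "sets (empirical_measure \<gamma> n x) = sets unit_borel"
    by (simp_all add: empirical_measure_def)
qed

lemma emeasure_empirical_measure:
  assumes "A \<in> sets unit_borel"
  shows "emeasure (empirical_measure \<gamma> n x) A =
    ennreal (1 / real n) * (\<Sum>k=1..n. indicator A ((intermittent_map \<gamma> ^^ k) x))"
proof -
  let ?\<mu> = "\<lambda>A. ennreal (1 / real n) *
    (\<Sum>k=1..n. emeasure (return unit_borel ((intermittent_map \<gamma> ^^ k) x)) A)"
  have "countably_additive (sets (empirical_measure \<gamma> n x)) ?\<mu>"
  proof (rule countably_additiveI)
    fix B :: "nat \<Rightarrow> real set"
    assume B: "range B \<subseteq> sets (empirical_measure \<gamma> n x)" "disjoint_family B"
    have "(\<Sum>i. emeasure (return unit_borel y) (B i)) = emeasure (return unit_borel y) (\<Union>i. B i)" for y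
      using B by (intro suminf_emeasure) auto
    then show "(\<Sum>i. ?\<mu> (B i)) = ?\<mu> (\<Union>i. B i)"
      by (simp add: suminf_sum)
  qed
  then have "emeasure (empirical_measure \<gamma> n x) A = ?\<mu> A"
    using assms sets.space_closed[of unit_borel]
    by (intro emeasure_measure_of[OF empirical_measure_def])
       (simp_all add: positive_def space_restrict_space)
  then show ?thesis using assms by simp
qed

lemma prob_space_empirical_measure:
  assumes "0 < \<gamma>" "x \<in> {0..1}" "0 < n"
  shows "prob_space (empirical_measure \<gamma> n x)"
proof
  have "{0..1} \<in> sets unit_borel"
    using sets.top[of unit_borel] by (simp add: space_restrict_space)
  then have "emeasure (empirical_measure \<gamma> n x) {0..1} = ennreal (1 / real n) * of_nat n"
    using intermittent_map_funpow_in[OF assms(1,2)]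
    by (simp add: emeasure_empirical_measure del: atLeastAtMost_iff)
  also have "\<dots> = ennreal (1 / real n * real n)"
    by (simp add: ennreal_mult ennreal_of_nat_eq_real_of_nat del: times_divide_eq_left)
  finally show "emeasure (empirical_measure \<gamma> n x) (space (empirical_measure \<gamma> n x)) = 1"
    using assms(3) by simp
qed

definition couplings :: "real measure \<Rightarrow> real measure \<Rightarrow> (real \<times> real) measure set" where
  "couplings \<mu> \<nu> = {\<pi>. prob_space \<pi> \<and> sets \<pi> = sets (\<mu> \<Otimes>\<^sub>M \<nu>) \<and>
     distr \<pi> \<mu> fst = \<mu> \<and> distr \<pi> \<nu> snd = \<nu>}"

(* For probability measures on [0,1] all integrals below lie in [0,1] and the set of
   couplings contains the product measure, so the real-valued infimum is the true one. *)
definition W1 :: "real measure \<Rightarrow> real measure \<Rightarrow> real" where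
  "W1 \<mu> \<nu> = (INF \<pi>\<in>couplings \<mu> \<nu>. \<integral>p. \<bar>fst p - snd p\<bar> \<partial>\<pi>)"

end

theory Submission
  imports Defs
begin

text \<open>
  Cut the orbit of a point into blocks, a block ending each time the right branch of the map has
  been used. The map that sends the first point of a block to the first point of the next one (the
  jump transformation) has full branches and expands by a factor of at least 2. The left branch is
  convex, so the derivatives \<open>W r\<close> of the inverse branches \<open>V r\<close> are decreasing and the transfer
  operator preserves decreasing functions. Consecutive branch intervals are adjacent and
  \<open>W r 0 \<le> 3 * W (Suc r) 1\<close>; comparing each branch with the next one shows that the image of a
  decreasing function varies by a factor of at most 3 (\<open>transfer_le_3\<close>). One third of the mass can
  therefore be split off as a constant, what remains is again decreasing, and by induction two
  decreasing densities merge at rate \<open>(2/3)^n\<close> (\<open>mixing\<close>).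

  For fixed \<open>t\<close> the number of visits to \<open>[0,t]\<close> during a block is, on each branch, a decreasing
  function of the first point of the next block. Weighting a decreasing density with it thus gives
  a decreasing density after one jump, so block sums decorrelate exponentially and the variance of a sum
  of \<open>k\<close> centred, truncated block sums is \<open>O(k)\<close> (\<open>variance_bound\<close>). Integrating over \<open>t\<close> gives a
  second moment for \<open>\<integral> \<bar>F\<^sub>n(t) - F(t)\<bar> dt\<close>, where \<open>F\<^sub>n\<close> and \<open>F\<close> are the distribution
  functions of \<open>\<mu>\<^sub>n\<close> and \<open>\<nu>\<close>, and an Ottaviani argument over cylinder sets makes it uniform
  over all times up to \<open>N\<close> (\<open>maximal_inequality\<close>).

  A block is longer than \<open>l\<close> with probability \<open>O(l^(-1/\<gamma>))\<close> (\<open>branch_0_le\<close>). Truncating at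
  \<open>l = x/2\<close> and using Chebyshev's inequality, the event that \<open>n \<integral> \<bar>F\<^sub>n - F\<bar>\<close> exceeds a multiple of
  \<open>x\<close> for some \<open>n \<le> N\<close> has probability \<open>O(N x^(-1/\<gamma>))\<close>, with an extra factor \<open>ln x\<close> if
  \<open>\<gamma> = 1/2\<close>. For \<open>N = 2^(p+1)\<close> and \<open>x = \<epsilon> b(2^p)\<close>, with \<open>b n = n^\<gamma> a\<^sub>n\<close> or
  \<open>b n = sqrt (n ln n) a\<^sub>n\<close>, these bounds are \<open>O(a(2^p)^(-1/\<gamma>))\<close>, which is summable by Cauchy
  condensation, and the Borel-Cantelli lemma applies (\<open>orbit_sum_negligible\<close>).

  The block argument centres the visits by Kac's formula (\<open>Fstar\<close>). The case \<open>b n = n\<close> is a law of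
  large numbers; integrated against \<open>\<nu>\<close> it identifies this centring with the distribution function
  of \<open>\<nu>\<close> (\<open>Fstar_eq_cdf\<close>). Finally the quantile coupling bounds the Wasserstein distance by
  \<open>\<integral> \<bar>F\<^sub>n - F\<bar>\<close> (\<open>W1_le_cdf_distance\<close>).
\<close>

section \<open>Lebesgue measure on the unit interval\<close>

text \<open>
  It lives on the whole real line, so that Borel functions on the line are measurable as they stand
  and maps of the interval need no restriction of their domain.
\<close>

definition leb01 :: "real measure" where
  "leb01 = density lborel (indicator {0..1})"

lemma sets_leb01 [simp, measurable_cong]: "sets leb01 = sets borel"
  and space_leb01 [simp]: "space leb01 = UNIV"
  by (simp_all add: leb01_def)

lemma nn_integral_leb01:
  "f \<in> borel_measurable borel \<Longrightarrow> (\<integral>\<^sup>+x. f x \<partial>leb01) = (\<integral>\<^sup>+x. f x * indicator {0..1} x \<partial>lborel)"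
  unfolding leb01_def by (subst nn_integral_density) (auto simp: mult.commute)

lemma emeasure_leb01: "A \<in> sets borel \<Longrightarrow> emeasure leb01 A = emeasure lborel ({0..1} \<inter> A)"
  unfolding leb01_def by (subst emeasure_density) (auto simp flip: indicator_inter_arith)

interpretation leb01: prob_space leb01
  by (rule prob_spaceI) (simp add: emeasure_leb01)

lemma emeasure_leb01_UNIV [simp]: "emeasure leb01 UNIV = 1"
  using leb01.emeasure_space_1 by simp

lemma prob_leb01_UNIV [simp]: "measure leb01 UNIV = 1"
  using leb01.prob_space by simp

lemma integrable_leb01_bounded:
  fixes f :: "real \<Rightarrow> real"
  assumes "f \<in> borel_measurable borel" "\<And>y. \<bar>f y\<bar> \<le> C"
  shows "integrable leb01 f"
  using assms by (intro leb01.integrable_const_bound[of _ C]) auto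

text \<open>
  Jensen's inequality; it turns second moments for fixed \<open>t\<close> into second moments of the norm
  in \<open>L\<^sup>1(dt)\<close>.
\<close>

lemma square_integral_le:
  fixes f :: "real \<Rightarrow> real"
  assumes f: "f \<in> borel_measurable borel" "\<And>y. \<bar>f y\<bar> \<le> C"
  shows "(\<integral>y. \<bar>f y\<bar> \<partial>leb01)\<^sup>2 \<le> (\<integral>y. (f y)\<^sup>2 \<partial>leb01)"
proof -
  have [measurable]: "f \<in> borel_measurable borel" by (rule f)
  have I1: "integrable leb01 (\<lambda>y. \<bar>f y\<bar>)" using f by (intro integrable_leb01_bounded[of _ C]) auto
  have I2: "integrable leb01 (\<lambda>y. \<bar>f y\<bar>\<^sup>2)"
  proof (rule integrable_leb01_bounded)
    fix y show "\<bar>\<bar>f y\<bar>\<^sup>2\<bar> \<le> C\<^sup>2" using power_mono[OF f(2)[of y], of 2] by simp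
  qed measurable
  show ?thesis
    using leb01.variance_eq[OF I1 I2] leb01.variance_positive[of "\<lambda>y. \<bar>f y\<bar>"] by simp
qed

text \<open>
  A point \<open>a\<close> is represented by its distribution function \<open>t \<mapsto> [a \<le> t]\<close>; the \<open>L\<^sup>1\<close> distance of
  two such functions is the distance of the points. This is used both for the oscillation of block
  sums and for the cost of the quantile coupling.
\<close>

lemma integral_step_difference:
  assumes "a \<in> {0..1}" "b \<in> {0..1::real}"
  shows "(\<integral>\<^sup>+t. ennreal \<bar>of_bool (a \<le> t) - of_bool (b \<le> t)\<bar> \<partial>leb01) = ennreal \<bar>a - b\<bar>"
proof -
  have "(\<lambda>t. ennreal \<bar>of_bool (a \<le> t) - of_bool (b \<le> t)\<bar>) \<in> borel_measurable borel"
    by measurable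
  then have "(\<integral>\<^sup>+t. ennreal \<bar>of_bool (a \<le> t) - of_bool (b \<le> t)\<bar> \<partial>leb01)
      = (\<integral>\<^sup>+t. ennreal \<bar>of_bool (a \<le> t) - of_bool (b \<le> t)\<bar> * indicator {0..1} t \<partial>lborel)"
    by (rule nn_integral_leb01)
  also have "\<dots> = (\<integral>\<^sup>+t. indicator {min a b..<max a b} t \<partial>lborel)"
    using AE_lborel_singleton[of "1::real"] assms
    by (intro nn_integral_cong) (auto split: split_indicator)
  also have "\<dots> = ennreal \<bar>a - b\<bar>" by (auto simp: max_def min_def)
  finally show ?thesis .
qed

lemma integral_step_difference_le:
  assumes "a \<in> {0..1}" "b \<in> {0..1::real}"
  shows "(\<integral>t. \<bar>of_bool (a \<le> t) - of_bool (b \<le> t)\<bar> \<partial>leb01) \<le> \<bar>a - b\<bar>"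
proof -
  have m [measurable]: "(\<lambda>t. \<bar>of_bool (a \<le> t) - of_bool (b \<le> t)\<bar> :: real) \<in> borel_measurable borel"
    by measurable
  have "integrable leb01 (\<lambda>t. \<bar>of_bool (a \<le> t) - of_bool (b \<le> t)\<bar> :: real)"
    by (rule integrable_leb01_bounded[of _ 1, OF m]) auto
  then show ?thesis
    using integral_step_difference[OF assms] by (subst (asm) nn_integral_eq_integral) auto
qed

lemma AE_leb01_open: "AE x in leb01. x \<in> {0<..<1}"
proof -
  have "AE x in lborel. x \<noteq> (0::real)" "AE x in lborel. x \<noteq> (1::real)"
    by (rule AE_lborel_singleton)+
  then have "AE x in lborel. x \<in> {0..1::real} \<longrightarrow> x \<in> {0<..<1}"
    by eventually_elim auto
  then show ?thesis
    unfolding leb01_def by (subst AE_density) (auto simp: indicator_def)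
qed

lemma AE_unit_lebesgue_iff: "(AE x in unit_lebesgue. P x) \<longleftrightarrow> (AE x in leb01. P x)"
  unfolding leb01_def by (subst AE_restrict_space_iff, simp, subst AE_density) (auto simp: indicator_def)

section \<open>Maps whose inverse branches have decreasing derivatives\<close>

text \<open>
  \<open>T\<close> maps the branch interval \<open>[V r 0, V r 1)\<close> onto the one of index \<open>r - 1\<close>, and onto the unit
  interval if \<open>r = 0\<close>; so \<open>V r\<close> is an inverse branch of \<open>T^(r+1)\<close>, and \<open>W r\<close> is its derivative. The branch
  intervals are adjacent, ordered from right to left, and exhaust the open unit interval.
  The last assumption is the only distortion estimate: it compares the largest value of the derivative
  on one branch with its smallest value on the next.
\<close>

locale decreasing_branch_map =
  fixes T :: "real \<Rightarrow> real" and V W :: "nat \<Rightarrow> real \<Rightarrow> real"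
  assumes T_measurable [measurable]: "T \<in> borel_measurable borel"
    and V_measurable [measurable]: "\<And>r. V r \<in> borel_measurable borel"
    and W_measurable [measurable]: "\<And>r. W r \<in> borel_measurable borel"
    and T_V_0: "\<And>z. z \<in> {0..<1} \<Longrightarrow> T (V 0 z) = z"
    and T_V_Suc: "\<And>r z. z \<in> {0..<1} \<Longrightarrow> T (V (Suc r) z) = V r z"
    and V_deriv: "\<And>r z. z \<in> {0..1} \<Longrightarrow> (V r has_real_derivative W r z) (at z)"
    and W_cont: "\<And>r. continuous_on {0..1} (W r)"
    and W_pos: "\<And>r z. z \<in> {0..1} \<Longrightarrow> 0 < W r z"
    and W_le: "\<And>r z. z \<in> {0..1} \<Longrightarrow> W r z \<le> 1/2"
    and W_antimono: "\<And>r. antimono_on {0..1} (W r)"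
    and V_top: "V 0 1 = 1"
    and V_adj: "\<And>r. V (Suc r) 1 = V r 0"
    and V_lim: "(\<lambda>r. V r 0) \<longlonglongrightarrow> 0"
    and W_adj: "\<And>r. W r 0 \<le> 3 * W (Suc r) 1"
begin

lemma V_less:
  assumes "0 \<le> z" "z < z'" "z' \<le> 1"
  shows "V r z < V r z'"
proof (rule DERIV_pos_imp_increasing[OF assms(2)])
  fix x assume "z \<le> x" "x \<le> z'"
  with assms have "x \<in> {0..1}" by auto
  then show "\<exists>y. (V r has_real_derivative y) (at x) \<and> y > 0"
    using V_deriv W_pos by blast
qed

lemma V_le: "0 \<le> z \<Longrightarrow> z \<le> z' \<Longrightarrow> z' \<le> 1 \<Longrightarrow> V r z \<le> V r z'"
  using V_less[of z z' r] by (cases "z = z'") auto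

lemma V_contract:
  assumes "z \<in> {0..1}" "z' \<in> {0..1}"
  shows "\<bar>V r z - V r z'\<bar> \<le> \<bar>z - z'\<bar> / 2"
proof -
  have "norm (V r z - V r z') \<le> 1/2 * norm (z - z')"
  proof (rule field_differentiable_bound[where S = "{0..1}" and f' = "W r"])
    fix x :: real assume x: "x \<in> {0..1}"
    show "(V r has_field_derivative W r x) (at x within {0..1})"
      using V_deriv[OF x] by (rule DERIV_subset) auto
    show "norm (W r x) \<le> 1/2"
      using W_pos[OF x, of r] W_le[OF x, of r] by simp
  qed (use assms in auto)
  then show ?thesis by simp
qed

lemma V_0_decseq: "decseq (\<lambda>r. V r 0)"
proof (rule decseq_SucI)
  fix r show "V (Suc r) 0 \<le> V r 0" using V_adj[of r] V_le[of 0 1 "Suc r"] by simp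
qed

lemma V_0_pos: "0 < V r 0"
proof -
  have "0 \<le> V (Suc r) 0"
    using decseq_ge[OF V_0_decseq V_lim] .
  also have "\<dots> < V r 0" using V_adj[of r] V_less[of 0 1 "Suc r"] by simp
  finally show ?thesis .
qed

lemma V_1_le: "V r 1 \<le> 1"
proof (induction r)
  case (Suc r)
  then show ?case using V_adj[of r] V_le[of 0 1 r] by simp
qed (simp add: V_top)

lemma V_in: "z \<in> {0<..<1} \<Longrightarrow> V r z \<in> {0<..<1}"
  using V_less[of 0 z r] V_less[of z 1 r] V_0_pos[of r] V_1_le[of r] by auto

text \<open>
  On the open unit interval this is the index of the branch interval that contains the point.
\<close>

definition digit :: "real \<Rightarrow> nat" where
  "digit y = (LEAST r. V r 0 \<le> y)"

definition jump :: "real \<Rightarrow> real" where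
  "jump y = (T ^^ Suc (digit y)) y"

lemma digit_measurable [measurable]: "digit \<in> measurable borel (count_space UNIV)"
  unfolding digit_def by measurable

lemma funpow_T_measurable [measurable]: "(T ^^ n) \<in> borel_measurable borel"
  by (induction n) (auto simp: o_def)

lemma jump_measurable [measurable]: "jump \<in> borel_measurable borel"
  unfolding jump_def
  by (rule measurable_compose_countable[where f = "\<lambda>r y. (T ^^ Suc r) y" and g = digit]) measurable

lemma funpow_jump_measurable [measurable]: "(jump ^^ n) \<in> borel_measurable borel"
  by (induction n) (auto simp: o_def)

lemma digit_bounds:
  assumes "y \<in> {0<..<1}"
  shows "V (digit y) 0 \<le> y" "y < V (digit y) 1"
proof -
  have "\<forall>\<^sub>F r in sequentially. V r 0 < y"
    using V_lim assms by (intro order_tendstoD(2)) auto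
  then obtain r where "V r 0 < y" by (auto simp: eventually_sequentially)
  then have "V r 0 \<le> y" by simp
  then show *: "V (digit y) 0 \<le> y" unfolding digit_def by (rule LeastI)
  show "y < V (digit y) 1"
  proof (cases "digit y")
    case 0 then show ?thesis using V_top assms by simp
  next
    case (Suc r)
    then have "\<not> V r 0 \<le> y" unfolding digit_def using not_less_Least by (metis lessI)
    then show ?thesis using Suc V_adj[of r] by simp
  qed
qed

lemma digit_eqI:
  assumes "V r 0 \<le> y" "y < V r 1"
  shows "digit y = r"
  unfolding digit_def
proof (rule Least_equality)
  fix q assume "V q 0 \<le> y"
  show "r \<le> q"
  proof (rule ccontr)
    assume "\<not> r \<le> q"
    then obtain r' where "r = Suc r'" "q \<le> r'" by (cases r) auto
    then have "V r 1 \<le> V q 0" using V_adj[of r'] decseqD[OF V_0_decseq, of q r'] by simp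
    with \<open>V q 0 \<le> y\<close> assms show False by simp
  qed
qed (use assms in auto)

lemma digit_V: "z \<in> {0..<1} \<Longrightarrow> digit (V r z) = r"
  by (rule digit_eqI) (use V_less[of z 1 r] V_le[of 0 z r] in auto)

lemma funpow_T_V: "z \<in> {0..<1} \<Longrightarrow> i \<le> r \<Longrightarrow> (T ^^ i) (V r z) = V (r - i) z"
proof (induction i)
  case (Suc i)
  have "r - i = Suc (r - Suc i)" using Suc.prems by simp
  then show ?case using Suc T_V_Suc[of z "r - Suc i"] by simp
qed simp

lemma jump_V: "z \<in> {0..<1} \<Longrightarrow> jump (V r z) = z"
  by (simp add: jump_def digit_V funpow_T_V T_V_0)

text \<open>
  The left endpoint of a branch interval belongs to it and has \<open>jump y = 0\<close>, so jumps may leave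
  the open interval; this happens only on a null set.
\<close>

lemma V_jump:
  assumes "y \<in> {0<..<1}"
  shows "V (digit y) (jump y) = y" "jump y \<in> {0..<1}"
proof -
  let ?r = "digit y"
  have "continuous_on {0..1} (V ?r)"
    using V_deriv by (intro continuous_at_imp_continuous_on ballI DERIV_isCont) blast
  then obtain z where z: "0 \<le> z" "z \<le> 1" "V ?r z = y"
    using IVT'[of "V ?r" 0 y 1] digit_bounds[OF assms(1)] by auto
  moreover have "z \<noteq> 1" using z digit_bounds[OF assms(1)] by auto
  ultimately have "z \<in> {0..<1}" by auto
  moreover from this have "jump y = z" using jump_V[of z ?r] z by simp
  ultimately show "V (digit y) (jump y) = y" "jump y \<in> {0..<1}" using z by auto
qed

lemma nn_integral_branch:
  fixes F :: "real \<Rightarrow> ennreal"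
  assumes F [measurable]: "F \<in> borel_measurable borel"
  shows "(\<integral>\<^sup>+y. F y * indicator {V r 0..<V r 1} y \<partial>leb01) = (\<integral>\<^sup>+z. ennreal (W r z) * F (V r z) \<partial>leb01)"
proof -
  have sub: "{V r 0..<V r 1} \<subseteq> {0..1}"
    using V_0_pos[of r] V_1_le[of r] by auto
  have "(\<integral>\<^sup>+y. F y * indicator {V r 0..<V r 1} y \<partial>leb01)
      = (\<integral>\<^sup>+y. F y * indicator {V r 0..<V r 1} y \<partial>lborel)"
    using sub by (subst nn_integral_leb01) (auto intro!: nn_integral_cong split: split_indicator)
  also have "\<dots> = (\<integral>\<^sup>+y. F y * indicator {V r 0..V r 1} y \<partial>lborel)"
    using AE_lborel_singleton[of "V r 1"]
    by (intro nn_integral_cong_AE) (auto elim!: eventually_mono split: split_indicator)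
  also have "\<dots> = (\<integral>\<^sup>+z. F (V r z) * W r z * indicator {0..1} z \<partial>lborel)"
    by (rule nn_integral_substitution_aux) (auto intro: V_deriv W_cont less_imp_le[OF W_pos])
  also have "\<dots> = (\<integral>\<^sup>+z. ennreal (W r z) * F (V r z) \<partial>leb01)"
    by (subst nn_integral_leb01) (auto simp: mult_ac)
  finally show ?thesis .
qed

lemma nn_integral_branches:
  fixes F :: "real \<Rightarrow> ennreal"
  assumes F [measurable]: "F \<in> borel_measurable borel"
  shows "(\<integral>\<^sup>+y. F y \<partial>leb01) = (\<Sum>r. \<integral>\<^sup>+z. ennreal (W r z) * F (V r z) \<partial>leb01)"
proof -
  have "(\<Sum>r. F y * indicator {V r 0..<V r 1} y) = F y" if y: "y \<in> {0<..<1}" for y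
  proof -
    have "(\<Sum>r. F y * indicator {V r 0..<V r 1} y) = (\<Sum>r\<in>{digit y}. F y * indicator {V r 0..<V r 1} y)"
      by (rule suminf_finite) (use digit_eqI in \<open>auto split: split_indicator\<close>)
    then show ?thesis using digit_bounds[OF y] by simp
  qed
  then have "(\<integral>\<^sup>+y. F y \<partial>leb01) = (\<integral>\<^sup>+y. (\<Sum>r. F y * indicator {V r 0..<V r 1} y) \<partial>leb01)"
    by (intro nn_integral_cong_AE) (use AE_leb01_open in eventually_elim, simp)
  also have "\<dots> = (\<Sum>r. \<integral>\<^sup>+y. F y * indicator {V r 0..<V r 1} y \<partial>leb01)"
    by (rule nn_integral_suminf) measurable
  finally show ?thesis by (simp add: nn_integral_branch)
qed

section \<open>The transfer operator and loss of memory\<close>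

text \<open>
  The density of the law of \<open>jump y\<close> when \<open>y\<close> has density \<open>f\<close> (see \<open>nn_integral_transfer\<close>).
\<close>

definition transfer :: "(real \<Rightarrow> ennreal) \<Rightarrow> real \<Rightarrow> ennreal" where
  "transfer f z = (\<Sum>r. ennreal (W r z) * f (V r z))"

lemma transfer_measurable [measurable]:
  assumes [measurable]: "f \<in> borel_measurable borel"
  shows "transfer f \<in> borel_measurable borel"
  unfolding transfer_def by measurable

lemma nn_integral_transfer:
  assumes [measurable]: "f \<in> borel_measurable borel" "u \<in> borel_measurable borel"
  shows "(\<integral>\<^sup>+y. f y * u (jump y) \<partial>leb01) = (\<integral>\<^sup>+z. transfer f z * u z \<partial>leb01)"
proof -
  have "(\<integral>\<^sup>+y. f y * u (jump y) \<partial>leb01)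
      = (\<Sum>r. \<integral>\<^sup>+z. ennreal (W r z) * (f (V r z) * u (jump (V r z))) \<partial>leb01)"
    by (rule nn_integral_branches) measurable
  also have "\<dots> = (\<Sum>r. \<integral>\<^sup>+z. (ennreal (W r z) * f (V r z)) * u z \<partial>leb01)"
    by (intro suminf_cong nn_integral_cong_AE) (use AE_leb01_open in \<open>eventually_elim, simp add: jump_V mult_ac\<close>)
  also have "\<dots> = (\<integral>\<^sup>+z. (\<Sum>r. (ennreal (W r z) * f (V r z)) * u z) \<partial>leb01)"
    by (rule nn_integral_suminf[symmetric]) measurable
  finally show ?thesis by (simp add: transfer_def)
qed

lemma nn_integral_transfer_funpow:
  assumes [measurable]: "f \<in> borel_measurable borel" "u \<in> borel_measurable borel"
  shows "(\<integral>\<^sup>+y. f y * u ((jump ^^ n) y) \<partial>leb01) = (\<integral>\<^sup>+z. (transfer ^^ n) f z * u z \<partial>leb01)"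
    and "(transfer ^^ n) f \<in> borel_measurable borel"
proof -
  have "(transfer ^^ n) f \<in> borel_measurable borel \<and>
    (\<forall>u\<in>borel_measurable borel. (\<integral>\<^sup>+y. f y * u ((jump ^^ n) y) \<partial>leb01) = (\<integral>\<^sup>+z. (transfer ^^ n) f z * u z \<partial>leb01))"
  proof (induction n)
    case (Suc n)
    then have [measurable]: "(transfer ^^ n) f \<in> borel_measurable borel" by simp
    have "(\<integral>\<^sup>+y. f y * u ((jump ^^ Suc n) y) \<partial>leb01) = (\<integral>\<^sup>+z. (transfer ^^ Suc n) f z * u z \<partial>leb01)"
      if [measurable]: "u \<in> borel_measurable borel" for u :: "real \<Rightarrow> ennreal"
    proof -
      have "(\<lambda>y. u (jump y)) \<in> borel_measurable borel" by measurable
      from bspec[OF conjunct2[OF Suc.IH] this] have "(\<integral>\<^sup>+y. f y * u (jump ((jump ^^ n) y)) \<partial>leb01) = (\<integral>\<^sup>+z. (transfer ^^ n) f z * u (jump z) \<partial>leb01)" .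
      then show ?thesis by (simp add: nn_integral_transfer)
    qed
    then show ?case by simp
  qed auto
  then show "(\<integral>\<^sup>+y. f y * u ((jump ^^ n) y) \<partial>leb01) = (\<integral>\<^sup>+z. (transfer ^^ n) f z * u z \<partial>leb01)"
    and "(transfer ^^ n) f \<in> borel_measurable borel"
    using assms(2) by (simp_all del: funpow.simps)
qed

lemma antimono_transfer_summand:
  fixes f :: "real \<Rightarrow> ennreal"
  assumes "antimono_on {0<..<1} (\<lambda>z. f (V r z))"
  shows "antimono_on {0<..<1} (\<lambda>z. ennreal (W r z) * f (V r z))"
proof (rule monotone_onI)
  fix x y :: real assume xy: "x \<in> {0<..<1}" "y \<in> {0<..<1}" "x \<le> y"
  then have "W r y \<le> W r x"
    using monotone_onD[OF W_antimono[of r], of x y] by auto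
  then show "ennreal (W r y) * f (V r y) \<le> ennreal (W r x) * f (V r x)"
    using monotone_onD[OF assms xy] by (intro mult_mono ennreal_leI) auto
qed

text \<open>
  The function itself need not be decreasing, only its restriction to each branch; block sums of
  visits enjoy just this weaker property.
\<close>

lemma antimono_transfer:
  assumes "\<And>r. antimono_on {0<..<1} (\<lambda>z. f (V r z))"
  shows "antimono_on {0<..<1} (transfer f)"
  unfolding transfer_def
  by (intro monotone_onI suminf_le) (use monotone_onD[OF antimono_transfer_summand[OF assms]] in auto)

lemma antimono_comp_V:
  fixes f :: "real \<Rightarrow> ennreal"
  assumes "antimono_on {0<..<1} f"
  shows "antimono_on {0<..<1} (\<lambda>z. f (V r z))"
  by (intro monotone_onI monotone_onD[OF assms]) (use V_le V_in in auto)

text \<open>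
  The summand of index \<open>r\<close> at \<open>z\<close> is compared with the summand of index \<open>r + 1\<close> at \<open>z'\<close>: the
  interval of branch \<open>r + 1\<close> lies to the left, where a decreasing \<open>f\<close> is larger, and the derivatives
  differ by a factor of at most 3. Note that the bound does not depend on the oscillation of \<open>f\<close>.
\<close>

lemma transfer_le_3:
  assumes f: "antimono_on {0<..<1} f" and z: "z \<in> {0<..<1}" "z' \<in> {0<..<1}"
  shows "transfer f z \<le> 3 * transfer f z'"
proof -
  have *: "ennreal (W r z) * f (V r z) \<le> 3 * (ennreal (W (Suc r) z') * f (V (Suc r) z'))" for r
  proof -
    have "W r z \<le> W r 0" using monotone_onD[OF W_antimono[of r], of 0 z] z by auto
    also have "\<dots> \<le> 3 * W (Suc r) 1" by (rule W_adj)
    also have "W (Suc r) 1 \<le> W (Suc r) z'" using monotone_onD[OF W_antimono[of "Suc r"], of z' 1] z by auto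
    finally have "ennreal (W r z) \<le> ennreal (3 * W (Suc r) z')" by (simp add: ennreal_leI)
    also have "\<dots> = 3 * ennreal (W (Suc r) z')" by (subst ennreal_mult) (use W_pos[of z' "Suc r"] z in auto)
    finally have "ennreal (W r z) \<le> 3 * ennreal (W (Suc r) z')" .
    moreover have "V (Suc r) z' \<le> V r z"
      using V_le[of z' 1 "Suc r"] V_le[of 0 z r] V_adj[of r] z by auto
    then have "f (V r z) \<le> f (V (Suc r) z')"
      by (intro monotone_onD[OF f] V_in z) auto
    ultimately show ?thesis by (simp add: mult.assoc[symmetric] mult_mono)
  qed
  have "transfer f z \<le> (\<Sum>r. 3 * (ennreal (W (Suc r) z') * f (V (Suc r) z')))"
    unfolding transfer_def by (intro suminf_le *) auto
  also have "\<dots> = 3 * (\<Sum>r. ennreal (W (Suc r) z') * f (V (Suc r) z'))" by simp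
  also have "(\<Sum>r. ennreal (W (Suc r) z') * f (V (Suc r) z')) \<le> transfer f z'"
    unfolding transfer_def
    by (subst suminf_offset[of "\<lambda>r. ennreal (W r z') * f (V r z')" 1]) auto
  finally show ?thesis by (simp add: mult_left_mono)
qed

lemma transfer_mass:
  assumes [measurable]: "f \<in> borel_measurable borel"
  shows "(\<integral>\<^sup>+z. transfer f z \<partial>leb01) = (\<integral>\<^sup>+z. f z \<partial>leb01)"
  using nn_integral_transfer[of f "\<lambda>_. 1"] by simp

lemma transfer_le_mass:
  assumes [measurable]: "f \<in> borel_measurable borel"
    and f: "antimono_on {0<..<1} f" and z: "z \<in> {0<..<1}"
  shows "transfer f z \<le> 3 * (\<integral>\<^sup>+z. f z \<partial>leb01)"
proof -
  have "transfer f z = (\<integral>\<^sup>+z'. transfer f z \<partial>leb01)"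
    using leb01.emeasure_space_1 by simp
  also have "\<dots> \<le> (\<integral>\<^sup>+z'. 3 * transfer f z' \<partial>leb01)"
    by (intro nn_integral_mono_AE) (rule eventually_mono[OF AE_leb01_open transfer_le_3[OF f z]])
  also have "\<dots> = 3 * (\<integral>\<^sup>+z. f z \<partial>leb01)"
    by (subst nn_integral_cmult) (auto simp: transfer_mass)
  finally show ?thesis .
qed

lemma transfer_ge_mass:
  assumes [measurable]: "f \<in> borel_measurable borel"
    and f: "antimono_on {0<..<1} f" and z: "z \<in> {0<..<1}"
  shows "(\<integral>\<^sup>+z. f z \<partial>leb01) \<le> 3 * transfer f z"
proof -
  have "(\<integral>\<^sup>+z. f z \<partial>leb01) = (\<integral>\<^sup>+z'. transfer f z' \<partial>leb01)"
    by (simp add: transfer_mass)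
  also have "\<dots> \<le> (\<integral>\<^sup>+z'. 3 * transfer f z \<partial>leb01)"
    by (intro nn_integral_mono_AE) (rule eventually_mono[OF AE_leb01_open transfer_le_3[OF f _ z]])
  finally show ?thesis using leb01.emeasure_space_1 by simp
qed

text \<open>
  One step makes a decreasing density of mass \<open>a\<close> at least \<open>a/3\<close>. Writing it as the constant
  \<open>a/3\<close> plus \<open>2/3\<close> times another decreasing density of mass \<open>a\<close>, the constants cancel when two
  densities are compared, and the remainders are treated by induction.
\<close>

lemma mixing:
  fixes f g u :: "real \<Rightarrow> ennreal"
  assumes "f \<in> borel_measurable borel" "antimono_on {0<..<1} f" "(\<integral>\<^sup>+y. f y \<partial>leb01) = ennreal a"
    and "g \<in> borel_measurable borel" "antimono_on {0<..<1} g" "(\<integral>\<^sup>+y. g y \<partial>leb01) = ennreal a"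
    and "0 \<le> a" and u [measurable]: "u \<in> borel_measurable borel"
  shows "(\<integral>\<^sup>+y. f y * u ((jump ^^ Suc j) y) \<partial>leb01)
    \<le> (\<integral>\<^sup>+y. g y * u ((jump ^^ Suc j) y) \<partial>leb01) + ennreal (3 * (2/3) ^ j * a) * (\<integral>\<^sup>+y. u y \<partial>leb01)"
  using assms(1-6)
proof (induction j arbitrary: f g)
  case 0
  note [measurable] = "0.prems"(1,4)
  have "(\<integral>\<^sup>+y. f y * u (jump y) \<partial>leb01) = (\<integral>\<^sup>+y. transfer f y * u y \<partial>leb01)"
    by (rule nn_integral_transfer) measurable
  also have "\<dots> \<le> (\<integral>\<^sup>+y. ennreal (3 * a) * u y \<partial>leb01)"
    using transfer_le_mass[OF "0.prems"(1,2)] \<open>0 \<le> a\<close>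
    by (intro nn_integral_mono_AE)
       (use AE_leb01_open in \<open>eventually_elim, auto simp: "0.prems"(3) ennreal_mult intro!: mult_right_mono\<close>)
  also have "\<dots> = ennreal (3 * a) * (\<integral>\<^sup>+y. u y \<partial>leb01)" by (rule nn_integral_cmult) measurable
  finally show ?case by (simp add: add_increasing)
next
  case (Suc j)
  note [measurable] = Suc.prems(1,4)
  \<comment> \<open>what is left of \<open>transfer f\<close> after removing the constant \<open>a/3\<close>, rescaled to mass \<open>a\<close>\<close>
  define excess where "excess f z = ennreal (3/2) * (transfer f z - ennreal (a/3))" for f z
  have excess: "excess f \<in> borel_measurable borel" "antimono_on {0<..<1} (excess f)"
      "(\<integral>\<^sup>+y. excess f y \<partial>leb01) = ennreal a"
      "(\<integral>\<^sup>+y. f y * u ((jump ^^ Suc (Suc j)) y) \<partial>leb01)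
        = ennreal (a/3) * (\<integral>\<^sup>+y. u ((jump ^^ Suc j) y) \<partial>leb01)
        + ennreal (2/3) * (\<integral>\<^sup>+y. excess f y * u ((jump ^^ Suc j) y) \<partial>leb01)"
    if f: "f \<in> borel_measurable borel" "antimono_on {0<..<1} f" "(\<integral>\<^sup>+y. f y \<partial>leb01) = ennreal a" for f
  proof -
    note [measurable] = f(1)
    show excess_m [measurable]: "excess f \<in> borel_measurable borel" unfolding excess_def by measurable
    have anti: "antimono_on {0<..<1} (transfer f)"
      by (intro antimono_transfer antimono_comp_V f)
    show "antimono_on {0<..<1} (excess f)"
      unfolding excess_def
      by (intro monotone_onI mult_left_mono ennreal_minus_mono monotone_onD[OF anti]) auto
    have ge: "ennreal (a/3) \<le> transfer f z" if "z \<in> {0<..<1}" for z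
    proof -
      have "ennreal (1/3) * ennreal a \<le> ennreal (1/3) * (3 * transfer f z)"
        using transfer_ge_mass[OF f(1,2) that] f(3) by (intro mult_left_mono) auto
      moreover have "ennreal (1/3) * (3 * transfer f z) = transfer f z"
      proof -
        have "ennreal (1/3) * 3 = ennreal (1/3 * 3)" by (subst ennreal_mult) auto
        then show ?thesis by (simp add: mult.assoc[symmetric])
      qed
      moreover have "ennreal (1/3) * ennreal a = ennreal (a/3)"
        using \<open>0 \<le> a\<close> by (simp flip: ennreal_mult)
      ultimately show ?thesis by simp
    qed
    have "(\<integral>\<^sup>+y. excess f y \<partial>leb01) = ennreal (3/2) * ((\<integral>\<^sup>+y. transfer f y \<partial>leb01) - (\<integral>\<^sup>+y. ennreal (a/3) \<partial>leb01))"
      unfolding excess_def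
      by (subst nn_integral_cmult, measurable, subst nn_integral_diff)
         (auto simp: leb01.emeasure_space_1 intro!: eventually_mono[OF AE_leb01_open ge])
    also have "\<dots> = ennreal (3/2) * (ennreal a - ennreal (a/3))"
      by (simp add: transfer_mass f(3) leb01.emeasure_space_1)
    also have "\<dots> = ennreal (3/2 * (a - a/3))"
      using \<open>0 \<le> a\<close> by (subst ennreal_minus, simp, subst ennreal_mult) auto
    finally show "(\<integral>\<^sup>+y. excess f y \<partial>leb01) = ennreal a" by simp
    have split: "transfer f z = ennreal (a/3) + ennreal (2/3) * excess f z" if "z \<in> {0<..<1}" for z
    proof -
      have "ennreal (2/3) * ennreal (3/2) = 1" by (simp flip: ennreal_mult)
      then have "ennreal (2/3) * excess f z = transfer f z - ennreal (a/3)"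
        unfolding excess_def by (simp add: mult.assoc[symmetric])
      then show ?thesis using ge[OF that] by (simp add: add_diff_inverse_ennreal)
    qed
    have "(\<integral>\<^sup>+y. f y * u ((jump ^^ Suc (Suc j)) y) \<partial>leb01)
        = (\<integral>\<^sup>+y. f y * (\<lambda>z. u ((jump ^^ Suc j) z)) (jump y) \<partial>leb01)"
      by (simp add: funpow_Suc_right del: funpow.simps)
    also have "\<dots> = (\<integral>\<^sup>+y. transfer f y * u ((jump ^^ Suc j) y) \<partial>leb01)"
      by (subst nn_integral_transfer) auto
    also have "\<dots> = (\<integral>\<^sup>+y. ennreal (a/3) * u ((jump ^^ Suc j) y)
        + ennreal (2/3) * (excess f y * u ((jump ^^ Suc j) y)) \<partial>leb01)"
      by (intro nn_integral_cong_AE)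
         (use AE_leb01_open in \<open>eventually_elim, simp add: split distrib_right mult.assoc del: funpow.simps\<close>)
    also have "\<dots> = ennreal (a/3) * (\<integral>\<^sup>+y. u ((jump ^^ Suc j) y) \<partial>leb01)
        + ennreal (2/3) * (\<integral>\<^sup>+y. excess f y * u ((jump ^^ Suc j) y) \<partial>leb01)"
      by (subst nn_integral_add, simp, simp, subst nn_integral_cmult, simp, subst nn_integral_cmult) auto
    finally show "(\<integral>\<^sup>+y. f y * u ((jump ^^ Suc (Suc j)) y) \<partial>leb01)
        = ennreal (a/3) * (\<integral>\<^sup>+y. u ((jump ^^ Suc j) y) \<partial>leb01)
        + ennreal (2/3) * (\<integral>\<^sup>+y. excess f y * u ((jump ^^ Suc j) y) \<partial>leb01)" .
  qed
  note ef = excess[OF Suc.prems(1-3)] and eg = excess[OF Suc.prems(4-6)]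
  have "ennreal (2/3) * (\<integral>\<^sup>+y. excess f y * u ((jump ^^ Suc j) y) \<partial>leb01)
      \<le> ennreal (2/3) * ((\<integral>\<^sup>+y. excess g y * u ((jump ^^ Suc j) y) \<partial>leb01)
          + ennreal (3 * (2/3) ^ j * a) * (\<integral>\<^sup>+y. u y \<partial>leb01))"
    by (intro mult_left_mono Suc.IH ef(1-3) eg(1-3)) auto
  also have "\<dots> = ennreal (2/3) * (\<integral>\<^sup>+y. excess g y * u ((jump ^^ Suc j) y) \<partial>leb01)
      + ennreal (3 * (2/3) ^ Suc j * a) * (\<integral>\<^sup>+y. u y \<partial>leb01)"
  proof -
    have "ennreal (3 * (2/3) ^ Suc j * a) = ennreal (2/3) * ennreal (3 * (2/3) ^ j * a)"
      using \<open>0 \<le> a\<close> by (subst ennreal_mult[symmetric]) (auto simp: mult_ac)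
    then show ?thesis by (simp only: distrib_left mult.assoc)
  qed
  finally show ?case unfolding ef(4) eg(4) by (simp only: add.assoc add_left_mono)
qed

text \<open>
  The density of the law of the \<open>n\<close>-th jump of a uniformly distributed point.
\<close>

abbreviation (input) pushed_density :: "nat \<Rightarrow> real \<Rightarrow> ennreal" where
  "pushed_density n \<equiv> (transfer ^^ n) (\<lambda>_. 1)"

lemma pushed_density_measurable [measurable]: "pushed_density n \<in> borel_measurable borel"
  by (induction n) auto

lemma pushed_density_antimono: "antimono_on {0<..<1} (pushed_density n)"
proof (induction n)
  case 0
  then show ?case by (auto intro: monotone_onI)
next
  case (Suc n)
  then show ?case by (simp add: antimono_transfer antimono_comp_V)
qed

lemma nn_integral_pushed_density:
  "u \<in> borel_measurable borel \<Longrightarrow> (\<integral>\<^sup>+y. pushed_density n y * u y \<partial>leb01) = (\<integral>\<^sup>+y. u ((jump ^^ n) y) \<partial>leb01)"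
  using nn_integral_transfer_funpow(1)[of "\<lambda>_. 1" u n] by simp

lemma pushed_density_mass: "(\<integral>\<^sup>+y. pushed_density n y \<partial>leb01) = 1"
  using nn_integral_pushed_density[of "\<lambda>_. 1" n] leb01.emeasure_space_1 by simp

lemma nn_integral_jump_le:
  assumes [measurable]: "u \<in> borel_measurable borel"
  shows "(\<integral>\<^sup>+y. u ((jump ^^ n) y) \<partial>leb01) \<le> 3 * (\<integral>\<^sup>+y. u y \<partial>leb01)"
proof (cases n)
  case 0
  have "1 * (\<integral>\<^sup>+y. u y \<partial>leb01) \<le> 3 * (\<integral>\<^sup>+y. u y \<partial>leb01)" by (intro mult_right_mono) auto
  then show ?thesis using 0 by simp
next
  case (Suc m)
  have "(\<integral>\<^sup>+y. u ((jump ^^ n) y) \<partial>leb01) = (\<integral>\<^sup>+y. pushed_density n y * u y \<partial>leb01)"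
    by (simp add: nn_integral_pushed_density)
  also have "\<dots> \<le> (\<integral>\<^sup>+y. 3 * u y \<partial>leb01)"
    using transfer_le_mass[OF pushed_density_measurable pushed_density_antimono, of _ m]
    by (intro nn_integral_mono_AE)
      (use AE_leb01_open in \<open>eventually_elim, auto simp: Suc pushed_density_mass intro!: mult_right_mono\<close>)
  finally show ?thesis by (simp add: nn_integral_cmult)
qed

lemma AE_jump:
  assumes "AE y in leb01. P y"
  shows "AE y in leb01. P ((jump ^^ n) y)"
proof -
  from assms obtain N where N: "{y. \<not> P y} \<subseteq> N" "emeasure leb01 N = 0" "N \<in> sets borel"
    by (auto elim!: AE_E)
  then have [measurable]: "N \<in> sets borel" by simp
  have "(\<integral>\<^sup>+y. indicator N ((jump ^^ n) y) \<partial>leb01) \<le> 3 * (\<integral>\<^sup>+y. indicator N y \<partial>leb01)"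
    by (rule nn_integral_jump_le) measurable
  then have "(\<integral>\<^sup>+y. indicator N ((jump ^^ n) y) \<partial>leb01) = 0" using N by simp
  then have "AE y in leb01. indicator N ((jump ^^ n) y) = (0::ennreal)"
    by (subst (asm) nn_integral_0_iff_AE) auto
  then show ?thesis
    by eventually_elim (use N in \<open>auto simp: indicator_def split: if_splits\<close>)
qed

lemma integrable_jump:
  fixes u :: "real \<Rightarrow> real"
  assumes u: "integrable leb01 u"
  shows "integrable leb01 (\<lambda>y. u ((jump ^^ n) y))"
    and "(\<integral>y. \<bar>u ((jump ^^ n) y)\<bar> \<partial>leb01) \<le> 3 * (\<integral>y. \<bar>u y\<bar> \<partial>leb01)"
    and "\<bar>\<integral>y. u ((jump ^^ n) y) \<partial>leb01\<bar> \<le> 3 * (\<integral>y. \<bar>u y\<bar> \<partial>leb01)"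
proof -
  have [measurable]: "u \<in> borel_measurable borel" using borel_measurable_integrable[OF u] by simp
  have *: "(\<integral>\<^sup>+y. ennreal \<bar>u ((jump ^^ n) y)\<bar> \<partial>leb01) \<le> 3 * (\<integral>\<^sup>+y. ennreal \<bar>u y\<bar> \<partial>leb01)"
    using nn_integral_jump_le[of "\<lambda>y. ennreal \<bar>u y\<bar>" n] by simp
  also have "(\<integral>\<^sup>+y. ennreal \<bar>u y\<bar> \<partial>leb01) = ennreal (\<integral>y. \<bar>u y\<bar> \<partial>leb01)"
    using u by (intro nn_integral_eq_integral) auto
  also have "3 * \<dots> = ennreal (3 * (\<integral>y. \<bar>u y\<bar> \<partial>leb01))"
    by (subst ennreal_mult) auto
  finally have **: "(\<integral>\<^sup>+y. ennreal \<bar>u ((jump ^^ n) y)\<bar> \<partial>leb01) \<le> ennreal (3 * (\<integral>y. \<bar>u y\<bar> \<partial>leb01))" .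
  show int: "integrable leb01 (\<lambda>y. u ((jump ^^ n) y))"
    using ** by (intro integrableI_bounded) (auto simp: less_top top_unique intro: le_less_trans)
  show le: "(\<integral>y. \<bar>u ((jump ^^ n) y)\<bar> \<partial>leb01) \<le> 3 * (\<integral>y. \<bar>u y\<bar> \<partial>leb01)"
    using ** int by (subst (asm) nn_integral_eq_integral) auto
  show "\<bar>\<integral>y. u ((jump ^^ n) y) \<partial>leb01\<bar> \<le> 3 * (\<integral>y. \<bar>u y\<bar> \<partial>leb01)"
    using le integral_abs_bound[of leb01 "\<lambda>y. u ((jump ^^ n) y)"] by linarith
qed

section \<open>Decay of correlations\<close>

definition branch_antimono :: "(real \<Rightarrow> real) \<Rightarrow> bool" where
  "branch_antimono g \<longleftrightarrow> (\<forall>r. antimono_on {0<..<1} (\<lambda>z. g (V r z)))"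

text \<open>
  Take \<open>g\<close> of the \<open>i\<close>-th jump as a weight. After one further jump the weighted law of the point has
  a decreasing density, because \<open>g\<close> is decreasing on each branch, so \<open>mixing\<close> compares it with the
  unweighted law after \<open>n\<close> jumps, scaled to the same mass.
\<close>

lemma weighted_mixing:
  fixes g u :: "real \<Rightarrow> real"
  assumes g [measurable]: "g \<in> borel_measurable borel" "\<And>y. 0 \<le> g y" "branch_antimono g" "integrable leb01 g"
    and u: "integrable leb01 u" "\<And>y. 0 \<le> u y"
    and gu: "integrable leb01 (\<lambda>y. g ((jump ^^ i) y) * u ((jump ^^ (i + k + 2)) y))"
  shows "\<bar>(\<integral>y. g ((jump ^^ i) y) * u ((jump ^^ (i + k + 2)) y) \<partial>leb01)
      - (\<integral>y. g ((jump ^^ i) y) \<partial>leb01) * (\<integral>y. u ((jump ^^ (n + k + 1)) y) \<partial>leb01)\<bar>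
    \<le> 3 * (2/3) ^ k * (\<integral>y. g ((jump ^^ i) y) \<partial>leb01) * (\<integral>y. u y \<partial>leb01)"
proof -
  have um [measurable]: "u \<in> borel_measurable borel" using borel_measurable_integrable[OF u(1)] by simp
  define a where "a = (\<integral>y. g ((jump ^^ i) y) \<partial>leb01)"
  have a: "0 \<le> a" unfolding a_def using g by (intro integral_nonneg_AE) auto
  let ?u = "\<lambda>y. ennreal (u y)"
  define f1 where "f1 = (\<lambda>y. pushed_density i y * ennreal (g y))"
  define f where "f = transfer f1"
  define h where "h y = ennreal a * pushed_density n y" for y
  have f1_m [measurable]: "f1 \<in> borel_measurable borel" unfolding f1_def by measurable
  have f_m [measurable]: "f \<in> borel_measurable borel" unfolding f_def by measurable
  have h_m [measurable]: "h \<in> borel_measurable borel" unfolding h_def by measurable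
  have f_int: "(\<integral>\<^sup>+y. f y * v y \<partial>leb01) = (\<integral>\<^sup>+y. ennreal (g ((jump ^^ i) y)) * v ((jump ^^ (i+1)) y) \<partial>leb01)"
    if [measurable]: "v \<in> borel_measurable borel" for v
  proof -
    have "(\<integral>\<^sup>+y. f y * v y \<partial>leb01) = (\<integral>\<^sup>+y. pushed_density i y * (ennreal (g y) * v (jump y)) \<partial>leb01)"
      unfolding f_def by (subst nn_integral_transfer[symmetric]) (auto simp: f1_def mult_ac)
    also have "\<dots> = (\<integral>\<^sup>+y. ennreal (g ((jump ^^ i) y)) * v (jump ((jump ^^ i) y)) \<partial>leb01)"
      by (rule nn_integral_pushed_density) measurable
    finally show ?thesis by simp
  qed
  have f_mass: "(\<integral>\<^sup>+y. f y \<partial>leb01) = ennreal a"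
    using f_int[of "\<lambda>_. 1"] integrable_jump(1)[OF g(4)] g(2)
    by (simp add: a_def nn_integral_eq_integral)
  have f_anti: "antimono_on {0<..<1} f"
    unfolding f_def f1_def
  proof (intro antimono_transfer monotone_onI mult_mono ennreal_leI)
    fix r and x y :: real assume xy: "x \<in> {0<..<1}" "y \<in> {0<..<1}" "x \<le> y"
    show "pushed_density i (V r y) \<le> pushed_density i (V r x)"
      using monotone_onD[OF antimono_comp_V[OF pushed_density_antimono] xy] .
    show "g (V r y) \<le> g (V r x)"
      using g(3) xy unfolding branch_antimono_def monotone_on_def by blast
  qed auto
  have h_mass: "(\<integral>\<^sup>+y. h y \<partial>leb01) = ennreal a"
    unfolding h_def by (subst nn_integral_cmult) (auto simp: pushed_density_mass)
  have h_anti: "antimono_on {0<..<1} h"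
    unfolding h_def
    by (intro monotone_onI mult_left_mono monotone_onD[OF pushed_density_antimono]) auto
  have F: "(\<integral>\<^sup>+y. f y * ?u ((jump ^^ Suc k) y) \<partial>leb01)
      = ennreal (\<integral>y. g ((jump ^^ i) y) * u ((jump ^^ (i + k + 2)) y) \<partial>leb01)"
  proof -
    have "(\<integral>\<^sup>+y. f y * ?u ((jump ^^ Suc k) y) \<partial>leb01)
        = (\<integral>\<^sup>+y. ennreal (g ((jump ^^ i) y)) * ?u ((jump ^^ Suc k) ((jump ^^ (i + 1)) y)) \<partial>leb01)"
      by (rule f_int) measurable
    also have "\<dots> = (\<integral>\<^sup>+y. ennreal (g ((jump ^^ i) y) * u ((jump ^^ (i + k + 2)) y)) \<partial>leb01)"
    proof (rule nn_integral_cong)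
      fix y
      have "(jump ^^ Suc k) ((jump ^^ (i + 1)) y) = (jump ^^ (Suc k + (i + 1))) y"
        by (simp only: funpow_add o_apply)
      moreover have "Suc k + (i + 1) = i + k + 2" by simp
      ultimately show "ennreal (g ((jump ^^ i) y)) * ?u ((jump ^^ Suc k) ((jump ^^ (i + 1)) y))
          = ennreal (g ((jump ^^ i) y) * u ((jump ^^ (i + k + 2)) y))"
        using g(2) u(2) by (simp only: ennreal_mult)
    qed
    also have "\<dots> = ennreal (\<integral>y. g ((jump ^^ i) y) * u ((jump ^^ (i + k + 2)) y) \<partial>leb01)"
      using g(2) u(2) by (intro nn_integral_eq_integral gu) auto
    finally show ?thesis .
  qed
  have Hh: "(\<integral>\<^sup>+y. h y * ?u ((jump ^^ Suc k) y) \<partial>leb01)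
      = ennreal (a * (\<integral>y. u ((jump ^^ (n + k + 1)) y) \<partial>leb01))"
  proof -
    have "(\<integral>\<^sup>+y. h y * ?u ((jump ^^ Suc k) y) \<partial>leb01)
        = ennreal a * (\<integral>\<^sup>+y. pushed_density n y * ?u ((jump ^^ Suc k) y) \<partial>leb01)"
      unfolding h_def by (subst nn_integral_cmult[symmetric]) (auto simp: mult_ac simp del: funpow.simps)
    also have "(\<integral>\<^sup>+y. pushed_density n y * ?u ((jump ^^ Suc k) y) \<partial>leb01)
        = (\<integral>\<^sup>+y. ?u ((jump ^^ Suc k) ((jump ^^ n) y)) \<partial>leb01)"
      by (rule nn_integral_pushed_density) measurable
    also have "\<dots> = (\<integral>\<^sup>+y. ?u ((jump ^^ (n + k + 1)) y) \<partial>leb01)"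
    proof (rule nn_integral_cong)
      fix y
      have "(jump ^^ Suc k) ((jump ^^ n) y) = (jump ^^ (Suc k + n)) y"
        by (simp only: funpow_add o_apply)
      moreover have "Suc k + n = n + k + 1" by simp
      ultimately show "?u ((jump ^^ Suc k) ((jump ^^ n) y)) = ?u ((jump ^^ (n + k + 1)) y)" by (simp only:)
    qed
    also have "\<dots> = ennreal (\<integral>y. u ((jump ^^ (n + k + 1)) y) \<partial>leb01)"
      using u(2) by (intro nn_integral_eq_integral integrable_jump u) auto
    finally show ?thesis using a u(2) by (simp add: ennreal_mult)
  qed
  have U: "(\<integral>\<^sup>+y. ?u y \<partial>leb01) = ennreal (\<integral>y. u y \<partial>leb01)"
    using u by (intro nn_integral_eq_integral) auto
  have nn: "0 \<le> (\<integral>y. u y \<partial>leb01)" "0 \<le> (\<integral>y. u ((jump ^^ (n + k + 1)) y) \<partial>leb01)"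
    "0 \<le> (\<integral>y. g ((jump ^^ i) y) * u ((jump ^^ (i + k + 2)) y) \<partial>leb01)"
    using g(2) u(2) by (auto intro!: integral_nonneg_AE)
  have "ennreal (\<integral>y. g ((jump ^^ i) y) * u ((jump ^^ (i + k + 2)) y) \<partial>leb01)
      \<le> ennreal (a * (\<integral>y. u ((jump ^^ (n + k + 1)) y) \<partial>leb01) + 3 * (2/3) ^ k * a * (\<integral>y. u y \<partial>leb01))"
    using mixing[OF f_m f_anti f_mass h_m h_anti h_mass a, of ?u k] a nn
    unfolding F Hh U by (simp add: ennreal_mult ennreal_plus del: funpow.simps)
  then have 1: "(\<integral>y. g ((jump ^^ i) y) * u ((jump ^^ (i + k + 2)) y) \<partial>leb01)
      \<le> a * (\<integral>y. u ((jump ^^ (n + k + 1)) y) \<partial>leb01) + 3 * (2/3) ^ k * a * (\<integral>y. u y \<partial>leb01)"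
    using a nn by (subst (asm) ennreal_le_iff) auto
  have "ennreal (a * (\<integral>y. u ((jump ^^ (n + k + 1)) y) \<partial>leb01))
      \<le> ennreal ((\<integral>y. g ((jump ^^ i) y) * u ((jump ^^ (i + k + 2)) y) \<partial>leb01) + 3 * (2/3) ^ k * a * (\<integral>y. u y \<partial>leb01))"
    using mixing[OF h_m h_anti h_mass f_m f_anti f_mass a, of ?u k] a nn
    unfolding F Hh U by (simp add: ennreal_mult ennreal_plus del: funpow.simps)
  then have 2: "a * (\<integral>y. u ((jump ^^ (n + k + 1)) y) \<partial>leb01)
      \<le> (\<integral>y. g ((jump ^^ i) y) * u ((jump ^^ (i + k + 2)) y) \<partial>leb01) + 3 * (2/3) ^ k * a * (\<integral>y. u y \<partial>leb01)"
    using a nn by (subst (asm) ennreal_le_iff) auto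
  from 1 2 show ?thesis unfolding a_def by linarith
qed

text \<open>
  The expectation of \<open>u\<close> under the invariant law of the jump transformation, expressed through
  the laws of the iterates of a uniformly distributed point.
\<close>

definition Estar :: "(real \<Rightarrow> real) \<Rightarrow> real" where
  "Estar u = lim (\<lambda>n. \<integral>y. u ((jump ^^ n) y) \<partial>leb01)"

lemma branch_antimono_const: "branch_antimono (\<lambda>_. c)"
  unfolding branch_antimono_def by (auto intro!: monotone_onI)

lemma Estar_lim:
  assumes u: "integrable leb01 u"
  shows "(\<lambda>n. \<integral>y. u ((jump ^^ n) y) \<partial>leb01) \<longlonglongrightarrow> Estar u"
proof -
  let ?A = "\<lambda>(u :: real \<Rightarrow> real) n. \<integral>y. u ((jump ^^ n) y) \<partial>leb01"
  have pos: "convergent (?A u)" if u: "integrable leb01 u" "\<And>y. 0 \<le> u y" for u :: "real \<Rightarrow> real"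
  proof -
    let ?I = "\<integral>y. u y \<partial>leb01"
    have I: "0 \<le> ?I" using u(2) by (rule Bochner_Integration.integral_nonneg)
    have bd: "\<bar>?A u (k + 2) - ?A u (n + k + 1)\<bar> \<le> 3 * (2/3) ^ k * ?I" for k n
      using weighted_mixing[of "\<lambda>_. 1" u 0 k n] u integrable_jump(1)[OF u(1), of "k + 2"]
      by (simp add: branch_antimono_const leb01.prob_space del: funpow.simps)
    have "Cauchy (?A u)"
    proof (rule metric_CauchyI)
      fix e :: real assume "0 < e"
      have "(\<lambda>k. 6 * (2/3) ^ k * ?I) \<longlonglongrightarrow> 6 * 0 * ?I"
        by (intro tendsto_intros LIMSEQ_realpow_zero) auto
      then have "\<forall>\<^sub>F k in sequentially. 6 * (2/3) ^ k * ?I < e"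
        using \<open>0 < e\<close> by (intro order_tendstoD(2)) auto
      then obtain k where k: "6 * (2/3) ^ k * ?I < e" by (auto simp: eventually_sequentially)
      show "\<exists>M. \<forall>m\<ge>M. \<forall>n\<ge>M. dist (?A u m) (?A u n) < e"
      proof (intro exI allI impI)
        fix m n assume "k + 1 \<le> m" "k + 1 \<le> n"
        then obtain m' n' where "m = m' + k + 1" "n = n' + k + 1"
          by (metis add.commute add.assoc le_Suc_ex)
        then show "dist (?A u m) (?A u n) < e"
          using bd[of k m'] bd[of k n'] k by (simp add: dist_real_def del: funpow.simps)
      qed
    qed
    then show ?thesis by (simp add: Cauchy_convergent)
  qed
  have "convergent (\<lambda>n. ?A (\<lambda>y. max (u y) 0) n - ?A (\<lambda>y. max (- u y) 0) n)"
    using u by (intro convergent_diff pos) auto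
  moreover have "?A (\<lambda>y. max (u y) 0) n - ?A (\<lambda>y. max (- u y) 0) n = ?A u n" for n
  proof -
    have "?A (\<lambda>y. max (u y) 0) n - ?A (\<lambda>y. max (- u y) 0) n
        = (\<integral>y. max (u ((jump ^^ n) y)) 0 - max (- u ((jump ^^ n) y)) 0 \<partial>leb01)"
      using u integrable_jump(1)[of "\<lambda>y. max (u y) 0" n] integrable_jump(1)[of "\<lambda>y. max (- u y) 0" n]
      by (subst Bochner_Integration.integral_diff) auto
    also have "\<dots> = ?A u n" by (intro Bochner_Integration.integral_cong) auto
    finally show ?thesis .
  qed
  ultimately show ?thesis unfolding Estar_def by (simp add: convergent_LIMSEQ_iff)
qed

lemma Estar_diff:
  assumes "integrable leb01 u" "integrable leb01 v"
  shows "Estar (\<lambda>y. u y - v y) = Estar u - Estar v"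
proof (rule LIMSEQ_unique[OF Estar_lim])
  show "(\<lambda>n. \<integral>y. u ((jump ^^ n) y) - v ((jump ^^ n) y) \<partial>leb01) \<longlonglongrightarrow> Estar u - Estar v"
    using tendsto_diff[OF Estar_lim[OF assms(1)] Estar_lim[OF assms(2)]] assms
    by (simp add: integrable_jump)
qed (use assms in auto)

lemma Estar_cmult:
  assumes "integrable leb01 u"
  shows "Estar (\<lambda>y. c * u y) = c * Estar u"
proof (rule LIMSEQ_unique[OF Estar_lim])
  show "(\<lambda>n. \<integral>y. c * u ((jump ^^ n) y) \<partial>leb01) \<longlonglongrightarrow> c * Estar u"
    using tendsto_mult_left[OF Estar_lim[OF assms]] by simp
qed (use assms in auto)

lemma Estar_const: "Estar (\<lambda>_. c) = c"
  by (simp add: Estar_def leb01.prob_space)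

lemma Estar_bound:
  assumes "integrable leb01 u"
  shows "\<bar>Estar u\<bar> \<le> 3 * (\<integral>y. \<bar>u y\<bar> \<partial>leb01)"
  using tendsto_rabs[OF Estar_lim[OF assms]] integrable_jump(3)[OF assms]
  by (intro LIMSEQ_le_const2[of _ "\<bar>Estar u\<bar>"]) auto

lemma Estar_mono:
  assumes "integrable leb01 u" "integrable leb01 v" "\<And>y. u y \<le> v y"
  shows "Estar u \<le> Estar v"
  using assms by (intro LIMSEQ_le[OF Estar_lim Estar_lim])
    (auto intro!: exI[of _ 0] integral_mono integrable_jump)

lemma decorrelation:
  fixes g u :: "real \<Rightarrow> real"
  assumes g [measurable]: "g \<in> borel_measurable borel" "\<And>y. 0 \<le> g y" "branch_antimono g" "integrable leb01 g"
    and u: "integrable leb01 u" "\<And>y. 0 \<le> u y"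
    and gu: "integrable leb01 (\<lambda>y. g ((jump ^^ i) y) * u ((jump ^^ (i + k + 2)) y))"
  shows "\<bar>(\<integral>y. g ((jump ^^ i) y) * u ((jump ^^ (i + k + 2)) y) \<partial>leb01)
      - (\<integral>y. g ((jump ^^ i) y) \<partial>leb01) * Estar u\<bar>
    \<le> 9 * (2/3) ^ k * (\<integral>y. g y \<partial>leb01) * (\<integral>y. u y \<partial>leb01)"
proof -
  have "(\<lambda>n. \<integral>y. u ((jump ^^ (n + (k + 1))) y) \<partial>leb01) \<longlonglongrightarrow> Estar u"
    by (rule LIMSEQ_ignore_initial_segment[OF Estar_lim[OF u(1)]])
  then have "(\<lambda>n. \<bar>(\<integral>y. g ((jump ^^ i) y) * u ((jump ^^ (i + k + 2)) y) \<partial>leb01)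
        - (\<integral>y. g ((jump ^^ i) y) \<partial>leb01) * (\<integral>y. u ((jump ^^ (n + k + 1)) y) \<partial>leb01)\<bar>)
      \<longlonglongrightarrow> \<bar>(\<integral>y. g ((jump ^^ i) y) * u ((jump ^^ (i + k + 2)) y) \<partial>leb01)
        - (\<integral>y. g ((jump ^^ i) y) \<partial>leb01) * Estar u\<bar>"
    by (intro tendsto_intros) (simp add: add.assoc)
  then have "\<bar>(\<integral>y. g ((jump ^^ i) y) * u ((jump ^^ (i + k + 2)) y) \<partial>leb01)
      - (\<integral>y. g ((jump ^^ i) y) \<partial>leb01) * Estar u\<bar>
    \<le> 3 * (2/3) ^ k * (\<integral>y. g ((jump ^^ i) y) \<partial>leb01) * (\<integral>y. u y \<partial>leb01)"
    using weighted_mixing[OF assms] by (intro LIMSEQ_le_const2) blast+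
  also have "\<dots> \<le> 3 * (2/3) ^ k * (3 * (\<integral>y. g y \<partial>leb01)) * (\<integral>y. u y \<partial>leb01)"
    using integrable_jump(3)[OF g(4), of i] g(2) u
    by (intro mult_right_mono mult_left_mono integral_nonneg_AE) auto
  finally show ?thesis by simp
qed

text \<open>
  The function whose sums are estimated is a difference of two functions that decrease on each branch, and
  \<open>decorrelation\<close> applies to both. Covariances at distance 0 and 1 are bounded by second moments, those at
  distance \<open>k + 2\<close> by \<open>9 * (2/3)^k\<close> times the square of the total first moment; the constants 9 and 54
  result from summing these bounds along a row of the covariance matrix.
\<close>

lemma variance_bound:
  fixes g h :: "real \<Rightarrow> real"
  assumes [measurable]: "g \<in> borel_measurable borel" "h \<in> borel_measurable borel"
    and gh: "\<And>y. 0 \<le> g y" "\<And>y. g y \<le> B" "\<And>y. 0 \<le> h y" "\<And>y. h y \<le> B"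
    and anti: "branch_antimono g" "branch_antimono h"
    and centred: "Estar (\<lambda>y. g y - h y) = 0"
  defines "\<psi> \<equiv> \<lambda>y. g y - h y"
  shows "(\<integral>y. (\<Sum>i<k. \<psi> ((jump ^^ i) y))\<^sup>2 \<partial>leb01)
    \<le> real k * (9 * (\<integral>y. (\<psi> y)\<^sup>2 \<partial>leb01) + 54 * ((\<integral>y. g y \<partial>leb01) + (\<integral>y. h y \<partial>leb01))\<^sup>2)"
proof -
  define G where "G = (\<integral>y. g y \<partial>leb01) + (\<integral>y. h y \<partial>leb01)"
  define S2 where "S2 = (\<integral>y. (\<psi> y)\<^sup>2 \<partial>leb01)"
  have bdI: "integrable leb01 f" if "f \<in> borel_measurable borel" "\<And>y. \<bar>f y\<bar> \<le> C" for f :: "real \<Rightarrow> real" and C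
    using that by (intro leb01.integrable_const_bound[of _ C]) auto
  have B: "0 \<le> B" using gh(1,2) order_trans by blast
  have \<psi>_m [measurable]: "\<psi> \<in> borel_measurable borel" unfolding \<psi>_def by measurable
  have \<psi>_bd: "\<bar>\<psi> y\<bar> \<le> B" for y
    using gh[of y] unfolding \<psi>_def by (auto simp: abs_le_iff)
  have gI: "integrable leb01 g" and hI: "integrable leb01 h"
    by (auto intro!: bdI[of _ B] simp: gh abs_of_nonneg)
  have sqI: "integrable leb01 (\<lambda>y. (\<psi> y)\<^sup>2)"
  proof (rule bdI)
    show "\<bar>(\<psi> y)\<^sup>2\<bar> \<le> B\<^sup>2" for y
      using power_mono[OF \<psi>_bd[of y], of 2] by simp
  qed measurable
  have prodI: "integrable leb01 (\<lambda>y. a ((jump ^^ i) y) * b ((jump ^^ j) y))"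
    if "a \<in> {g, h, \<psi>}" "b \<in> {g, h, \<psi>}" for a b i j
  proof (rule bdI)
    have m: "a \<in> borel_measurable borel" "b \<in> borel_measurable borel" using that by auto
    then show "(\<lambda>y. a ((jump ^^ i) y) * b ((jump ^^ j) y)) \<in> borel_measurable borel" by measurable
    have "\<bar>a z\<bar> \<le> B" "\<bar>b z\<bar> \<le> B" for z using that gh[of z] \<psi>_bd[of z] by auto
    then show "\<bar>a ((jump ^^ i) y) * b ((jump ^^ j) y)\<bar> \<le> B * B" for y
      using B by (simp add: abs_mult mult_mono)
  qed
  have S2: "0 \<le> S2" unfolding S2_def by simp
  have sq: "(\<integral>y. (\<psi> ((jump ^^ i) y))\<^sup>2 \<partial>leb01) \<le> 3 * S2" for i
    using integrable_jump(3)[OF sqI, of i] unfolding S2_def by simp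
  have sqJI: "integrable leb01 (\<lambda>y. (\<psi> ((jump ^^ i) y))\<^sup>2)" for i
    using integrable_jump(1)[OF sqI, of i] .
  define cov where "cov i j = (\<integral>y. \<psi> ((jump ^^ i) y) * \<psi> ((jump ^^ j) y) \<partial>leb01)" for i j
  have near: "\<bar>cov i j\<bar> \<le> 3 * S2" for i j
  proof -
    have "\<bar>cov i j\<bar> \<le> (\<integral>y. \<bar>\<psi> ((jump ^^ i) y) * \<psi> ((jump ^^ j) y)\<bar> \<partial>leb01)"
      unfolding cov_def by (rule integral_abs_bound)
    also have "\<dots> \<le> (\<integral>y. (\<psi> ((jump ^^ i) y))\<^sup>2 / 2 + (\<psi> ((jump ^^ j) y))\<^sup>2 / 2 \<partial>leb01)"
    proof (rule integral_mono)
      fix y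
      have "0 \<le> (\<bar>\<psi> ((jump ^^ i) y)\<bar> - \<bar>\<psi> ((jump ^^ j) y)\<bar>)\<^sup>2" by simp
      then show "\<bar>\<psi> ((jump ^^ i) y) * \<psi> ((jump ^^ j) y)\<bar>
          \<le> (\<psi> ((jump ^^ i) y))\<^sup>2 / 2 + (\<psi> ((jump ^^ j) y))\<^sup>2 / 2"
        by (simp add: power2_diff abs_mult)
    qed (use prodI sqJI in auto)
    also have "\<dots> = (\<integral>y. (\<psi> ((jump ^^ i) y))\<^sup>2 \<partial>leb01) / 2 + (\<integral>y. (\<psi> ((jump ^^ j) y))\<^sup>2 \<partial>leb01) / 2"
      using sqJI by simp
    finally show ?thesis using sq[of i] sq[of j] by simp
  qed
  have far: "\<bar>cov i (i + k + 2)\<bar> \<le> 9 * (2/3) ^ k * G\<^sup>2" for i k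
  proof -
    let ?J = "\<lambda>a b. \<integral>y. a ((jump ^^ i) y) * b ((jump ^^ (i + k + 2)) y) \<partial>leb01"
    have one: "\<bar>?J a \<psi>\<bar> \<le> 9 * (2/3) ^ k * (\<integral>y. a y \<partial>leb01) * G" if "a \<in> {g, h}" for a
    proof -
      let ?A = "\<integral>y. a ((jump ^^ i) y) \<partial>leb01"
      have aI: "integrable leb01 a" "a \<in> borel_measurable borel" "\<And>y. 0 \<le> a y" "branch_antimono a"
        using that gI hI gh anti by auto
      have "Estar g - Estar h = 0" using centred gI hI by (simp add: Estar_diff)
      then have E: "?A * Estar g = ?A * Estar h" by simp
      have "?J a \<psi> = ?J a g - ?J a h"
        using that prodI by (subst Bochner_Integration.integral_diff[symmetric]) (auto simp: \<psi>_def right_diff_distrib simp del: funpow.simps)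
      also have "\<dots> = (?J a g - ?A * Estar g) - (?J a h - ?A * Estar h)" using E by linarith
      finally have "\<bar>?J a \<psi>\<bar> \<le> \<bar>?J a g - ?A * Estar g\<bar> + \<bar>?J a h - ?A * Estar h\<bar>" by simp
      also have "\<dots> \<le> 9 * (2/3) ^ k * (\<integral>y. a y \<partial>leb01) * (\<integral>y. g y \<partial>leb01)
          + 9 * (2/3) ^ k * (\<integral>y. a y \<partial>leb01) * (\<integral>y. h y \<partial>leb01)"
        using that by (intro add_mono decorrelation aI gI hI gh prodI) auto
      finally show ?thesis by (simp add: G_def algebra_simps)
    qed
    have "cov i (i + k + 2) = ?J g \<psi> - ?J h \<psi>"
      unfolding cov_def using prodI
      by (subst Bochner_Integration.integral_diff[symmetric]) (auto simp: \<psi>_def left_diff_distrib simp del: funpow.simps)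
    then have "\<bar>cov i (i + k + 2)\<bar> \<le> \<bar>?J g \<psi>\<bar> + \<bar>?J h \<psi>\<bar>" by simp
    also have "\<dots> \<le> 9 * (2/3) ^ k * (\<integral>y. g y \<partial>leb01) * G + 9 * (2/3) ^ k * (\<integral>y. h y \<partial>leb01) * G"
      using one by (intro add_mono) auto
    finally show ?thesis by (simp add: G_def algebra_simps power2_eq_square)
  qed
  have row: "(\<Sum>i<k. \<bar>cov i k\<bar>) \<le> 3 * S2 + 27 * G\<^sup>2" for k
  proof (cases k)
    case (Suc m)
    have geo: "(\<Sum>i<m. (2/3::real) ^ i) \<le> 3"
      by (subst sum_gp_strict) (simp add: field_simps)
    have "(\<Sum>i<k. \<bar>cov i k\<bar>) = \<bar>cov m k\<bar> + (\<Sum>i<m. \<bar>cov i k\<bar>)" using Suc by simp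
    also have "(\<Sum>i<m. \<bar>cov i k\<bar>) \<le> (\<Sum>i<m. 9 * (2/3) ^ (m - Suc i) * G\<^sup>2)"
    proof (rule sum_mono)
      fix i assume "i \<in> {..<m}"
      then have "k = i + (m - Suc i) + 2" using Suc by simp
      then show "\<bar>cov i k\<bar> \<le> 9 * (2/3) ^ (m - Suc i) * G\<^sup>2" using far[of i "m - Suc i"] by simp
    qed
    also have "\<dots> = 9 * G\<^sup>2 * (\<Sum>i<m. (2/3) ^ (m - Suc i))"
      by (simp add: sum_distrib_left mult_ac)
    also have "(\<Sum>i<m. (2/3::real) ^ (m - Suc i)) = (\<Sum>i<m. (2/3) ^ i)"
      by (rule sum.nat_diff_reindex)
    also have "9 * G\<^sup>2 * (\<Sum>i<m. (2/3) ^ i) \<le> 9 * G\<^sup>2 * 3" using geo by (intro mult_left_mono) auto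
    finally show ?thesis using near[of m k] by simp
  qed (use S2 in simp)
  have "(\<integral>y. (\<Sum>i<k. \<psi> ((jump ^^ i) y))\<^sup>2 \<partial>leb01) \<le> real k * (9 * S2 + 54 * G\<^sup>2)"
  proof (induction k)
    case (Suc k)
    let ?S = "\<lambda>y. \<Sum>i<k. \<psi> ((jump ^^ i) y)"
    have SI: "integrable leb01 (\<lambda>y. (?S y)\<^sup>2)"
      by (simp add: power2_eq_square sum_product prodI)
    have cI: "integrable leb01 (\<lambda>y. ?S y * \<psi> ((jump ^^ k) y))"
      by (simp add: sum_distrib_right prodI)
    have "(\<integral>y. (\<Sum>i<Suc k. \<psi> ((jump ^^ i) y))\<^sup>2 \<partial>leb01)
        = (\<integral>y. (?S y)\<^sup>2 + 2 * (?S y * \<psi> ((jump ^^ k) y)) + (\<psi> ((jump ^^ k) y))\<^sup>2 \<partial>leb01)"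
      by (intro Bochner_Integration.integral_cong) (auto simp: power2_sum)
    also have "\<dots> = (\<integral>y. (?S y)\<^sup>2 \<partial>leb01) + 2 * (\<integral>y. ?S y * \<psi> ((jump ^^ k) y) \<partial>leb01)
        + (\<integral>y. (\<psi> ((jump ^^ k) y))\<^sup>2 \<partial>leb01)"
      using SI cI sqJI by simp
    also have "(\<integral>y. ?S y * \<psi> ((jump ^^ k) y) \<partial>leb01) = (\<Sum>i<k. cov i k)"
      unfolding cov_def sum_distrib_right by (intro Bochner_Integration.integral_sum prodI) auto
    also have "(\<Sum>i<k. cov i k) \<le> (\<Sum>i<k. \<bar>cov i k\<bar>)" by (intro sum_mono) auto
    also have "\<dots> \<le> 3 * S2 + 27 * G\<^sup>2" by (rule row)
    finally show ?case using Suc sq[of k] by (simp add: algebra_simps)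
  qed simp
  then show ?thesis unfolding S2_def G_def .
qed

section \<open>A maximal inequality\<close>

definition same_digits :: "nat \<Rightarrow> real \<Rightarrow> real \<Rightarrow> bool" where
  "same_digits k y y' \<longleftrightarrow> (\<forall>i<k. digit ((jump ^^ i) y) = digit ((jump ^^ i) y'))"

text \<open>
  Sets that, within the open unit interval, depend on the first \<open>k\<close> digits only.
\<close>

definition cylindrical :: "nat \<Rightarrow> real set \<Rightarrow> bool" where
  "cylindrical k D \<longleftrightarrow>
     (\<forall>y\<in>{0<..<1}. \<forall>y'\<in>{0<..<1}. same_digits k y y' \<longrightarrow> (y \<in> D \<longleftrightarrow> y' \<in> D))"

lemma same_digits_V:
  assumes "z \<in> {0<..<1}" "z' \<in> {0<..<1}" "same_digits k z z'"
  shows "same_digits (Suc k) (V r z) (V r z')"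
  unfolding same_digits_def
proof (intro allI impI)
  fix i assume "i < Suc k"
  then show "digit ((jump ^^ i) (V r z)) = digit ((jump ^^ i) (V r z'))"
    using assms by (cases i) (auto simp: digit_V jump_V same_digits_def funpow_Suc_right simp del: funpow.simps)
qed

text \<open>
  Restricting a decreasing density to one branch and jumping once multiplies a composition with an
  increasing function by a decreasing one, so it stays decreasing; a set of depth \<open>k\<close> is handled
  branch by branch, by induction on \<open>k\<close>.
\<close>

lemma cylinder_density:
  assumes "f \<in> borel_measurable borel" "antimono_on {0<..<1} f"
    and "D \<in> sets borel" "cylindrical k D"
  shows "\<exists>f'\<in>borel_measurable borel. antimono_on {0<..<1} f' \<and>
    (\<forall>\<phi>\<in>borel_measurable borel.
      (\<integral>\<^sup>+y. f y * indicator D y * \<phi> ((jump ^^ k) y) \<partial>leb01) = (\<integral>\<^sup>+y. f' y * \<phi> y \<partial>leb01))"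
  using assms
proof (induction k arbitrary: f D)
  case 0
  have "same_digits 0 y y'" for y y' by (simp add: same_digits_def)
  then have "{0<..<1} \<subseteq> D \<or> {0<..<1} \<inter> D = {}"
    using "0.prems"(4) unfolding cylindrical_def by blast
  then show ?case
  proof
    assume D: "{0<..<1} \<subseteq> D"
    have "(\<integral>\<^sup>+y. f y * indicator D y * \<phi> ((jump ^^ 0) y) \<partial>leb01) = (\<integral>\<^sup>+y. f y * \<phi> y \<partial>leb01)" for \<phi>
      by (intro nn_integral_cong_AE eventually_mono[OF AE_leb01_open]) (use D in \<open>auto simp: indicator_def\<close>)
    then show ?thesis using 0 by blast
  next
    assume D: "{0<..<1} \<inter> D = {}"
    have "(\<integral>\<^sup>+y. f y * indicator D y * \<phi> ((jump ^^ 0) y) \<partial>leb01) = (\<integral>\<^sup>+y. 0 * \<phi> y \<partial>leb01)" for \<phi>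
      by (intro nn_integral_cong_AE eventually_mono[OF AE_leb01_open]) (use D in \<open>auto simp: indicator_def\<close>)
    then show ?thesis by (intro bexI[of _ "\<lambda>_. 0"]) (auto intro: monotone_onI)
  qed
next
  case (Suc k)
  note [measurable] = Suc.prems(1,3)
  define rep where "rep r f' \<longleftrightarrow> f' \<in> borel_measurable borel \<and> antimono_on {0<..<1} f' \<and>
    (\<forall>\<phi>\<in>borel_measurable borel.
      (\<integral>\<^sup>+z. (ennreal (W r z) * f (V r z)) * indicator (V r -` D) z * \<phi> ((jump ^^ k) z) \<partial>leb01)
        = (\<integral>\<^sup>+z. f' z * \<phi> z \<partial>leb01))" for r f'
  have "\<exists>f'. rep r f'" for r
    unfolding rep_def Bex_def[symmetric]
  proof (rule Suc.IH)
    show "(\<lambda>z. ennreal (W r z) * f (V r z)) \<in> borel_measurable borel" by measurable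
    show "antimono_on {0<..<1} (\<lambda>z. ennreal (W r z) * f (V r z))"
      by (intro antimono_transfer_summand antimono_comp_V Suc.prems)
    show "V r -` D \<in> sets borel"
      using measurable_sets[OF V_measurable Suc.prems(3)] by simp
    show "cylindrical k (V r -` D)"
      unfolding cylindrical_def
    proof (intro ballI impI)
      fix z z' :: real assume z: "z \<in> {0<..<1}" "z' \<in> {0<..<1}" "same_digits k z z'"
      have "V r z \<in> D \<longleftrightarrow> V r z' \<in> D"
        using Suc.prems(4) V_in[OF z(1), of r] V_in[OF z(2), of r] same_digits_V[OF z, of r]
        unfolding cylindrical_def by blast
      then show "z \<in> V r -` D \<longleftrightarrow> z' \<in> V r -` D" by simp
    qed
  qed
  then have "\<forall>r. \<exists>f'. rep r f'" by blast
  then obtain f' where "\<forall>r. rep r (f' r)" by (rule choice[THEN exE])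
  then have f': "\<And>r. f' r \<in> borel_measurable borel" "\<And>r. antimono_on {0<..<1} (f' r)"
    "\<And>r \<phi>. \<phi> \<in> borel_measurable borel \<Longrightarrow>
      (\<integral>\<^sup>+z. (ennreal (W r z) * f (V r z)) * indicator (V r -` D) z * \<phi> ((jump ^^ k) z) \<partial>leb01)
        = (\<integral>\<^sup>+z. f' r z * \<phi> z \<partial>leb01)"
    unfolding rep_def by simp_all
  note [measurable] = f'(1)
  show ?case
  proof (intro bexI conjI ballI)
    show "(\<lambda>z. \<Sum>r. f' r z) \<in> borel_measurable borel" by measurable
    show "antimono_on {0<..<1} (\<lambda>z. \<Sum>r. f' r z)"
      by (intro monotone_onI suminf_le) (use monotone_onD[OF f'(2)] in auto)
    fix \<phi> :: "real \<Rightarrow> ennreal" assume \<phi> [measurable]: "\<phi> \<in> borel_measurable borel"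
    have "(\<integral>\<^sup>+y. f y * indicator D y * \<phi> ((jump ^^ Suc k) y) \<partial>leb01)
        = (\<Sum>r. \<integral>\<^sup>+z. ennreal (W r z) * (f (V r z) * indicator D (V r z) * \<phi> ((jump ^^ Suc k) (V r z))) \<partial>leb01)"
      by (rule nn_integral_branches) measurable
    also have "\<dots> = (\<Sum>r. \<integral>\<^sup>+z. (ennreal (W r z) * f (V r z)) * indicator (V r -` D) z * \<phi> ((jump ^^ k) z) \<partial>leb01)"
      by (intro suminf_cong nn_integral_cong_AE eventually_mono[OF AE_leb01_open])
         (auto simp: jump_V funpow_Suc_right indicator_def mult.assoc simp del: funpow.simps)
    also have "\<dots> = (\<Sum>r. \<integral>\<^sup>+z. f' r z * \<phi> z \<partial>leb01)" by (simp add: f'(3))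
    also have "\<dots> = (\<integral>\<^sup>+z. (\<Sum>r. f' r z) * \<phi> z \<partial>leb01)"
      by (subst nn_integral_suminf[symmetric]) auto
    finally show "(\<integral>\<^sup>+y. f y * indicator D y * \<phi> ((jump ^^ Suc k) y) \<partial>leb01)
        = (\<integral>\<^sup>+z. (\<Sum>r. f' r z) * \<phi> z \<partial>leb01)" .
  qed
qed

text \<open>
  The density on a cylinder can oscillate arbitrarily much, but one additional jump brings it
  into the range of \<open>transfer_le_3\<close>; this explains the gap of one step between \<open>k\<close> and
  \<open>Suc k\<close>.
\<close>

lemma cylinder_decoupling:
  assumes [measurable]: "D \<in> sets borel" "E \<in> sets borel" and "cylindrical k D"
  shows "measure leb01 (D \<inter> {y. (jump ^^ Suc k) y \<in> E}) \<le> 3 * measure leb01 D * measure leb01 E"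
proof -
  obtain f where f [measurable]: "f \<in> borel_measurable borel" and anti: "antimono_on {0<..<1} f"
    and eq: "\<And>\<phi>. \<phi> \<in> borel_measurable borel \<Longrightarrow>
      (\<integral>\<^sup>+y. 1 * indicator D y * \<phi> ((jump ^^ k) y) \<partial>leb01) = (\<integral>\<^sup>+y. f y * \<phi> y \<partial>leb01)"
    using cylinder_density[of "\<lambda>_. 1" D k] assms by (auto intro: monotone_onI)
  have mass: "(\<integral>\<^sup>+y. f y \<partial>leb01) = emeasure leb01 D"
    using eq[of "\<lambda>_. 1"] by simp
  have "emeasure leb01 (D \<inter> {y. (jump ^^ Suc k) y \<in> E}) = (\<integral>\<^sup>+y. indicator (D \<inter> {y. (jump ^^ Suc k) y \<in> E}) y \<partial>leb01)"
    by (subst nn_integral_indicator) (auto simp del: funpow.simps)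
  also have "\<dots> = (\<integral>\<^sup>+y. 1 * indicator D y * indicator E (jump ((jump ^^ k) y)) \<partial>leb01)"
    by (intro nn_integral_cong) (auto simp: indicator_def)
  also have "\<dots> = (\<integral>\<^sup>+y. f y * indicator E (jump y) \<partial>leb01)"
    by (rule eq) measurable
  also have "\<dots> = (\<integral>\<^sup>+y. transfer f y * indicator E y \<partial>leb01)"
    by (rule nn_integral_transfer) measurable
  also have "\<dots> \<le> (\<integral>\<^sup>+y. (3 * emeasure leb01 D) * indicator E y \<partial>leb01)"
    using transfer_le_mass[OF f anti] unfolding mass
    by (intro nn_integral_mono_AE eventually_mono[OF AE_leb01_open] mult_right_mono) auto
  also have "\<dots> = 3 * emeasure leb01 D * emeasure leb01 E"
    by (subst nn_integral_cmult) auto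
  finally have "ennreal (measure leb01 (D \<inter> {y. (jump ^^ Suc k) y \<in> E}))
      \<le> ennreal (3 * measure leb01 D * measure leb01 E)"
    by (simp add: leb01.emeasure_eq_measure ennreal_mult)
  then show ?thesis by (subst (asm) ennreal_le_iff) auto
qed

text \<open>
  At these points \<open>V_jump\<close> recovers every jump point from its digit and the next jump point.
\<close>

definition interior_orbit :: "real set" where
  "interior_orbit = {y. \<forall>i. (jump ^^ i) y \<in> {0<..<1}}"

lemma AE_interior_orbit: "AE y in leb01. y \<in> interior_orbit"
  unfolding interior_orbit_def mem_Collect_eq AE_all_countable
  using AE_jump[OF AE_leb01_open] by blast

lemma interior_orbitD: "y \<in> interior_orbit \<Longrightarrow> (jump ^^ n) y \<in> {0<..<1}"
  unfolding interior_orbit_def by auto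

lemma same_digits_hull_measurable: "{y. \<exists>y'\<in>A. same_digits k y y'} \<in> sets borel"
proof -
  \<comment> \<open>there are only countably many finite digit sequences\<close>
  define itin where "itin y = map (\<lambda>i. digit ((jump ^^ i) y)) [0..<k]" for y
  have "{y. \<exists>y'\<in>A. same_digits k y y'} = (\<Union>w\<in>itin ` A. {y. \<forall>i<k. digit ((jump ^^ i) y) = w ! i})"
    unfolding itin_def same_digits_def by auto
  also have "\<dots> \<in> sets borel"
  proof (rule sets.countable_UN'')
    show "countable (itin ` A)" by (rule countableI_type)
    fix w assume "w \<in> itin ` A"
    have "{y \<in> space borel. \<forall>i<k. digit ((jump ^^ i) y) = w ! i} \<in> sets borel" by measurable
    then show "{y. \<forall>i<k. digit ((jump ^^ i) y) = w ! i} \<in> sets borel" by simp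
  qed
  finally show ?thesis .
qed

text \<open>
  Ottaviani's argument. \<open>Q k\<close> stands for the norm of the sum of the first \<open>k\<close> terms. The event that \<open>Q\<close>
  first exceeds the level at time \<open>k\<close> is replaced by its hull with respect to the first \<open>k\<close> digits,
  which costs \<open>x\<close> by the oscillation bound. On the hull either \<open>Q n\<close> is large as well, or the
  part of the sum after the step \<open>k + 1\<close> is; the latter is nearly independent of the hull and has
  probability at most \<open>3 * p \<le> 1/2\<close>.
\<close>

lemma maximal_inequality:
  fixes Q :: "nat \<Rightarrow> real \<Rightarrow> real"
  assumes Q [measurable]: "\<And>k. Q k \<in> borel_measurable borel"
    and osc: "\<And>k y y'. y \<in> interior_orbit \<Longrightarrow> y' \<in> interior_orbit \<Longrightarrow> same_digits k y y' \<Longrightarrow> Q k y' \<le> Q k y + x"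
    and sub: "\<And>k n y. k < n \<Longrightarrow> Q k y \<le> Q n y + x + Q (n - Suc k) ((jump ^^ Suc k) y)"
    and p: "\<And>m. m \<le> n \<Longrightarrow> measure leb01 {y. x < Q m y} \<le> p" "p \<le> 1/6" and "0 \<le> x"
  shows "\<exists>B\<in>sets borel. measure leb01 B \<le> 2 * p \<and> (\<forall>y\<in>interior_orbit - B. \<forall>k\<le>n. Q k y \<le> 4 * x)"
proof -
  \<comment> \<open>\<open>B k\<close> is the hull of the exceedance at time \<open>k\<close>, and \<open>D k\<close> the part of it that is entered first at time \<open>k\<close>\<close>
  define B where "B k = {y. \<exists>y'\<in>{y' \<in> interior_orbit. 4 * x < Q k y'}. same_digits k y y'}" for k
  define D where "D k = B k - (\<Union>j<k. B j)" for k
  have B [measurable]: "B k \<in> sets borel" for k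
    unfolding B_def by (rule same_digits_hull_measurable)
  have D [measurable]: "D k \<in> sets borel" for k
    unfolding D_def by measurable
  have cyl: "cylindrical k (D k)" for k
  proof -
    have "y \<in> D k \<longleftrightarrow> y' \<in> D k" if same: "same_digits k y y'" for y y'
    proof -
      have B_iff: "y \<in> B j \<longleftrightarrow> y' \<in> B j" if "j \<le> k" for j
        using same that unfolding B_def same_digits_def by force
      then have "(\<exists>j<k. y \<in> B j) \<longleftrightarrow> (\<exists>j<k. y' \<in> B j)" by (meson less_imp_le)
      with B_iff[of k] show ?thesis unfolding D_def by auto
    qed
    then show ?thesis unfolding cylindrical_def by blast
  qed
  have B_Q: "3 * x < Q k y" if "y \<in> B k" "y \<in> interior_orbit" for k y
  proof -
    from that obtain y' where "y' \<in> interior_orbit" "4 * x < Q k y'" "same_digits k y y'"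
      unfolding B_def by auto
    with osc[of y y' k] that show ?thesis by simp
  qed
  let ?B = "\<Union>k\<le>n. B k"
  have BD: "?B = (\<Union>k\<le>n. D k)"
  proof
    show "?B \<subseteq> (\<Union>k\<le>n. D k)"
    proof
      fix y assume "y \<in> ?B"
      then obtain k where k: "k \<le> n" "y \<in> B k" by auto
      define j where "j = (LEAST j. y \<in> B j)"
      have "y \<in> B j" "j \<le> k" unfolding j_def using k by (auto intro: LeastI Least_le)
      moreover have "y \<notin> B i" if "i < j" for i using that not_less_Least unfolding j_def by blast
      ultimately show "y \<in> (\<Union>k\<le>n. D k)" using k unfolding D_def by force
    qed
  qed (auto simp: D_def)
  have disj: "disjoint_family_on D {..n}"
    unfolding disjoint_family_on_def
  proof (intro ballI impI)
    fix i j :: nat assume "i \<noteq> j"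
    then show "D i \<inter> D j = {}" by (cases "i < j") (auto simp: D_def)
  qed
  have sum_D: "measure leb01 ?B = (\<Sum>k\<le>n. measure leb01 (D k))"
    unfolding BD by (rule leb01.finite_measure_finite_Union) (use disj in auto)
  let ?E = "\<lambda>m. {y. x < Q m y}"
  have E [measurable]: "?E m \<in> sets borel" for m by measurable
  have p0: "0 \<le> p" using p(1)[of 0] measure_nonneg[of leb01 "?E 0"] by linarith
  have "measure leb01 ?B \<le> measure leb01 (?E n \<union> (\<Union>k<n. D k \<inter> {y. (jump ^^ Suc k) y \<in> ?E (n - Suc k)}))"
  proof (rule leb01.finite_measure_mono_AE)
    show "AE y in leb01. y \<in> ?B \<longrightarrow>
      y \<in> ?E n \<union> (\<Union>k<n. D k \<inter> {y. (jump ^^ Suc k) y \<in> ?E (n - Suc k)})"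
    proof (rule eventually_mono[OF AE_interior_orbit], rule impI)
      fix y assume y: "y \<in> interior_orbit" and "y \<in> ?B"
      then obtain k where k: "k \<le> n" "y \<in> D k" unfolding BD by auto
      then have "3 * x < Q k y" using B_Q[of y k] y by (auto simp: D_def)
      show "y \<in> ?E n \<union> (\<Union>k<n. D k \<inter> {y. (jump ^^ Suc k) y \<in> ?E (n - Suc k)})"
      proof (cases "k = n")
        case True
        then show ?thesis using \<open>3 * x < Q k y\<close> \<open>0 \<le> x\<close> by auto
      next
        case False
        then have "k < n" using k by simp
        then show ?thesis
          using sub[of k n y] \<open>3 * x < Q k y\<close> k by (cases "x < Q n y") (auto simp del: funpow.simps)
      qed
    qed
  qed simp
  also have "\<dots> \<le> measure leb01 (?E n) + measure leb01 (\<Union>k<n. D k \<inter> {y. (jump ^^ Suc k) y \<in> ?E (n - Suc k)})"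
    by (rule measure_Un_le) simp_all
  also have "measure leb01 (\<Union>k<n. D k \<inter> {y. (jump ^^ Suc k) y \<in> ?E (n - Suc k)})
      \<le> (\<Sum>k<n. measure leb01 (D k \<inter> {y. (jump ^^ Suc k) y \<in> ?E (n - Suc k)}))"
    by (rule measure_UNION_le) simp_all
  also have "\<dots> \<le> (\<Sum>k<n. 3 * measure leb01 (D k) * p)"
  proof (rule sum_mono)
    fix k assume "k \<in> {..<n}"
    have "measure leb01 (D k \<inter> {y. (jump ^^ Suc k) y \<in> ?E (n - Suc k)})
        \<le> 3 * measure leb01 (D k) * measure leb01 (?E (n - Suc k))"
      by (rule cylinder_decoupling) (auto simp: cyl)
    also have "\<dots> \<le> 3 * measure leb01 (D k) * p"
      by (intro mult_left_mono p) auto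
    finally show "measure leb01 (D k \<inter> {y. (jump ^^ Suc k) y \<in> ?E (n - Suc k)}) \<le> 3 * measure leb01 (D k) * p" .
  qed
  also have "\<dots> = 3 * p * (\<Sum>k<n. measure leb01 (D k))" by (simp add: sum_distrib_left mult_ac)
  finally have first_exit: "measure leb01 ?B \<le> measure leb01 (?E n) + 3 * p * (\<Sum>k<n. measure leb01 (D k))"
    by simp
  have "3 * p * (\<Sum>k<n. measure leb01 (D k)) \<le> 1/2 * measure leb01 ?B"
  proof (rule mult_mono)
    show "(\<Sum>k<n. measure leb01 (D k)) \<le> measure leb01 ?B"
      unfolding sum_D by (rule sum_mono2) auto
  qed (use p(2) p0 in \<open>auto intro: sum_nonneg\<close>)
  with first_exit have "measure leb01 ?B \<le> 2 * p" using p(1)[of n] by simp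
  moreover have "Q k y \<le> 4 * x" if "y \<in> interior_orbit" "y \<notin> ?B" "k \<le> n" for k y
  proof (rule ccontr)
    assume "\<not> Q k y \<le> 4 * x"
    then have "y \<in> B k" unfolding B_def same_digits_def using that by auto
    with that show False by auto
  qed
  ultimately show ?thesis by (intro bexI[of _ ?B]) auto
qed

section \<open>Blocks and their fluctuations\<close>

lemma same_digits_contract:
  assumes "y \<in> interior_orbit" "y' \<in> interior_orbit" "same_digits k y y'" "i \<le> k"
  shows "\<bar>(jump ^^ i) y - (jump ^^ i) y'\<bar> \<le> (1/2) ^ (k - i)"
  using assms(4)
proof (induction i rule: inc_induct)
  case base
  show ?case using interior_orbitD[OF assms(1), of k] interior_orbitD[OF assms(2), of k] by (simp add: abs_le_iff)
next
  case (step i)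
  let ?a = "(jump ^^ i) y" and ?b = "(jump ^^ i) y'"
  have "?a = V (digit ?a) (jump ?a)" "?b = V (digit ?a) (jump ?b)"
    using V_jump(1)[of ?a] V_jump(1)[of ?b] interior_orbitD[OF assms(1), of i] interior_orbitD[OF assms(2), of i]
      assms(3) step.hyps by (simp_all add: same_digits_def)
  then have "\<bar>?a - ?b\<bar> \<le> \<bar>jump ?a - jump ?b\<bar> / 2"
    using V_contract[of "jump ?a" "jump ?b" "digit ?a"]
      interior_orbitD[OF assms(1), of "Suc i"] interior_orbitD[OF assms(2), of "Suc i"] by simp
  also have "\<dots> \<le> (1/2) ^ (k - Suc i) / 2" using step.IH by simp
  also have "\<dots> = (1/2) ^ (k - i)"
  proof -
    have "k - i = Suc (k - Suc i)" using step.hyps by simp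
    then show ?thesis by simp
  qed
  finally show ?case .
qed

text \<open>
  The block that starts in \<open>y\<close> consists of the \<open>digit y + 1\<close> points that \<open>T\<close> visits before the
  next jump point; those in \<open>[0,t]\<close> are counted.
\<close>

definition visits :: "real \<Rightarrow> real \<Rightarrow> real" where
  "visits t y = (\<Sum>i<Suc (digit y). of_bool ((T ^^ i) y \<le> t))"

definition block_length :: "real \<Rightarrow> real" where
  "block_length y = real (Suc (digit y))"

definition cut :: "nat \<Rightarrow> (real \<Rightarrow> real) \<Rightarrow> real \<Rightarrow> real" where
  "cut l f y = (if digit y < l then f y else 0)"

lemma cut_measurable [measurable (raw)]:
  assumes [measurable]: "f \<in> borel_measurable borel"
  shows "cut l f \<in> borel_measurable borel"
  unfolding cut_def by measurable

lemma block_length_measurable [measurable]: "block_length \<in> borel_measurable borel"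
  unfolding block_length_def by measurable

lemma visits_measurable2 [measurable]:
  "(\<lambda>(y, t). visits t y) \<in> borel_measurable (borel \<Otimes>\<^sub>M borel)"
proof -
  have "(\<lambda>p. \<Sum>i<Suc r. of_bool ((T ^^ i) (fst p) \<le> snd p) :: real) \<in> borel_measurable (borel \<Otimes>\<^sub>M borel)" for r
    by measurable
  then have "(\<lambda>p. \<Sum>i<Suc (digit (fst p)). of_bool ((T ^^ i) (fst p) \<le> snd p) :: real)
      \<in> borel_measurable (borel \<Otimes>\<^sub>M borel)"
    by (rule measurable_compose_countable) measurable
  then show ?thesis by (simp add: visits_def case_prod_beta')
qed

lemma visits_measurable [measurable]: "visits t \<in> borel_measurable borel"
  using measurable_compose[OF _ visits_measurable2, of "\<lambda>y. (y, t)" borel] by simp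

lemma visits_nonneg: "0 \<le> visits t y" and visits_le: "visits t y \<le> block_length y"
proof -
  show "0 \<le> visits t y" unfolding visits_def by (intro sum_nonneg) auto
  have "visits t y \<le> (\<Sum>i<Suc (digit y). 1)" unfolding visits_def by (intro sum_mono) auto
  then show "visits t y \<le> block_length y" unfolding block_length_def by simp
qed

lemma visits_mono: "t \<le> t' \<Longrightarrow> visits t y \<le> visits t' y"
  unfolding visits_def by (intro sum_mono) auto

lemma visits_V:
  assumes "z \<in> {0..<1}"
  shows "visits t (V r z) = (\<Sum>i\<le>r. of_bool (V i z \<le> t))"
proof -
  have "visits t (V r z) = (\<Sum>i<Suc r. of_bool (V (r - i) z \<le> t))"
    unfolding visits_def digit_V[OF assms] by (intro sum.cong) (auto simp: funpow_T_V[OF assms])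
  also have "\<dots> = (\<Sum>i<Suc r. of_bool (V i z \<le> t))"
    using sum.nat_diff_reindex[of "\<lambda>i. of_bool (V i z \<le> t) :: real" "Suc r"] by simp
  finally show ?thesis by (simp add: lessThan_Suc_atMost)
qed

lemma block_length_ge_1: "1 \<le> block_length y" unfolding block_length_def by simp

text \<open>
  The block consists of the points \<open>V i z\<close> with \<open>i \<le> r\<close>, all of which increase with \<open>z\<close>.
\<close>

lemma branch_antimono_visits: "branch_antimono (visits t)"
  unfolding branch_antimono_def
proof (intro allI monotone_onI)
  fix r and x y :: real assume xy: "x \<in> {0<..<1}" "y \<in> {0<..<1}" "x \<le> y"
  then have "V i x \<le> V i y" for i by (intro V_le) auto
  then have "of_bool (V i y \<le> t) \<le> (of_bool (V i x \<le> t) :: real)" for i using order_trans by auto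
  then show "visits t (V r y) \<le> visits t (V r x)"
    using visits_V[of x t r] visits_V[of y t r] xy
    by (simp only: atLeastLessThan_iff greaterThanLessThan_iff less_imp_le simp_thms sum_mono)
qed

lemma branch_antimono_cut: "branch_antimono f \<Longrightarrow> branch_antimono (cut l f)"
  unfolding branch_antimono_def cut_def monotone_on_def by (auto simp: digit_V)

lemma branch_antimono_block_length: "branch_antimono block_length"
  unfolding branch_antimono_def block_length_def monotone_on_def by (auto simp: digit_V)

lemma branch_antimono_affine:
  "branch_antimono f \<Longrightarrow> 0 \<le> a \<Longrightarrow> branch_antimono (\<lambda>y. a * f y + c)"
  unfolding branch_antimono_def monotone_on_def by (auto intro: mult_left_mono)

end

locale integrable_branch_map = decreasing_branch_map +
  assumes block_length_integrable: "integrable leb01 block_length"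
begin

definition mean_length :: real where "mean_length = (\<integral>y. block_length y \<partial>leb01)"

definition length_tail :: "nat \<Rightarrow> real" where
  "length_tail l = (\<integral>y. block_length y - cut l block_length y \<partial>leb01)"

definition sq_length :: "nat \<Rightarrow> real" where
  "sq_length l = (\<integral>y. (cut l block_length y)\<^sup>2 \<partial>leb01)"

text \<open>
  Kac's formula for the distribution function of the invariant measure of \<open>T\<close>.
\<close>

definition Fstar :: "real \<Rightarrow> real" where
  "Fstar t = Estar (visits t) / Estar block_length"

text \<open>
  The mean of a block sum after truncation; without truncation the mean would be zero by the choice
  of \<open>Fstar\<close>, so the drift is controlled by the blocks that are cut away.
\<close>

definition drift :: "nat \<Rightarrow> real \<Rightarrow> real" where
  "drift l t = Estar (cut l (visits t)) - Fstar t * Estar (cut l block_length)"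

definition fluct :: "nat \<Rightarrow> real \<Rightarrow> real \<Rightarrow> real" where
  "fluct l t y = cut l (visits t) y - Fstar t * cut l block_length y - drift l t"

lemma mean_length_ge_1: "1 \<le> mean_length"
proof -
  have "(\<integral>y. 1 \<partial>leb01) \<le> mean_length"
    unfolding mean_length_def by (intro integral_mono block_length_integrable) (auto simp: block_length_ge_1)
  then show ?thesis by simp
qed

lemma visits_integrable: "integrable leb01 (visits t)"
  by (rule Bochner_Integration.integrable_bound[OF block_length_integrable])
     (use visits_nonneg visits_le block_length_ge_1 in \<open>auto intro!: AE_I2 simp: abs_of_nonneg order_trans[OF zero_le_one]\<close>)

lemma cut_integrable: "integrable leb01 f \<Longrightarrow> f \<in> borel_measurable borel \<Longrightarrow> integrable leb01 (cut l f)"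
  by (rule Bochner_Integration.integrable_bound[of _ f]) (auto simp: cut_def)

lemma Estar_block_length_ge_1: "1 \<le> Estar block_length"
  using Estar_mono[of "\<lambda>_. 1" block_length] block_length_integrable block_length_ge_1
  by (simp add: Estar_const)

lemma Fstar_nonneg: "0 \<le> Fstar t" and Fstar_le_1: "Fstar t \<le> 1" and Fstar_mono: "t \<le> t' \<Longrightarrow> Fstar t \<le> Fstar t'"
proof -
  have "0 \<le> Estar (visits t)"
    using Estar_mono[of "\<lambda>_. 0" "visits t"] visits_integrable visits_nonneg by (simp add: Estar_const)
  then show "0 \<le> Fstar t" using Estar_block_length_ge_1 by (simp add: Fstar_def)
  have "Estar (visits t) \<le> Estar block_length"
    by (intro Estar_mono visits_integrable block_length_integrable visits_le)
  then show "Fstar t \<le> 1" using Estar_block_length_ge_1 by (simp add: Fstar_def)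
  assume "t \<le> t'"
  then have "Estar (visits t) \<le> Estar (visits t')"
    by (intro Estar_mono visits_integrable visits_mono)
  then show "Fstar t \<le> Fstar t'"
    using Estar_block_length_ge_1 by (simp add: Fstar_def divide_right_mono)
qed

lemma Fstar_measurable [measurable]: "Fstar \<in> borel_measurable borel"
  by (intro borel_measurable_mono monoI Fstar_mono)

lemma Estar_cut_visits_mono: "t \<le> t' \<Longrightarrow> Estar (cut l (visits t)) \<le> Estar (cut l (visits t'))"
  by (intro Estar_mono cut_integrable visits_integrable) (auto simp: cut_def visits_mono)

lemma drift_measurable [measurable]: "drift l \<in> borel_measurable borel"
proof -
  have [measurable]: "(\<lambda>t. Estar (cut l (visits t))) \<in> borel_measurable borel"
    by (intro borel_measurable_mono monoI Estar_cut_visits_mono)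
  show ?thesis unfolding drift_def by measurable
qed

lemma cut_visits_measurable2 [measurable]:
  "(\<lambda>(y, t). cut l (visits t) y) \<in> borel_measurable (borel \<Otimes>\<^sub>M borel)"
proof -
  have [measurable]: "(\<lambda>p. visits (snd p) (fst p)) \<in> borel_measurable (borel \<Otimes>\<^sub>M borel)"
    using visits_measurable2 by (simp add: case_prod_beta')
  show ?thesis unfolding cut_def case_prod_beta' by measurable
qed

lemma fluct_measurable2 [measurable]:
  "(\<lambda>(y, t). fluct l t y) \<in> borel_measurable (borel \<Otimes>\<^sub>M borel)"
proof -
  have [measurable]: "(\<lambda>p. cut l (visits (snd p)) (fst p)) \<in> borel_measurable (borel \<Otimes>\<^sub>M borel)"
    using cut_visits_measurable2[of l] by (simp add: case_prod_beta')
  have [measurable]: "cut l block_length \<in> borel_measurable borel" by measurable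
  have [measurable]: "(\<lambda>p. cut l block_length (fst p)) \<in> borel_measurable (borel \<Otimes>\<^sub>M borel :: (real \<times> real) measure)"
    "(\<lambda>p. drift l (snd p)) \<in> borel_measurable (borel \<Otimes>\<^sub>M borel :: (real \<times> real) measure)"
    by (rule measurable_compose[OF measurable_fst], measurable)
  show ?thesis unfolding fluct_def case_prod_beta' by measurable
qed

lemma fluct_measurable [measurable]: "fluct l t \<in> borel_measurable borel"
  unfolding fluct_def by measurable

lemma fluct_measurable_t [measurable]: "(\<lambda>t. fluct l t y) \<in> borel_measurable borel"
  using measurable_compose[OF _ fluct_measurable2, of "\<lambda>t. (y, t)" borel] by simp

lemma Fstar_cut_le: "\<bar>cut l (visits t) y - Fstar t * cut l block_length y\<bar> \<le> cut l block_length y"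
proof (cases "digit y < l")
  case True
  have "0 \<le> Fstar t * block_length y" "Fstar t * block_length y \<le> block_length y"
    using Fstar_nonneg[of t] Fstar_le_1[of t] block_length_ge_1[of y] by (auto simp: mult_left_le_one_le)
  then show ?thesis using True visits_nonneg[of t y] visits_le[of t y] by (simp add: cut_def abs_le_iff)
qed (simp add: cut_def)

lemma length_tail_integrable: "integrable leb01 (\<lambda>y. block_length y - cut l block_length y)"
  by (intro Bochner_Integration.integrable_diff block_length_integrable cut_integrable) auto

lemma length_tail_le: "length_tail l \<le> mean_length"
  unfolding length_tail_def mean_length_def using block_length_ge_1 order_trans[OF zero_le_one]
  by (intro integral_mono length_tail_integrable block_length_integrable) (auto simp: cut_def)

lemma drift_bound: "\<bar>drift l t\<bar> \<le> 3 * length_tail l"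
proof -
  let ?u = "\<lambda>y. visits t y - Fstar t * block_length y"
  have uI: "integrable leb01 ?u" using visits_integrable block_length_integrable by simp
  have um: "?u \<in> borel_measurable borel" by measurable
  have "Estar (\<lambda>y. Fstar t * block_length y) = Fstar t * Estar block_length"
    by (rule Estar_cmult[OF block_length_integrable])
  also have "\<dots> = Estar (visits t)"
    using Estar_block_length_ge_1 by (simp add: Fstar_def)
  finally have "Estar (\<lambda>y. Fstar t * block_length y) = Estar (visits t)" .
  then have "Estar ?u = 0"
    using Estar_diff[OF visits_integrable, of "\<lambda>y. Fstar t * block_length y" t] block_length_integrable by simp
  moreover have "Estar (cut l ?u) = drift l t"
  proof -
    have "cut l ?u = (\<lambda>y. cut l (visits t) y - Fstar t * cut l block_length y)" by (auto simp: cut_def)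
    then show ?thesis
      unfolding drift_def
      by (simp add: Estar_diff Estar_cmult cut_integrable visits_integrable block_length_integrable)
  qed
  ultimately have "drift l t = - Estar (\<lambda>y. ?u y - cut l ?u y)"
    using Estar_diff[OF uI cut_integrable[OF uI um]] by simp
  then have "\<bar>drift l t\<bar> \<le> 3 * (\<integral>y. \<bar>?u y - cut l ?u y\<bar> \<partial>leb01)"
    using Estar_bound[of "\<lambda>y. ?u y - cut l ?u y"] uI cut_integrable[OF uI um] by simp
  also have "(\<integral>y. \<bar>?u y - cut l ?u y\<bar> \<partial>leb01) \<le> length_tail l"
    unfolding length_tail_def
  proof (intro integral_mono length_tail_integrable)
    fix y
    show "\<bar>?u y - cut l ?u y\<bar> \<le> block_length y - cut l block_length y"
      using Fstar_cut_le[of "Suc (digit y)" t y] by (auto simp: cut_def)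
  qed (use uI cut_integrable[OF uI um] in auto)
  finally show ?thesis by simp
qed

lemma cut_block_length_le: "cut l block_length y \<le> real l" "0 \<le> cut l block_length y"
  unfolding cut_def block_length_def by auto

lemma fluct_bound: "\<bar>fluct l t y\<bar> \<le> cut l block_length y + 3 * mean_length"
  using Fstar_cut_le[of l t y] drift_bound[of l t] length_tail_le[of l] unfolding fluct_def by linarith

lemma fluct_bound': "\<bar>fluct l t y\<bar> \<le> real l + 3 * mean_length"
  using fluct_bound[of l t y] cut_block_length_le(1)[of l y] by linarith

definition fluct_sum :: "nat \<Rightarrow> nat \<Rightarrow> real \<Rightarrow> real \<Rightarrow> real" where
  "fluct_sum l k t y = (\<Sum>i<k. fluct l t ((jump ^^ i) y))"

definition fluct_norm :: "nat \<Rightarrow> nat \<Rightarrow> real \<Rightarrow> real" where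
  "fluct_norm l k y = (\<integral>t. \<bar>fluct_sum l k t y\<bar> \<partial>leb01)"

lemma fluct_sum_measurable2 [measurable]:
  "(\<lambda>(y, t). fluct_sum l k t y) \<in> borel_measurable (borel \<Otimes>\<^sub>M borel)"
proof -
  have "(\<lambda>p. fluct l (snd p) ((jump ^^ i) (fst p))) \<in> borel_measurable (borel \<Otimes>\<^sub>M borel)" for i
    using measurable_compose[OF _ fluct_measurable2[of l], of "\<lambda>p. ((jump ^^ i) (fst p), snd p)" "borel \<Otimes>\<^sub>M borel"]
    by simp
  then show ?thesis unfolding fluct_sum_def case_prod_beta' by measurable
qed

lemma fluct_sum_measurable_t [measurable]: "(\<lambda>t. fluct_sum l k t y) \<in> borel_measurable borel"
  unfolding fluct_sum_def by measurable

lemma fluct_sum_measurable [measurable]: "fluct_sum l k t \<in> borel_measurable borel"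
  unfolding fluct_sum_def by measurable

lemma fluct_sum_bound: "\<bar>fluct_sum l k t y\<bar> \<le> real k * (real l + 3 * mean_length)"
proof -
  have "\<bar>fluct_sum l k t y\<bar> \<le> (\<Sum>i<k. \<bar>fluct l t ((jump ^^ i) y)\<bar>)"
    unfolding fluct_sum_def by (rule sum_abs)
  also have "\<dots> \<le> (\<Sum>i<k. real l + 3 * mean_length)" by (intro sum_mono fluct_bound')
  finally show ?thesis by simp
qed

lemma fluct_sum_integrable_t: "integrable leb01 (\<lambda>t. fluct_sum l k t y)"
  by (rule integrable_leb01_bounded[OF _ fluct_sum_bound]) measurable

lemma fluct_norm_measurable [measurable]: "fluct_norm l k \<in> borel_measurable borel"
proof -
  have m: "(\<lambda>(y, t). \<bar>fluct_sum l k t y\<bar>) \<in> borel_measurable (borel \<Otimes>\<^sub>M leb01)"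
  proof -
    have [measurable]: "(\<lambda>p. fluct_sum l k (snd p) (fst p)) \<in> borel_measurable (borel \<Otimes>\<^sub>M borel)"
      using fluct_sum_measurable2[of l k] by (simp add: case_prod_beta')
    have "sets (borel \<Otimes>\<^sub>M leb01) = sets (borel \<Otimes>\<^sub>M borel :: (real \<times> real) measure)"
      by (rule sets_pair_measure_cong) auto
    then show ?thesis
      unfolding case_prod_beta' by (subst measurable_cong_sets[OF _ refl]) measurable
  qed
  show ?thesis unfolding fluct_norm_def
    by (rule leb01.borel_measurable_lebesgue_integral[OF m])
qed

text \<open>
  To apply \<open>variance_bound\<close>, the drift is added to one of the two parts of the fluctuation
  according to its sign, which keeps both parts nonnegative. With \<open>\<rho>\<close> the mean block length, the first moments add up to at most
  \<open>5 \<rho>\<close> and the square of the fluctuation is at most \<open>2 L\<^sup>2 + 18 \<rho>\<^sup>2\<close> for a truncated block of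
  length \<open>L\<close>; hence \<open>1512 = 9 * 18 + 54 * 25\<close>.
\<close>

lemma fluct_sum_second_moment:
  "(\<integral>y. (fluct_sum l k t y)\<^sup>2 \<partial>leb01) \<le> real k * (18 * sq_length l + 1512 * mean_length\<^sup>2)"
proof -
  \<comment> \<open>the fluctuation is \<open>g - h\<close>\<close>
  define g where "g y = cut l (visits t) y + max (- drift l t) 0" for y
  define h where "h y = Fstar t * cut l block_length y + max (drift l t) 0" for y
  let ?\<rho> = mean_length
  have \<rho>: "1 \<le> ?\<rho>" by (rule mean_length_ge_1)
  have eq: "g y - h y = fluct l t y" for y unfolding g_def h_def fluct_def by auto
  have [measurable]: "g \<in> borel_measurable borel" "h \<in> borel_measurable borel"
    unfolding g_def h_def by measurable
  have dr: "\<bar>drift l t\<bar> \<le> 3 * ?\<rho>" using drift_bound[of l t] length_tail_le[of l] by linarith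
  have c0: "0 \<le> cut l (visits t) y" "cut l (visits t) y \<le> cut l block_length y" for y
    using visits_nonneg visits_le by (auto simp: cut_def)
  have F0: "0 \<le> Fstar t * cut l block_length y" "Fstar t * cut l block_length y \<le> cut l block_length y" for y
    using Fstar_nonneg[of t] Fstar_le_1[of t] cut_block_length_le(2)[of l y] by (auto simp: mult_left_le_one_le)
  have cI: "integrable leb01 (cut l (visits t))" "integrable leb01 (cut l block_length)"
    by (auto intro!: cut_integrable visits_integrable block_length_integrable)
  have cut_le: "(\<integral>y. cut l block_length y \<partial>leb01) \<le> ?\<rho>"
    unfolding mean_length_def using block_length_ge_1 order_trans[OF zero_le_one]
    by (intro integral_mono cI block_length_integrable) (auto simp: cut_def)
  have "(\<integral>y. (\<Sum>i<k. g ((jump ^^ i) y) - h ((jump ^^ i) y))\<^sup>2 \<partial>leb01)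
    \<le> real k * (9 * (\<integral>y. (g y - h y)\<^sup>2 \<partial>leb01) + 54 * ((\<integral>y. g y \<partial>leb01) + (\<integral>y. h y \<partial>leb01))\<^sup>2)"
  proof (rule variance_bound)
    show "0 \<le> g y" "0 \<le> h y" for y using c0(1)[of y] F0(1)[of y] by (auto simp: g_def h_def)
    show "g y \<le> real l + 3 * ?\<rho>" "h y \<le> real l + 3 * ?\<rho>" for y
      using c0(2)[of y] F0(2)[of y] cut_block_length_le(1)[of l y] dr \<rho> by (auto simp: g_def h_def)
    show "branch_antimono g"
      unfolding g_def
      using branch_antimono_affine[OF branch_antimono_cut[OF branch_antimono_visits[of t]], of 1] by simp
    show "branch_antimono h"
      unfolding h_def
      by (intro branch_antimono_affine branch_antimono_cut branch_antimono_block_length Fstar_nonneg)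
    have "Estar (\<lambda>y. g y - h y) = Estar (\<lambda>y. (cut l (visits t) y - Fstar t * cut l block_length y) - drift l t)"
      unfolding eq fluct_def ..
    also have "\<dots> = 0"
      using cI by (simp add: Estar_diff Estar_cmult Estar_const drift_def)
    finally show "Estar (\<lambda>y. g y - h y) = 0" .
  qed measurable
  also have "\<dots> \<le> real k * (9 * (2 * sq_length l + 18 * ?\<rho>\<^sup>2) + 54 * (5 * ?\<rho>)\<^sup>2)"
  proof (intro mult_left_mono add_mono power_mono)
    have I: "integrable leb01 (\<lambda>y. (cut l block_length y)\<^sup>2)"
    proof (rule integrable_leb01_bounded)
      fix y show "\<bar>(cut l block_length y)\<^sup>2\<bar> \<le> (real l)\<^sup>2"
        using power_mono[OF cut_block_length_le(1)[of l y] cut_block_length_le(2), of 2] by simp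
    qed measurable
    have "(\<integral>y. (g y - h y)\<^sup>2 \<partial>leb01) \<le> (\<integral>y. 2 * (cut l block_length y)\<^sup>2 + 18 * ?\<rho>\<^sup>2 \<partial>leb01)"
    proof (rule integral_mono)
      show "integrable leb01 (\<lambda>y. (g y - h y)\<^sup>2)"
      proof (rule integrable_leb01_bounded)
        fix y show "\<bar>(g y - h y)\<^sup>2\<bar> \<le> (real l + 3 * ?\<rho>)\<^sup>2"
          using power_mono[OF fluct_bound'[of l t y], of 2] by (simp add: eq)
      qed measurable
      fix y
      have "(g y - h y)\<^sup>2 \<le> (cut l block_length y + 3 * ?\<rho>)\<^sup>2"
        using power_mono[OF fluct_bound[of l t y], of 2] by (simp add: eq)
      also have "\<dots> \<le> 2 * (cut l block_length y)\<^sup>2 + 18 * ?\<rho>\<^sup>2"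
        using zero_le_power2[of "cut l block_length y - 3 * ?\<rho>"] by (simp add: power2_sum power2_diff power_mult_distrib)
      finally show "(g y - h y)\<^sup>2 \<le> 2 * (cut l block_length y)\<^sup>2 + 18 * ?\<rho>\<^sup>2" .
    qed (use I in auto)
    then show "(\<integral>y. (g y - h y)\<^sup>2 \<partial>leb01) \<le> 2 * sq_length l + 18 * ?\<rho>\<^sup>2"
      using I by (simp add: sq_length_def)
    have "(\<integral>y. g y \<partial>leb01) = (\<integral>y. cut l (visits t) y \<partial>leb01) + max (- drift l t) 0"
      unfolding g_def using cI by simp
    moreover have "(\<integral>y. cut l (visits t) y \<partial>leb01) \<le> (\<integral>y. cut l block_length y \<partial>leb01)"
      by (intro integral_mono cI c0)
    moreover have "(\<integral>y. h y \<partial>leb01) = (\<integral>y. Fstar t * cut l block_length y \<partial>leb01) + max (drift l t) 0"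
      unfolding h_def using cI by simp
    moreover have "(\<integral>y. Fstar t * cut l block_length y \<partial>leb01) \<le> (\<integral>y. cut l block_length y \<partial>leb01)"
      using cI by (intro integral_mono F0) auto
    ultimately show "(\<integral>y. g y \<partial>leb01) + (\<integral>y. h y \<partial>leb01) \<le> 5 * ?\<rho>"
      using cut_le dr by auto
    show "0 \<le> (\<integral>y. g y \<partial>leb01) + (\<integral>y. h y \<partial>leb01)"
      using c0(1) F0(1) by (auto intro!: add_nonneg_nonneg integral_nonneg_AE simp: g_def h_def)
  qed auto
  finally show ?thesis unfolding eq fluct_sum_def by (simp add: power_mult_distrib algebra_simps)
qed

text \<open>
  Chebyshev's inequality, after exchanging the integrals over \<open>y\<close> and \<open>t\<close>.
\<close>

lemma fluct_norm_tail:
  assumes "0 < x"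
  shows "measure leb01 {y. x < fluct_norm l k y} \<le> real k * (18 * sq_length l + 1512 * mean_length\<^sup>2) / x\<^sup>2"
proof -
  let ?C = "real k * (real l + 3 * mean_length)" and ?K = "real k * (18 * sq_length l + 1512 * mean_length\<^sup>2)"
  let ?q = "\<lambda>y. \<integral>t. (fluct_sum l k t y)\<^sup>2 \<partial>leb01"
  have m [measurable]: "(\<lambda>p. fluct_sum l k (snd p) (fst p)) \<in> borel_measurable (leb01 \<Otimes>\<^sub>M leb01)"
  proof -
    have "sets (leb01 \<Otimes>\<^sub>M leb01) = sets (borel \<Otimes>\<^sub>M borel :: (real \<times> real) measure)"
      by (rule sets_pair_measure_cong) auto
    then show ?thesis
      using fluct_sum_measurable2[of l k] by (subst measurable_cong_sets[OF _ refl]) (auto simp: case_prod_beta')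
  qed
  have sq_bd: "(fluct_sum l k t y)\<^sup>2 \<le> ?C\<^sup>2" for t y
    using power_mono[OF fluct_sum_bound[of l k t y], of 2] by simp
  have sqI: "integrable leb01 (\<lambda>t. (fluct_sum l k t y)\<^sup>2)" "integrable leb01 (\<lambda>y. (fluct_sum l k t y)\<^sup>2)" for t y
    using sq_bd by (auto intro!: integrable_leb01_bounded[of _ "?C\<^sup>2"])
  interpret P: pair_sigma_finite leb01 leb01 ..
  have "(\<integral>\<^sup>+y. ennreal (?q y) \<partial>leb01) = (\<integral>\<^sup>+y. \<integral>\<^sup>+t. ennreal ((fluct_sum l k t y)\<^sup>2) \<partial>leb01 \<partial>leb01)"
    by (intro nn_integral_cong nn_integral_eq_integral[symmetric] sqI) auto
  also have "\<dots> = (\<integral>\<^sup>+t. \<integral>\<^sup>+y. ennreal ((fluct_sum l k t y)\<^sup>2) \<partial>leb01 \<partial>leb01)"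
    by (rule P.Fubini'[symmetric]) (simp add: case_prod_beta')
  also have "\<dots> = (\<integral>\<^sup>+t. ennreal (\<integral>y. (fluct_sum l k t y)\<^sup>2 \<partial>leb01) \<partial>leb01)"
    by (intro nn_integral_cong nn_integral_eq_integral sqI) auto
  also have "\<dots> \<le> (\<integral>\<^sup>+t. ennreal ?K \<partial>leb01)"
    by (intro nn_integral_mono ennreal_leI fluct_sum_second_moment)
  finally have q: "(\<integral>\<^sup>+y. ennreal (?q y) \<partial>leb01) \<le> ennreal ?K" by simp
  have K0: "0 \<le> ?K" unfolding sq_length_def by simp
  have "ennreal (x\<^sup>2) * emeasure leb01 {y. x < fluct_norm l k y}
      = (\<integral>\<^sup>+y. ennreal (x\<^sup>2) * indicator {y. x < fluct_norm l k y} y \<partial>leb01)"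
    by (subst nn_integral_cmult_indicator) auto
  also have "\<dots> \<le> (\<integral>\<^sup>+y. ennreal (?q y) \<partial>leb01)"
  proof (rule nn_integral_mono)
    fix y
    show "ennreal (x\<^sup>2) * indicator {y. x < fluct_norm l k y} y \<le> ennreal (?q y)"
    proof (cases "x < fluct_norm l k y")
      case True
      then have "x\<^sup>2 \<le> (fluct_norm l k y)\<^sup>2" using assms by (intro power_mono) auto
      also have "\<dots> \<le> ?q y"
        unfolding fluct_norm_def by (rule square_integral_le[OF _ fluct_sum_bound]) measurable
      finally show ?thesis using True by (simp add: ennreal_leI)
    qed simp
  qed
  also note q
  finally have "ennreal (x\<^sup>2 * measure leb01 {y. x < fluct_norm l k y}) \<le> ennreal ?K"
    by (simp add: leb01.emeasure_eq_measure ennreal_mult)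
  then have "x\<^sup>2 * measure leb01 {y. x < fluct_norm l k y} \<le> ?K"
    using K0 by (subst (asm) ennreal_le_iff) auto
  then show ?thesis using assms by (simp add: field_simps)
qed

text \<open>
  Two blocks with the same digit visit the points \<open>V j z\<close> and \<open>V j z'\<close>, and every \<open>V j\<close> contracts, so the
  difference of the block sums is at most the block length times the distance of the next jump
  points.
\<close>

lemma fluct_oscillation:
  assumes "y \<in> interior_orbit" "y' \<in> interior_orbit" "same_digits k y y'" "i < k"
  shows "(\<integral>t. \<bar>fluct l t ((jump ^^ i) y) - fluct l t ((jump ^^ i) y')\<bar> \<partial>leb01)
    \<le> real l / 2 * (1/2) ^ (k - Suc i)"
proof -
  let ?a = "(jump ^^ i) y" and ?b = "(jump ^^ i) y'"
  define r where "r = digit ?a"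
  have rb: "digit ?b = r" using assms by (simp add: r_def same_digits_def)
  have ab: "?a \<in> {0<..<1}" "?b \<in> {0<..<1}" using assms interior_orbitD by blast+
  have jab: "jump ?a \<in> {0<..<1}" "jump ?b \<in> {0<..<1}"
    using interior_orbitD[OF assms(1), of "Suc i"] interior_orbitD[OF assms(2), of "Suc i"] by simp_all
  show ?thesis
  proof (cases "r < l")
    case False
    then show ?thesis using rb by (simp add: fluct_def cut_def flip: r_def)
  next
    case True
    have bI: "integrable leb01 (\<lambda>t. \<bar>of_bool (V j (jump ?a) \<le> t) - of_bool (V j (jump ?b) \<le> t)\<bar> :: real)" for j
      by (rule integrable_leb01_bounded[of _ 1]) auto
    have va: "visits t ?a = (\<Sum>j\<le>r. of_bool (V j (jump ?a) \<le> t))" for t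
      using visits_V[of "jump ?a" t r] V_jump(1)[OF ab(1)] jab by (simp add: r_def)
    have vb: "visits t ?b = (\<Sum>j\<le>r. of_bool (V j (jump ?b) \<le> t))" for t
      using visits_V[of "jump ?b" t r] V_jump(1)[OF ab(2)] jab rb by simp
    have eq: "fluct l t ?a - fluct l t ?b = (\<Sum>j\<le>r. of_bool (V j (jump ?a) \<le> t) - of_bool (V j (jump ?b) \<le> t))" for t
    proof -
      have "fluct l t ?a - fluct l t ?b = visits t ?a - visits t ?b"
        using True rb by (simp add: fluct_def cut_def block_length_def flip: r_def)
      then show ?thesis by (simp only: va vb sum_subtractf)
    qed
    have "(\<integral>t. \<bar>fluct l t ?a - fluct l t ?b\<bar> \<partial>leb01)
        \<le> (\<integral>t. (\<Sum>j\<le>r. \<bar>of_bool (V j (jump ?a) \<le> t) - of_bool (V j (jump ?b) \<le> t)\<bar>) \<partial>leb01)"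
    proof (rule integral_mono)
      show "integrable leb01 (\<lambda>t. \<bar>fluct l t ?a - fluct l t ?b\<bar>)"
      proof (rule integrable_leb01_bounded)
        fix t show "\<bar>\<bar>fluct l t ?a - fluct l t ?b\<bar>\<bar> \<le> 2 * (real l + 3 * mean_length)"
          using order_trans[OF abs_triangle_ineq4 add_mono[OF fluct_bound'[of l t ?a] fluct_bound'[of l t ?b]]]
          by simp
      qed measurable
    qed (use bI in \<open>auto simp: eq intro: sum_abs\<close>)
    also have "\<dots> = (\<Sum>j\<le>r. \<integral>t. \<bar>of_bool (V j (jump ?a) \<le> t) - of_bool (V j (jump ?b) \<le> t)\<bar> \<partial>leb01)"
      by (intro Bochner_Integration.integral_sum bI)
    also have "\<dots> \<le> (\<Sum>j\<le>r. \<bar>jump ?a - jump ?b\<bar> / 2)"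
    proof (rule sum_mono)
      fix j
      show "(\<integral>t. \<bar>of_bool (V j (jump ?a) \<le> t) - of_bool (V j (jump ?b) \<le> t)\<bar> \<partial>leb01) \<le> \<bar>jump ?a - jump ?b\<bar> / 2"
        using integral_step_difference_le[of "V j (jump ?a)" "V j (jump ?b)"] V_contract[of "jump ?a" "jump ?b" j]
          V_in[OF jab(1), of j] V_in[OF jab(2), of j] jab
        by simp
    qed
    also have "\<dots> = real (Suc r) / 2 * \<bar>jump ?a - jump ?b\<bar>" by simp
    also have "\<dots> \<le> real l / 2 * (1/2) ^ (k - Suc i)"
      using same_digits_contract[OF assms(1-3), of "Suc i"] assms(4) True by (intro mult_mono) auto
    finally show ?thesis .
  qed
qed

text \<open>
  The distances of the jump points at least double at every step and are at most 1 at the last one, so their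
  sum is bounded independently of \<open>k\<close>.
\<close>

lemma fluct_norm_oscillation:
  assumes "y \<in> interior_orbit" "y' \<in> interior_orbit" "same_digits k y y'"
  shows "fluct_norm l k y' \<le> fluct_norm l k y + real l"
proof -
  let ?d = "\<lambda>i t. \<bar>fluct l t ((jump ^^ i) y) - fluct l t ((jump ^^ i) y')\<bar>"
  have dI: "integrable leb01 (?d i)" for i
  proof (rule integrable_leb01_bounded)
    fix t show "\<bar>?d i t\<bar> \<le> 2 * (real l + 3 * mean_length)"
      using order_trans[OF abs_triangle_ineq4
          add_mono[OF fluct_bound'[of l t "(jump ^^ i) y"] fluct_bound'[of l t "(jump ^^ i) y'"]]]
      by simp
  qed measurable
  have geo: "(\<Sum>i<k. (1/2::real) ^ (k - Suc i)) \<le> 2"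
    by (subst sum.nat_diff_reindex, subst sum_gp_strict) (simp add: field_simps)
  have "fluct_norm l k y' \<le> (\<integral>t. \<bar>fluct_sum l k t y\<bar> + (\<Sum>i<k. ?d i t) \<partial>leb01)"
    unfolding fluct_norm_def
  proof (rule integral_mono)
    fix t
    have "\<bar>fluct_sum l k t y - fluct_sum l k t y'\<bar> \<le> (\<Sum>i<k. ?d i t)"
      unfolding fluct_sum_def sum_subtractf[symmetric] by (rule sum_abs)
    then show "\<bar>fluct_sum l k t y'\<bar> \<le> \<bar>fluct_sum l k t y\<bar> + (\<Sum>i<k. ?d i t)" by linarith
  qed (use fluct_sum_integrable_t dI in auto)
  also have "\<dots> = fluct_norm l k y + (\<Sum>i<k. \<integral>t. ?d i t \<partial>leb01)"
    unfolding fluct_norm_def using fluct_sum_integrable_t dI by simp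
  also have "(\<Sum>i<k. \<integral>t. ?d i t \<partial>leb01) \<le> (\<Sum>i<k. real l / 2 * (1/2) ^ (k - Suc i))"
    by (intro sum_mono fluct_oscillation assms) auto
  also have "\<dots> = real l / 2 * (\<Sum>i<k. (1/2) ^ (k - Suc i))" by (simp add: sum_distrib_left)
  also have "\<dots> \<le> real l / 2 * 2" by (intro mult_left_mono geo) auto
  finally show ?thesis by simp
qed

lemma fluct_norm_split:
  assumes "k < n"
  shows "fluct_norm l k y \<le> fluct_norm l n y + (real l + 3 * mean_length) + fluct_norm l (n - Suc k) ((jump ^^ Suc k) y)"
proof -
  have split: "fluct_sum l n t y = fluct_sum l k t y + fluct l t ((jump ^^ k) y) + fluct_sum l (n - Suc k) t ((jump ^^ Suc k) y)" for t
  proof -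
    have "fluct_sum l (Suc k + m) t y = fluct_sum l (Suc k) t y + fluct_sum l m t ((jump ^^ Suc k) y)" for m
    proof (induction m)
      case (Suc m)
      have "(jump ^^ m) ((jump ^^ Suc k) y) = (jump ^^ (Suc k + m)) y"
        by (subst add.commute) (simp only: funpow_add o_apply)
      with Suc show ?case by (simp add: fluct_sum_def del: funpow.simps)
    qed (simp add: fluct_sum_def)
    from this[of "n - Suc k"] assms show ?thesis by (simp add: fluct_sum_def del: funpow.simps)
  qed
  have "fluct_norm l k y \<le> (\<integral>t. \<bar>fluct_sum l n t y\<bar> + (real l + 3 * mean_length)
      + \<bar>fluct_sum l (n - Suc k) t ((jump ^^ Suc k) y)\<bar> \<partial>leb01)"
    unfolding fluct_norm_def
  proof (rule integral_mono)
    fix t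
    show "\<bar>fluct_sum l k t y\<bar> \<le> \<bar>fluct_sum l n t y\<bar> + (real l + 3 * mean_length)
        + \<bar>fluct_sum l (n - Suc k) t ((jump ^^ Suc k) y)\<bar>"
      using split[of t] fluct_bound'[of l t "(jump ^^ k) y"] by linarith
  qed (use fluct_sum_integrable_t in auto)
  also have "\<dots> = fluct_norm l n y + (real l + 3 * mean_length) + fluct_norm l (n - Suc k) ((jump ^^ Suc k) y)"
    unfolding fluct_norm_def using fluct_sum_integrable_t by simp
  finally show ?thesis .
qed

text \<open>
  \<open>n\<close> times the difference of the distribution functions of the empirical measure and its limit, for
  the orbit segment that starts with \<open>y\<close> itself.
\<close>

definition orbit_sum :: "nat \<Rightarrow> real \<Rightarrow> real \<Rightarrow> real" where
  "orbit_sum n t y = (\<Sum>k<n. of_bool ((T ^^ k) y \<le> t) - Fstar t)"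

lemma orbit_sum_measurable_t [measurable]: "(\<lambda>t. orbit_sum n t y) \<in> borel_measurable borel"
  unfolding orbit_sum_def by measurable

lemma orbit_sum_bound: "\<bar>orbit_sum n t y\<bar> \<le> real n"
proof -
  have "\<bar>of_bool ((T ^^ k) y \<le> t) - Fstar t\<bar> \<le> 1" for k
    using Fstar_nonneg[of t] Fstar_le_1[of t] by auto
  then have "\<bar>orbit_sum n t y\<bar> \<le> (\<Sum>k<n. 1)"
    unfolding orbit_sum_def by (intro order_trans[OF sum_abs] sum_mono) auto
  then show ?thesis by simp
qed

lemma orbit_sum_split: "orbit_sum (m + n) t y = orbit_sum m t y + orbit_sum n t ((T ^^ m) y)"
  by (induction n) (simp_all add: orbit_sum_def funpow_add add.commute[of m])

lemma orbit_sum_block: "orbit_sum (Suc (digit y)) t y = visits t y - Fstar t * block_length y"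
  unfolding orbit_sum_def visits_def block_length_def by (simp only: sum_subtractf sum_constant card_lessThan mult.commute)

text \<open>
  The segment of length \<open>n\<close> consists of \<open>m\<close> complete blocks and an initial part of the next block.
  Since blocks are nonempty, \<open>m \<le> n\<close>.
\<close>

lemma orbit_sum_blocks:
  "\<exists>m\<le>n. \<exists>q\<le>Suc (digit ((jump ^^ m) y)). \<forall>t.
     orbit_sum n t y = (\<Sum>i<m. visits t ((jump ^^ i) y) - Fstar t * block_length ((jump ^^ i) y))
       + orbit_sum q t ((jump ^^ m) y)"
proof (induction n arbitrary: y rule: less_induct)
  case (less n)
  show ?case
  proof (cases "n < Suc (digit y)")
    case True
    then show ?thesis by (intro exI[of _ 0]) (auto intro!: exI[of _ n])
  next
    case False
    define n' where "n' = n - Suc (digit y)"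
    have n: "n = Suc (digit y) + n'" using False by (simp add: n'_def)
    then have "n' < n" by simp
    from less[OF this, of "jump y"] obtain m q where mq: "m \<le> n'" "q \<le> Suc (digit ((jump ^^ m) (jump y)))"
      "\<And>t. orbit_sum n' t (jump y) = (\<Sum>i<m. visits t ((jump ^^ i) (jump y)) - Fstar t * block_length ((jump ^^ i) (jump y)))
         + orbit_sum q t ((jump ^^ m) (jump y))" by blast
    have "orbit_sum n t y = (\<Sum>i<Suc m. visits t ((jump ^^ i) y) - Fstar t * block_length ((jump ^^ i) y))
       + orbit_sum q t ((jump ^^ Suc m) y)" for t
    proof -
      have "orbit_sum n t y = (visits t y - Fstar t * block_length y) + orbit_sum n' t (jump y)"
        unfolding n orbit_sum_split orbit_sum_block by (simp add: jump_def)
      also have "\<dots> = (\<Sum>i<Suc m. visits t ((jump ^^ i) y) - Fstar t * block_length ((jump ^^ i) y))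
         + orbit_sum q t ((jump ^^ Suc m) y)"
        unfolding mq(3) by (subst sum.lessThan_Suc_shift) (simp add: funpow_Suc_right del: funpow.simps)
      finally show ?thesis .
    qed
    moreover have "Suc m \<le> n" using mq(1) n by simp
    moreover have "q \<le> Suc (digit ((jump ^^ Suc m) y))" using mq(2) by (simp add: funpow_Suc_right del: funpow.simps)
    ultimately show ?thesis by blast
  qed
qed

lemma orbit_sum_norm_le:
  assumes short: "\<And>i. i \<le> N \<Longrightarrow> digit ((jump ^^ i) y) < l"
    and fl: "\<And>m. m \<le> N \<Longrightarrow> fluct_norm l m y \<le> a" and "n \<le> N"
  shows "(\<integral>t. \<bar>orbit_sum n t y\<bar> \<partial>leb01) \<le> a + real N * (3 * length_tail l) + real l"
proof -
  obtain m q where mq: "m \<le> n" "q \<le> Suc (digit ((jump ^^ m) y))"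
    "\<And>t. orbit_sum n t y = (\<Sum>i<m. visits t ((jump ^^ i) y) - Fstar t * block_length ((jump ^^ i) y))
       + orbit_sum q t ((jump ^^ m) y)"
    using orbit_sum_blocks[of n y] by blast
  have q: "real q \<le> real l" using mq short[of m] assms(3) by simp
  have pw: "\<bar>orbit_sum n t y\<bar> \<le> \<bar>fluct_sum l m t y\<bar> + real N * (3 * length_tail l) + real l" for t
  proof -
    have "(\<Sum>i<m. visits t ((jump ^^ i) y) - Fstar t * block_length ((jump ^^ i) y))
        = (\<Sum>i<m. fluct l t ((jump ^^ i) y) + drift l t)"
      using short mq(1) assms(3) by (intro sum.cong) (auto simp: fluct_def cut_def)
    also have "\<dots> = fluct_sum l m t y + real m * drift l t" by (simp add: fluct_sum_def sum.distrib)
    finally have "orbit_sum n t y = fluct_sum l m t y + real m * drift l t + orbit_sum q t ((jump ^^ m) y)"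
      by (simp add: mq(3))
    moreover have "\<bar>real m * drift l t\<bar> \<le> real N * (3 * length_tail l)"
      unfolding abs_mult using mq(1) assms(3) drift_bound by (intro mult_mono) auto
    ultimately show ?thesis using orbit_sum_bound[of q t "(jump ^^ m) y"] q by linarith
  qed
  have "(\<integral>t. \<bar>orbit_sum n t y\<bar> \<partial>leb01) \<le> (\<integral>t. \<bar>fluct_sum l m t y\<bar> + real N * (3 * length_tail l) + real l \<partial>leb01)"
  proof (rule integral_mono)
    show "integrable leb01 (\<lambda>t. \<bar>orbit_sum n t y\<bar>)"
      using integrable_leb01_bounded[OF orbit_sum_measurable_t orbit_sum_bound] by simp
  qed (use fluct_sum_integrable_t pw in auto)
  also have "\<dots> = fluct_norm l m y + real N * (3 * length_tail l) + real l"
    unfolding fluct_norm_def using fluct_sum_integrable_t by simp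
  finally show ?thesis using fl[of m] mq(1) assms(3) by simp
qed

text \<open>
  Outside an exceptional set no block up to index \<open>N\<close> is truncated, so orbit sums differ from sums of
  fluctuations only by the drifts of at most \<open>N\<close> blocks and by one incomplete block. Of the bound
  \<open>6 * x\<close>, the maximal inequality takes \<open>4 * x\<close>, the drifts \<open>x\<close> and the incomplete block \<open>x\<close>.
\<close>

theorem orbit_sum_deviation:
  assumes x: "real l + 3 * mean_length \<le> x" and tail: "3 * real N * length_tail l \<le> x"
    and var: "real N * (18 * sq_length l + 1512 * mean_length\<^sup>2) / x\<^sup>2 \<le> 1/6"
  shows "\<exists>B\<in>sets borel.
    measure leb01 B \<le> 2 * (real N * (18 * sq_length l + 1512 * mean_length\<^sup>2) / x\<^sup>2)
      + 3 * real (Suc N) * measure leb01 {y. l \<le> digit y} \<and>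
    (\<forall>y\<in>interior_orbit - B. \<forall>n\<le>N. (\<integral>t. \<bar>orbit_sum n t y\<bar> \<partial>leb01) \<le> 6 * x)"
proof -
  let ?K = "18 * sq_length l + 1512 * mean_length\<^sup>2"
  have x0: "0 < x" using x mean_length_ge_1 by linarith
  have K0: "0 \<le> ?K" unfolding sq_length_def by simp
  have "\<exists>B\<in>sets borel. measure leb01 B \<le> 2 * (real N * ?K / x\<^sup>2) \<and>
      (\<forall>y\<in>interior_orbit - B. \<forall>k\<le>N. fluct_norm l k y \<le> 4 * x)"
  proof (rule maximal_inequality)
    show "fluct_norm l k y' \<le> fluct_norm l k y + x"
      if "y \<in> interior_orbit" "y' \<in> interior_orbit" "same_digits k y y'" for k y y'
      using fluct_norm_oscillation[OF that, of l] x mean_length_ge_1 by linarith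
    show "fluct_norm l k y \<le> fluct_norm l n y + x + fluct_norm l (n - Suc k) ((jump ^^ Suc k) y)"
      if "k < n" for k n y
      using fluct_norm_split[OF that, of l y] x by linarith
    show "measure leb01 {y. x < fluct_norm l m y} \<le> real N * ?K / x\<^sup>2" if "m \<le> N" for m
    proof -
      have "measure leb01 {y. x < fluct_norm l m y} \<le> real m * ?K / x\<^sup>2" by (rule fluct_norm_tail[OF x0])
      also have "\<dots> \<le> real N * ?K / x\<^sup>2" using that K0 by (intro divide_right_mono mult_right_mono) auto
      finally show ?thesis .
    qed
  qed (use var x0 in auto)
  then obtain B where B: "B \<in> sets borel" "measure leb01 B \<le> 2 * (real N * ?K / x\<^sup>2)"
    "\<And>y k. y \<in> interior_orbit - B \<Longrightarrow> k \<le> N \<Longrightarrow> fluct_norm l k y \<le> 4 * x" by blast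
  define E where "E i = {y. l \<le> digit ((jump ^^ i) y)}" for i
  have E [measurable]: "E i \<in> sets borel" for i
  proof -
    have "{y \<in> space borel. l \<le> digit ((jump ^^ i) y)} \<in> sets borel" by measurable
    then show ?thesis by (simp add: E_def)
  qed
  have E_le: "measure leb01 (E i) \<le> 3 * measure leb01 {y. l \<le> digit y}" for i
  proof -
    have m: "{y. l \<le> digit y} \<in> sets borel" using E[of 0] by (simp add: E_def)
    have "(\<integral>y. indicat_real {y. l \<le> digit y} ((jump ^^ i) y) \<partial>leb01) = measure leb01 (E i)"
    proof -
      have "(\<integral>y. indicat_real {y. l \<le> digit y} ((jump ^^ i) y) \<partial>leb01) = (\<integral>y. indicator (E i) y \<partial>leb01)"
        by (intro Bochner_Integration.integral_cong) (auto simp: E_def indicator_def)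
      then show ?thesis by simp
    qed
    moreover have "integrable leb01 (indicator {y. l \<le> digit y} :: real \<Rightarrow> real)"
      using m by (intro integrable_leb01_bounded[of _ 1]) auto
    ultimately show ?thesis using integrable_jump(3)[of "indicator {y. l \<le> digit y}" i] m by simp
  qed
  have "measure leb01 (B \<union> (\<Union>i\<le>N. E i)) \<le> measure leb01 B + measure leb01 (\<Union>i\<le>N. E i)"
    using B(1) by (intro measure_Un_le) auto
  also have "measure leb01 (\<Union>i\<le>N. E i) \<le> (\<Sum>i\<le>N. measure leb01 (E i))"
    by (intro measure_UNION_le) auto
  also have "\<dots> \<le> (\<Sum>i\<le>N. 3 * measure leb01 {y. l \<le> digit y})"
    by (intro sum_mono E_le)
  also have "\<dots> = 3 * real (Suc N) * measure leb01 {y. l \<le> digit y}" by simp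
  finally have "measure leb01 (B \<union> (\<Union>i\<le>N. E i)) \<le> 2 * (real N * ?K / x\<^sup>2)
      + 3 * real (Suc N) * measure leb01 {y. l \<le> digit y}" using B(2) by simp
  moreover have "(\<integral>t. \<bar>orbit_sum n t y\<bar> \<partial>leb01) \<le> 6 * x"
    if y: "y \<in> interior_orbit - (B \<union> (\<Union>i\<le>N. E i))" and n: "n \<le> N" for y n
  proof -
    have "(\<integral>t. \<bar>orbit_sum n t y\<bar> \<partial>leb01) \<le> 4 * x + real N * (3 * length_tail l) + real l"
      using y by (intro orbit_sum_norm_le n B(3)) (auto simp: E_def not_le)
    then show ?thesis using tail x mean_length_ge_1 by (simp add: mult_ac)
  qed
  ultimately show ?thesis using B(1) by (intro bexI[of _ "B \<union> (\<Union>i\<le>N. E i)"]) auto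
qed

end

section \<open>Polynomial tails of the block length\<close>

text \<open>
  Mean value theorem; for either sign of \<open>s\<close> it makes the power sums below telescope.
\<close>

lemma powr_increment_bound:
  fixes a s :: real
  assumes "1 \<le> a" "s < 1" "s \<noteq> 0"
  shows "(a + 1) powr (s - 1) \<le> ((a + 1) powr s - a powr s) / s"
proof -
  have "\<exists>z. a < z \<and> z < a + 1 \<and> (a + 1) powr s - a powr s = (a + 1 - a) * (s * z powr (s - 1))"
    using assms by (intro MVT2[where f = "\<lambda>x. x powr s" and f' = "\<lambda>x. s * x powr (s - 1)"])
      (auto intro!: derivative_eq_intros)
  then obtain z where z: "a < z" "z < a + 1" "(a + 1) powr s - a powr s = s * z powr (s - 1)" by auto
  then have "((a + 1) powr s - a powr s) / s = z powr (s - 1)" using assms by simp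
  moreover have "(a + 1) powr (s - 1) \<le> z powr (s - 1)"
    using z assms by (intro powr_mono2') auto
  ultimately show ?thesis by simp
qed

lemma sum_powr_tail_le:
  assumes "1 < \<alpha>" "1 \<le> l"
  shows "(\<Sum>j<n. real (l + j) powr -\<alpha>) \<le> \<alpha> / (\<alpha> - 1) * real l powr (1 - \<alpha>)"
proof -
  have "(\<Sum>j<Suc n. real (l + j) powr -\<alpha>)
      \<le> real l powr (1 - \<alpha>) + (real l powr (1 - \<alpha>) - real (l + n) powr (1 - \<alpha>)) / (\<alpha> - 1)" for n
  proof (induction n)
    case 0
    show ?case using assms by (auto intro: powr_mono)
  next
    case (Suc n)
    have "real (l + n + 1) powr -\<alpha> \<le> (real (l + n) powr (1 - \<alpha>) - real (l + n + 1) powr (1 - \<alpha>)) / (\<alpha> - 1)"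
    proof -
      have "((real (l + n) + 1) powr (1 - \<alpha>) - real (l + n) powr (1 - \<alpha>)) / (1 - \<alpha>)
          = (real (l + n) powr (1 - \<alpha>) - (real (l + n) + 1) powr (1 - \<alpha>)) / (\<alpha> - 1)"
        using assms by (simp add: field_simps)
      then show ?thesis
        using powr_increment_bound[of "real (l + n)" "1 - \<alpha>"] assms by (simp add: add_ac)
    qed
    moreover have "(\<Sum>j<Suc (Suc n). real (l + j) powr -\<alpha>) = (\<Sum>j<Suc n. real (l + j) powr -\<alpha>) + real (l + n + 1) powr -\<alpha>"
      by (simp add: add_ac)
    ultimately show ?case using Suc by (simp add: diff_divide_distrib add_ac)
  qed
  moreover have "(\<Sum>j<n. real (l + j) powr -\<alpha>) \<le> (\<Sum>j<Suc n. real (l + j) powr -\<alpha>)" by simp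
  moreover have "(real l powr (1 - \<alpha>) - real (l + n) powr (1 - \<alpha>)) / (\<alpha> - 1) \<le> real l powr (1 - \<alpha>) / (\<alpha> - 1)"
    using assms by (intro divide_right_mono) auto
  moreover have "\<alpha> / (\<alpha> - 1) * real l powr (1 - \<alpha>) = real l powr (1 - \<alpha>) + real l powr (1 - \<alpha>) / (\<alpha> - 1)"
    using assms by (simp add: field_simps)
  ultimately show ?thesis by (smt (verit))
qed

lemma sum_powr_head_le:
  assumes "1 < \<alpha>" "\<alpha> < 2"
  shows "(\<Sum>j<n. real (Suc j) powr (1 - \<alpha>)) \<le> real n powr (2 - \<alpha>) / (2 - \<alpha>)"
proof (induction n)
  case (Suc n)
  have "real (Suc n) powr (1 - \<alpha>) \<le> (real (Suc n) powr (2 - \<alpha>) - real n powr (2 - \<alpha>)) / (2 - \<alpha>)"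
  proof (cases "n = 0")
    case True
    then show ?thesis using assms by simp
  next
    case False
    then show ?thesis using powr_increment_bound[of "real n" "2 - \<alpha>"] assms by (simp add: add_ac)
  qed
  with Suc show ?case by (simp add: diff_divide_distrib)
qed simp

lemma sum_inverse_le:
  assumes "1 \<le> n"
  shows "(\<Sum>j<n. 1 / real (Suc j)) \<le> 1 + ln (real n)"
  using assms
proof (induction n rule: dec_induct)
  case (step n)
  have "1 / real (Suc n) \<le> ln (real (Suc n)) - ln (real n)"
  proof -
    have "ln (real n / real (Suc n)) \<le> real n / real (Suc n) - 1"
      using step by (intro ln_le_minus_one) auto
    also have "\<dots> = - (1 / real (Suc n))" by (simp add: field_simps)
    finally show ?thesis using step by (simp add: ln_div)
  qed
  with step show ?case by simp
qed simp

locale polynomial_branch_map = decreasing_branch_map +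
  fixes \<alpha> C :: real
  assumes \<alpha>: "1 < \<alpha>" "\<alpha> \<le> 2" and C_nonneg: "0 \<le> C"
    and V_0_le: "\<And>r. V r 0 \<le> C * real (Suc r) powr -\<alpha>"
begin

lemma digit_ge_sets [measurable]: "{y. l \<le> digit y} \<in> sets borel"
proof -
  have "{y \<in> space borel. l \<le> digit y} \<in> sets borel" by measurable
  then show ?thesis by simp
qed

text \<open>
  A digit of at least \<open>r + 1\<close> means that the point lies in \<open>[0, V r 0)\<close>.
\<close>

lemma measure_digit_ge:
  assumes "1 \<le> l"
  shows "measure leb01 {y. l \<le> digit y} \<le> C * real l powr -\<alpha>"
proof -
  obtain r where r: "l = Suc r" using assms by (cases l) auto
  have "measure leb01 {y. l \<le> digit y} \<le> measure leb01 {0..V r 0}"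
  proof (rule leb01.finite_measure_mono_AE)
    show "AE y in leb01. y \<in> {y. l \<le> digit y} \<longrightarrow> y \<in> {0..V r 0}"
    proof (rule eventually_mono[OF AE_leb01_open], rule impI)
      fix y :: real assume y: "y \<in> {0<..<1}" and "y \<in> {y. l \<le> digit y}"
      then have "\<not> V r 0 \<le> y"
        using Least_le[of "\<lambda>r. V r 0 \<le> y" r] by (auto simp: digit_def r)
      then show "y \<in> {0..V r 0}" using y by auto
    qed
  qed simp
  also have "\<dots> \<le> measure lborel {0..V r 0}"
    using V_0_pos[of r] by (simp add: measure_def emeasure_leb01)
  also have "\<dots> = V r 0" using V_0_pos[of r] by simp
  also have "\<dots> \<le> C * real l powr -\<alpha>" using V_0_le[of r] by (simp add: r)
  finally show ?thesis .
qed

text \<open>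
  For a block of length \<open>L > l\<close>, write \<open>L\<close> as \<open>l\<close> plus the number of \<open>j \<ge> 0\<close> with \<open>digit y \<ge> l + j\<close>.
\<close>

lemma block_tail_nn:
  assumes "1 \<le> l"
  shows "(\<integral>\<^sup>+y. ennreal (block_length y - cut l block_length y) \<partial>leb01)
    \<le> ennreal (C * (1 + \<alpha> / (\<alpha> - 1)) * real l powr (1 - \<alpha>))"
proof -
  have pw: "ennreal (block_length y - cut l block_length y)
      = ennreal (real l) * indicator {y. l \<le> digit y} y + (\<Sum>j. indicator {y. l + j \<le> digit y} y)" for y
  proof (cases "l \<le> digit y")
    case True
    have "(\<Sum>j. indicator {y. l + j \<le> digit y} y :: ennreal) = (\<Sum>j\<le>digit y - l. indicator {y. l + j \<le> digit y} y)"
      by (rule suminf_finite) (auto simp: indicator_def)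
    also have "\<dots> = (\<Sum>j\<le>digit y - l. 1)" using True by (intro sum.cong) (auto simp: indicator_def)
    also have "\<dots> = ennreal (real (Suc (digit y - l)))" by (simp only: sum_constant card_atMost ennreal_of_nat_eq_real_of_nat mult_1_right)
    also have "ennreal (real l) * indicator {y. l \<le> digit y} y + \<dots> = ennreal (real l + real (Suc (digit y - l)))"
      using True by (subst ennreal_plus) auto
    also have "real l + real (Suc (digit y - l)) = block_length y - cut l block_length y"
      using True by (simp add: block_length_def cut_def of_nat_diff)
    finally show ?thesis by simp
  next
    case False
    then have "indicator {y. l + j \<le> digit y} y = (0::ennreal)" for j by (simp add: indicator_def)
    then show ?thesis using False by (simp add: cut_def)
  qed
  have "(\<integral>\<^sup>+y. ennreal (block_length y - cut l block_length y) \<partial>leb01)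
      = ennreal (real l) * emeasure leb01 {y. l \<le> digit y} + (\<Sum>j. emeasure leb01 {y. l + j \<le> digit y})"
  proof -
    have m: "indicator {y. j \<le> digit y} \<in> borel_measurable leb01" for j by simp
    have "(\<integral>\<^sup>+y. ennreal (block_length y - cut l block_length y) \<partial>leb01)
      = (\<integral>\<^sup>+y. ennreal (real l) * indicator {y. l \<le> digit y} y \<partial>leb01)
        + (\<integral>\<^sup>+y. (\<Sum>j. indicator {y. l + j \<le> digit y} y) \<partial>leb01)"
      unfolding pw by (rule nn_integral_add) (auto intro: m borel_measurable_suminf_order)
    also have "(\<integral>\<^sup>+y. (\<Sum>j. indicator {y. l + j \<le> digit y} y) \<partial>leb01) = (\<Sum>j. emeasure leb01 {y. l + j \<le> digit y})"
      by (subst nn_integral_suminf[OF m]) simp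
    finally show ?thesis by (simp add: nn_integral_cmult_indicator)
  qed
  also have "\<dots> \<le> ennreal (real l) * ennreal (C * real l powr -\<alpha>) + (\<Sum>j. ennreal (C * real (l + j) powr -\<alpha>))"
  proof -
    have "emeasure leb01 {y. l + j \<le> digit y} \<le> ennreal (C * real (l + j) powr -\<alpha>)" for j
      using measure_digit_ge[of "l + j"] assms
      by (simp add: leb01.emeasure_eq_measure ennreal_leI del: of_nat_add)
    from this this[of 0] show ?thesis by (intro add_mono mult_left_mono suminf_le) auto
  qed
  also have "ennreal (real l) * ennreal (C * real l powr -\<alpha>) = ennreal (C * real l powr (1 - \<alpha>))"
    using assms C_nonneg by (simp add: powr_diff powr_minus field_simps flip: ennreal_mult)
  also have "(\<Sum>j. ennreal (C * real (l + j) powr -\<alpha>)) \<le> ennreal (C * (\<alpha> / (\<alpha> - 1) * real l powr (1 - \<alpha>)))"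
  proof (rule suminf_le_const)
    fix n
    have "(\<Sum>j<n. ennreal (C * real (l + j) powr -\<alpha>)) = ennreal (\<Sum>j<n. C * real (l + j) powr -\<alpha>)"
      using C_nonneg by (intro sum_ennreal) auto
    also have "\<dots> \<le> ennreal (C * (\<alpha> / (\<alpha> - 1) * real l powr (1 - \<alpha>)))"
      unfolding sum_distrib_left[symmetric]
      by (intro ennreal_leI mult_left_mono sum_powr_tail_le \<alpha> assms C_nonneg)
    finally show "(\<Sum>j<n. ennreal (C * real (l + j) powr -\<alpha>)) \<le> ennreal (C * (\<alpha> / (\<alpha> - 1) * real l powr (1 - \<alpha>)))" .
  qed auto
  also have "ennreal (C * real l powr (1 - \<alpha>)) + \<dots> = ennreal (C * (1 + \<alpha> / (\<alpha> - 1)) * real l powr (1 - \<alpha>))"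
    using C_nonneg \<alpha> by (subst ennreal_plus[symmetric]) (auto simp: algebra_simps)
  finally show ?thesis by (simp add: add_left_mono)
qed

end

sublocale polynomial_branch_map \<subseteq> integrable_branch_map
proof
  have "integrable leb01 (\<lambda>y. (block_length y - cut 1 block_length y) + cut 1 block_length y)"
  proof (rule Bochner_Integration.integrable_add)
    show "integrable leb01 (\<lambda>y. block_length y - cut 1 block_length y)"
    proof (rule integrableI_nonneg)
      show "AE y in leb01. 0 \<le> block_length y - cut 1 block_length y"
        by (auto simp: cut_def block_length_def)
      show "(\<integral>\<^sup>+y. ennreal (block_length y - cut 1 block_length y) \<partial>leb01) < \<infinity>"
        using le_less_trans[OF block_tail_nn[of 1]] by simp
    qed measurable
    show "integrable leb01 (cut 1 block_length)"
      by (rule integrable_leb01_bounded[of _ 1]) (auto simp: cut_def block_length_def)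
  qed
  then show "integrable leb01 block_length" by simp
qed

context polynomial_branch_map
begin

lemma length_tail_le_powr:
  assumes "1 \<le> l"
  shows "length_tail l \<le> C * (1 + \<alpha> / (\<alpha> - 1)) * real l powr (1 - \<alpha>)"
proof -
  have "ennreal (length_tail l) = (\<integral>\<^sup>+y. ennreal (block_length y - cut l block_length y) \<partial>leb01)"
    unfolding length_tail_def
    by (rule nn_integral_eq_integral[symmetric, OF length_tail_integrable]) (auto simp: cut_def block_length_def)
  also note block_tail_nn[OF assms]
  finally show ?thesis
    using C_nonneg \<alpha> by (subst (asm) ennreal_le_iff) auto
qed

text \<open>
  The square of \<open>n\<close> is the sum of the first \<open>n\<close> odd numbers, so the second moment is a
  weighted sum of the tail probabilities.
\<close>

lemma sq_length_le:
  assumes "1 \<le> l"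
  shows "sq_length l \<le> 1 + 3 * C * (\<Sum>j<l. real (Suc j) powr (1 - \<alpha>))"
proof -
  have odd: "(\<Sum>j<n. real (2 * j + 1)) = (real n)\<^sup>2" for n
    by (induction n) (auto simp: power2_eq_square algebra_simps)
  have "sq_length l \<le> (\<integral>y. (\<Sum>j<l. real (2 * j + 1) * indicator {y. j \<le> digit y} y) \<partial>leb01)"
    unfolding sq_length_def
  proof (rule integral_mono)
    show "integrable leb01 (\<lambda>y. (cut l block_length y)\<^sup>2)"
    proof (rule integrable_leb01_bounded)
      fix y show "\<bar>(cut l block_length y)\<^sup>2\<bar> \<le> (real l)\<^sup>2"
        using power_mono[OF cut_block_length_le(1)[of l y] cut_block_length_le(2), of 2] by simp
    qed measurable
    show "integrable leb01 (\<lambda>y. \<Sum>j<l. real (2 * j + 1) * indicator {y. j \<le> digit y} y)"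
      by (intro Bochner_Integration.integrable_sum integrable_mult_right integrable_leb01_bounded[of _ 1]) auto
    fix y
    show "(cut l block_length y)\<^sup>2 \<le> (\<Sum>j<l. real (2 * j + 1) * indicator {y. j \<le> digit y} y)"
    proof (cases "digit y < l")
      case True
      then have "(cut l block_length y)\<^sup>2 = (\<Sum>j<Suc (digit y). real (2 * j + 1) * indicator {y. j \<le> digit y} y)"
        unfolding cut_def block_length_def by (simp add: odd[symmetric] indicator_def del: of_nat_Suc)
      also have "\<dots> \<le> (\<Sum>j<l. real (2 * j + 1) * indicator {y. j \<le> digit y} y)"
        using True by (intro sum_mono2) auto
      finally show ?thesis .
    qed (auto simp: cut_def intro!: sum_nonneg)
  qed
  also have "\<dots> = (\<Sum>j<l. real (2 * j + 1) * measure leb01 {y. j \<le> digit y})"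
    by (subst Bochner_Integration.integral_sum) (auto intro!: integrable_mult_right integrable_leb01_bounded[of _ 1])
  also have "\<dots> = measure leb01 {y. 0 \<le> digit y} + (\<Sum>j<l - 1. real (2 * Suc j + 1) * measure leb01 {y. Suc j \<le> digit y})"
    using assms by (cases l) (auto simp only: sum.lessThan_Suc_shift, auto)
  also have "\<dots> \<le> 1 + (\<Sum>j<l - 1. 3 * C * real (Suc j) powr (1 - \<alpha>))"
  proof (intro add_mono sum_mono leb01.prob_le_1)
    fix j
    have "real (2 * Suc j + 1) * measure leb01 {y. Suc j \<le> digit y} \<le> (3 * real (Suc j)) * (C * real (Suc j) powr -\<alpha>)"
      using C_nonneg by (intro mult_mono measure_digit_ge) auto
    also have "\<dots> = 3 * C * real (Suc j) powr (1 - \<alpha>)"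
      by (simp add: powr_diff powr_minus field_simps del: of_nat_Suc)
    finally show "real (2 * Suc j + 1) * measure leb01 {y. Suc j \<le> digit y} \<le> 3 * C * real (Suc j) powr (1 - \<alpha>)" .
  qed
  also have "(\<Sum>j<l - 1. 3 * C * real (Suc j) powr (1 - \<alpha>)) \<le> (\<Sum>j<l. 3 * C * real (Suc j) powr (1 - \<alpha>))"
    using C_nonneg by (intro sum_mono2) auto
  finally show ?thesis by (simp add: sum_distrib_left)
qed

text \<open>
  Up to constants, \<open>N * rate x\<close> bounds the probability that an orbit sum of length at most \<open>N\<close> has norm
  larger than \<open>x\<close>; the logarithm stems from the truncated second moment, which diverges logarithmically at \<open>\<alpha> = 2\<close>.
\<close>

definition rate :: "real \<Rightarrow> real" where
  "rate x = (if \<alpha> = 2 then ln x else 1) * x powr -\<alpha>"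

lemma log_factor_ge_1: "3 \<le> (x :: real) \<Longrightarrow> 1 \<le> (if \<alpha> = 2 then ln x else 1)"
  using exp_le by (auto simp: ln_ge_iff)

text \<open>
  With truncation at half the level, the tail probability, the mean cut away and the truncated
  second moment are all of the order \<open>rate x\<close> after scaling by the appropriate power of \<open>x\<close>.
\<close>

lemma moment_bounds:
  "\<exists>K>0. \<forall>x\<ge>3. measure leb01 {y. nat \<lfloor>x / 2\<rfloor> \<le> digit y} \<le> K * rate x \<and>
    length_tail (nat \<lfloor>x / 2\<rfloor>) \<le> K * x * rate x \<and>
    (18 * sq_length (nat \<lfloor>x / 2\<rfloor>) + 1512 * mean_length\<^sup>2) / x\<^sup>2 \<le> K * rate x"
proof -
  define S where "S = (if \<alpha> = 2 then 2 else 1 / (2 - \<alpha>))"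
  define K1 where "K1 = C * 6 powr \<alpha>"
  define K2 where "K2 = C * (1 + \<alpha> / (\<alpha> - 1)) * 6 powr (\<alpha> - 1)"
  define K3 where "K3 = 18 * (1 + 3 * C * S) + 1512 * mean_length\<^sup>2"
  have S: "0 \<le> S" using \<alpha> by (auto simp: S_def)
  have K: "0 \<le> K1" "0 \<le> K2" "0 < K3"
    using C_nonneg \<alpha> S by (auto simp: K1_def K2_def K3_def intro!: add_pos_nonneg mult_nonneg_nonneg add_nonneg_nonneg)
  have main: "measure leb01 {y. nat \<lfloor>x / 2\<rfloor> \<le> digit y} \<le> K1 * rate x"
    "length_tail (nat \<lfloor>x / 2\<rfloor>) \<le> K2 * x * rate x"
    "(18 * sq_length (nat \<lfloor>x / 2\<rfloor>) + 1512 * mean_length\<^sup>2) / x\<^sup>2 \<le> K3 * rate x" if x: "3 \<le> x" for x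
  proof -
    define l where "l = nat \<lfloor>x / 2\<rfloor>"
    define L where "L = (if \<alpha> = 2 then ln x else 1)"
    have L: "1 \<le> L" using log_factor_ge_1[OF x] by (simp add: L_def)
    have rate: "rate x = L * x powr -\<alpha>" by (simp add: rate_def L_def)
    have "1 \<le> \<lfloor>x / 2\<rfloor>" using x by linarith
    then have rl: "real l = of_int \<lfloor>x / 2\<rfloor>" by (simp add: l_def)
    have l: "1 \<le> l" "real l \<le> x" "x / 6 \<le> real l"
      using x \<open>1 \<le> \<lfloor>x / 2\<rfloor>\<close> unfolding rl by (auto simp: l_def) linarith+
    have "measure leb01 {y. l \<le> digit y} \<le> C * real l powr -\<alpha>" by (rule measure_digit_ge[OF l(1)])
    also have "\<dots> \<le> C * (x / 6) powr -\<alpha>"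
      using l x \<alpha> C_nonneg by (intro mult_left_mono powr_mono2') auto
    also have "\<dots> = K1 * x powr -\<alpha>" using x by (simp add: K1_def powr_divide powr_minus field_simps)
    also have "\<dots> \<le> K1 * rate x" unfolding rate using K L by (intro mult_left_mono) (auto simp: mult_le_cancel_right1)
    finally show "measure leb01 {y. nat \<lfloor>x / 2\<rfloor> \<le> digit y} \<le> K1 * rate x" by (simp add: l_def)
    have "length_tail l \<le> C * (1 + \<alpha> / (\<alpha> - 1)) * real l powr (1 - \<alpha>)" by (rule length_tail_le_powr[OF l(1)])
    also have "\<dots> \<le> C * (1 + \<alpha> / (\<alpha> - 1)) * (x / 6) powr (1 - \<alpha>)"
      using l x \<alpha> C_nonneg by (intro mult_left_mono powr_mono2') auto
    also have "(x / 6) powr (1 - \<alpha>) = 6 powr (\<alpha> - 1) * (x * x powr -\<alpha>)"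
      using x by (simp add: powr_divide powr_diff powr_minus field_simps)
    also have "C * (1 + \<alpha> / (\<alpha> - 1)) * \<dots> = K2 * x * x powr -\<alpha>" by (simp add: K2_def)
    also have "\<dots> \<le> K2 * x * rate x"
      unfolding rate using K L x by (intro mult_left_mono) (auto simp: mult_le_cancel_right1)
    finally show "length_tail (nat \<lfloor>x / 2\<rfloor>) \<le> K2 * x * rate x" by (simp add: l_def)
    have "(\<Sum>j<l. real (Suc j) powr (1 - \<alpha>)) \<le> S * (L * x powr (2 - \<alpha>))"
    proof (cases "\<alpha> = 2")
      case True
      have "(\<Sum>j<l. real (Suc j) powr (1 - \<alpha>)) = (\<Sum>j<l. 1 / real (Suc j))"
        using True by (intro sum.cong) (auto simp: powr_minus field_simps)
      also have "\<dots> \<le> 1 + ln (real l)" by (rule sum_inverse_le[OF l(1)])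
      also have "\<dots> \<le> L + ln x" using L l x by (intro add_mono) auto
      finally show ?thesis using True x by (simp add: S_def L_def)
    next
      case False
      then have "\<alpha> < 2" using \<alpha> by simp
      have "(\<Sum>j<l. real (Suc j) powr (1 - \<alpha>)) \<le> real l powr (2 - \<alpha>) / (2 - \<alpha>)"
        by (rule sum_powr_head_le[OF \<alpha>(1) \<open>\<alpha> < 2\<close>])
      also have "\<dots> \<le> x powr (2 - \<alpha>) / (2 - \<alpha>)"
        using l \<open>\<alpha> < 2\<close> by (intro divide_right_mono powr_mono2) auto
      finally show ?thesis using False by (simp add: S_def L_def)
    qed
    then have "sq_length l \<le> 1 + 3 * C * (S * (L * x powr (2 - \<alpha>)))"
      using sq_length_le[OF l(1)] C_nonneg by (smt (verit) mult_left_mono)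
    moreover have one: "1 \<le> L * x powr (2 - \<alpha>)"
    proof -
      have "1 * 1 \<le> L * x powr (2 - \<alpha>)" using L x \<alpha> by (intro mult_mono) (auto intro: ge_one_powr_ge_zero)
      then show ?thesis by simp
    qed
    ultimately have "18 * sq_length l + 1512 * mean_length\<^sup>2
        \<le> 18 * (L * x powr (2 - \<alpha>) + 3 * C * (S * (L * x powr (2 - \<alpha>)))) + 1512 * mean_length\<^sup>2 * (L * x powr (2 - \<alpha>))"
      using mult_left_mono[OF one, of "1512 * mean_length\<^sup>2"] by auto
    also have "\<dots> = K3 * (L * x powr (2 - \<alpha>))" by (simp add: K3_def algebra_simps)
    finally have "(18 * sq_length l + 1512 * mean_length\<^sup>2) / x\<^sup>2 \<le> K3 * (L * x powr (2 - \<alpha>)) / x\<^sup>2"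
      by (intro divide_right_mono) auto
    also have "\<dots> = K3 * rate x"
      using x by (simp add: rate powr_diff powr_minus field_simps powr_numeral)
    finally show "(18 * sq_length (nat \<lfloor>x / 2\<rfloor>) + 1512 * mean_length\<^sup>2) / x\<^sup>2 \<le> K3 * rate x" by (simp add: l_def)
  qed
  have rate_nn: "0 \<le> rate x" if "3 \<le> x" for x
    using log_factor_ge_1[OF that] by (simp add: rate_def)
  define K where "K = K1 + K2 + K3"
  have "K1 * rate x \<le> K * rate x" "K2 * x * rate x \<le> K * x * rate x" "K3 * rate x \<le> K * rate x" if "3 \<le> x" for x
    using K rate_nn[OF that] that by (auto simp: K_def intro!: mult_right_mono)
  moreover have "0 < K" using K by (simp add: K_def)
  ultimately show ?thesis using main by (intro exI[of _ K]) (meson order_trans)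
qed

end

section \<open>Almost sure bounds along dyadic times\<close>

lemma filterlim_2_power: "filterlim (\<lambda>p. 2 ^ p :: real) at_top sequentially"
proof (rule filterlim_at_top_mono[OF filterlim_real_sequentially])
  have "real p \<le> 2 ^ p" for p
    by (metis less_exp less_imp_le of_nat_le_iff of_nat_numeral of_nat_power)
  then show "\<forall>\<^sub>F p in sequentially. real p \<le> 2 ^ p" by simp
qed

lemma eventually_ln_le_sqrt: "\<forall>\<^sub>F x in at_top. ln x \<le> x powr (1/2 :: real)"
proof (rule eventually_mono[OF eventually_ge_at_top[of 256]])
  fix x :: real assume x: "256 \<le> x"
  have "ln x \<le> x powr (1/4) / (1/4)" using x by (intro ln_powr_bound) auto
  also have "\<dots> = (256 :: real) powr (1/4) * x powr (1/4)"
    using powr_powr[of 4 4 "1/4 :: real"] by simp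
  also have "\<dots> \<le> x powr (1/4) * x powr (1/4)"
    using x by (intro mult_right_mono powr_mono2) auto
  also have "\<dots> = x powr (1/2)" by (simp flip: powr_add)
  finally show "ln x \<le> x powr (1/2)" .
qed

context polynomial_branch_map
begin

text \<open>
  Borel-Cantelli. Summability also makes the bounds small, which yields the smallness conditions of
  \<open>orbit_sum_deviation\<close> for all large \<open>p\<close>.
\<close>

theorem orbit_sum_eventually_le:
  fixes x :: "nat \<Rightarrow> real"
  assumes x: "filterlim x at_top sequentially" and sm: "summable (\<lambda>p. 2 ^ p * rate (x p))"
  shows "AE y in leb01. \<forall>\<^sub>F p in sequentially. \<forall>n\<le>2 ^ Suc p. (\<integral>t. \<bar>orbit_sum n t y\<bar> \<partial>leb01) \<le> 6 * x p"
proof -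
  obtain K where K: "0 < K"
    "\<And>x. 3 \<le> x \<Longrightarrow> measure leb01 {y. nat \<lfloor>x / 2\<rfloor> \<le> digit y} \<le> K * rate x"
    "\<And>x. 3 \<le> x \<Longrightarrow> length_tail (nat \<lfloor>x / 2\<rfloor>) \<le> K * x * rate x"
    "\<And>x. 3 \<le> x \<Longrightarrow> (18 * sq_length (nat \<lfloor>x / 2\<rfloor>) + 1512 * mean_length\<^sup>2) / x\<^sup>2 \<le> K * rate x"
    using moment_bounds by blast
  define \<theta> where "\<theta> p = K * (2 ^ p * rate (x p))" for p
  have \<theta>_sm: "summable \<theta>" unfolding \<theta>_def using sm by (rule summable_mult)
  have "\<forall>\<^sub>F p in sequentially. \<theta> p < 1/12"
    using summable_LIMSEQ_zero[OF \<theta>_sm] by (rule order_tendstoD(2)) simp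
  moreover have "\<forall>\<^sub>F p in sequentially. max 3 (6 * mean_length) \<le> x p"
    using x unfolding filterlim_at_top by blast
  ultimately have "\<forall>\<^sub>F p in sequentially. \<theta> p < 1/12 \<and> max 3 (6 * mean_length) \<le> x p"
    by (rule eventually_conj)
  then obtain P where P: "\<And>p. P \<le> p \<Longrightarrow> \<theta> p < 1/12" "\<And>p. P \<le> p \<Longrightarrow> 3 \<le> x p"
    "\<And>p. P \<le> p \<Longrightarrow> 6 * mean_length \<le> x p"
    by (auto simp: eventually_sequentially)
  have "\<exists>B\<in>sets borel. (P \<le> p \<longrightarrow> measure leb01 B \<le> 13 * \<theta> p \<and>
      (\<forall>y\<in>interior_orbit - B. \<forall>n\<le>2 ^ Suc p. (\<integral>t. \<bar>orbit_sum n t y\<bar> \<partial>leb01) \<le> 6 * x p)) \<and> (p < P \<longrightarrow> B = {})" for p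
  proof (cases "P \<le> p")
    case True
    let ?l = "nat \<lfloor>x p / 2\<rfloor>" and ?N = "2 ^ Suc p :: nat"
    have x3: "3 \<le> x p" using P(2)[OF True] .
    have "real ?l \<le> x p / 2" using x3 by (simp only: of_nat_nat zero_le_floor) linarith
    then have c1: "real ?l + 3 * mean_length \<le> x p" using P(3)[OF True] by linarith
    have "3 * real ?N * length_tail ?l \<le> 3 * real ?N * (K * x p * rate (x p))"
      using K(3)[OF x3] by (intro mult_left_mono) auto
    also have "\<dots> = 6 * \<theta> p * x p" by (simp add: \<theta>_def)
    also have "\<dots> \<le> 1 * x p" using P(1)[OF True] x3 by (intro mult_right_mono) auto
    finally have c2: "3 * real ?N * length_tail ?l \<le> x p" by simp
    have "real ?N * ((18 * sq_length ?l + 1512 * mean_length\<^sup>2) / (x p)\<^sup>2) \<le> real ?N * (K * rate (x p))"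
      using K(4)[OF x3] by (intro mult_left_mono) auto
    moreover have "real ?N * (K * rate (x p)) = 2 * \<theta> p" by (simp add: \<theta>_def)
    ultimately have v: "real ?N * (18 * sq_length ?l + 1512 * mean_length\<^sup>2) / (x p)\<^sup>2 \<le> 2 * \<theta> p"
      by (simp only: times_divide_eq_right)
    then have c3: "real ?N * (18 * sq_length ?l + 1512 * mean_length\<^sup>2) / (x p)\<^sup>2 \<le> 1/6"
      using P(1)[OF True] by linarith
    obtain B where B: "B \<in> sets borel"
      "measure leb01 B \<le> 2 * (real ?N * (18 * sq_length ?l + 1512 * mean_length\<^sup>2) / (x p)\<^sup>2)
        + 3 * real (Suc ?N) * measure leb01 {y. ?l \<le> digit y}"
      "\<forall>y\<in>interior_orbit - B. \<forall>n\<le>?N. (\<integral>t. \<bar>orbit_sum n t y\<bar> \<partial>leb01) \<le> 6 * x p"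
      using orbit_sum_deviation[OF c1 c2 c3] by blast
    \<comment> \<open>\<open>3 * (2 * 2^p + 1) \<le> 9 * 2^p\<close>, which together with the variance term \<open>4 * \<theta> p\<close> gives \<open>13 * \<theta> p\<close>\<close>
    have "3 * real (Suc ?N) * measure leb01 {y. ?l \<le> digit y} \<le> (9 * 2 ^ p) * (K * rate (x p))"
    proof (rule mult_mono[OF _ K(2)[OF x3]])
      have "(1::real) \<le> 2 ^ p" by simp
      then show "3 * real (Suc ?N) \<le> 9 * 2 ^ p" by simp
    qed auto
    moreover have "(9 * 2 ^ p) * (K * rate (x p)) = 9 * \<theta> p" by (simp add: \<theta>_def)
    ultimately have "measure leb01 B \<le> 13 * \<theta> p" using B(2) v by linarith
    with B True show ?thesis by (intro bexI[of _ B]) auto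
  qed (intro bexI[of _ "{}"], auto)
  then obtain B where B: "\<And>p. B p \<in> sets borel" "\<And>p. P \<le> p \<Longrightarrow> measure leb01 (B p) \<le> 13 * \<theta> p"
    "\<And>p y n. P \<le> p \<Longrightarrow> y \<in> interior_orbit - B p \<Longrightarrow> n \<le> 2 ^ Suc p \<Longrightarrow> (\<integral>t. \<bar>orbit_sum n t y\<bar> \<partial>leb01) \<le> 6 * x p"
    by metis
  have "summable (\<lambda>p. measure leb01 (B p))"
    by (rule summable_comparison_test'[where N = P, OF summable_mult[OF \<theta>_sm, of 13]]) (use B(2) in auto)
  then have "AE y in leb01. \<forall>\<^sub>F p in sequentially. y \<in> space leb01 - B p"
    by (intro borel_cantelli_AE1) (auto simp: B(1) leb01.emeasure_eq_measure)
  with AE_interior_orbit show ?thesis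
  proof eventually_elim
    case (elim y)
    from elim(2) eventually_ge_at_top[of P] show ?case
      by eventually_elim (use elim(1) B(3) in auto)
  qed
qed

text \<open>
  A time \<open>n\<close> with \<open>2^p \<le> n < 2^(p+1)\<close> is covered by the bound at level \<open>\<epsilon> * b (2^p) \<le> \<epsilon> * b n\<close>;
  countably many \<open>\<epsilon>\<close> suffice.
\<close>

theorem orbit_sum_negligible:
  fixes b :: "nat \<Rightarrow> real"
  assumes b_mono: "\<And>m n. 1 \<le> m \<Longrightarrow> m \<le> n \<Longrightarrow> b m \<le> b n"
    and b_lim: "filterlim (\<lambda>p. b (2 ^ p)) at_top sequentially"
    and sm: "\<And>\<epsilon>. 0 < \<epsilon> \<Longrightarrow> summable (\<lambda>p. 2 ^ p * rate (\<epsilon> * b (2 ^ p)))"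
  shows "AE y in leb01. (\<lambda>n. (\<integral>t. \<bar>orbit_sum n t y\<bar> \<partial>leb01) / b n) \<longlonglongrightarrow> 0"
proof -
  define \<epsilon> where "\<epsilon> k = 1 / real (Suc k)" for k
  have "AE y in leb01. \<forall>\<^sub>F p in sequentially. \<forall>n\<le>2 ^ Suc p.
      (\<integral>t. \<bar>orbit_sum n t y\<bar> \<partial>leb01) \<le> 6 * (\<epsilon> k * b (2 ^ p))" for k
  proof (rule orbit_sum_eventually_le)
    show "filterlim (\<lambda>p. \<epsilon> k * b (2 ^ p)) at_top sequentially"
      by (rule filterlim_tendsto_pos_mult_at_top[OF tendsto_const _ b_lim]) (simp add: \<epsilon>_def)
    show "summable (\<lambda>p. 2 ^ p * rate (\<epsilon> k * b (2 ^ p)))"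
      by (rule sm) (simp add: \<epsilon>_def)
  qed
  then have "AE y in leb01. \<forall>k. \<forall>\<^sub>F p in sequentially. \<forall>n\<le>2 ^ Suc p.
      (\<integral>t. \<bar>orbit_sum n t y\<bar> \<partial>leb01) \<le> 6 * (\<epsilon> k * b (2 ^ p))"
    by (simp add: AE_all_countable)
  then show ?thesis
  proof eventually_elim
    case (elim y)
    have b_pos: "\<forall>\<^sub>F p in sequentially. 0 < b (2 ^ p)"
      using b_lim by (simp add: filterlim_at_top_dense)
    show ?case
    proof (rule tendstoI)
      fix e :: real assume "0 < e"
      obtain k where k: "6 * \<epsilon> k < e"
      proof -
        obtain k where "6 / e < real k" using reals_Archimedean2 by blast
        then have "6 / real (Suc k) < e" using \<open>0 < e\<close> by (simp add: field_simps)
        then show thesis using that[of k] by (simp add: \<epsilon>_def)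
      qed
      from elim[rule_format, of k] b_pos
      have "\<forall>\<^sub>F p in sequentially. 0 < b (2 ^ p) \<and> (\<forall>n\<le>2 ^ Suc p.
        (\<integral>t. \<bar>orbit_sum n t y\<bar> \<partial>leb01) \<le> 6 * (\<epsilon> k * b (2 ^ p)))"
        by eventually_elim auto
      then obtain P where P: "\<And>p. P \<le> p \<Longrightarrow> 0 < b (2 ^ p)"
        "\<And>p n. P \<le> p \<Longrightarrow> n \<le> 2 ^ Suc p \<Longrightarrow> (\<integral>t. \<bar>orbit_sum n t y\<bar> \<partial>leb01) \<le> 6 * (\<epsilon> k * b (2 ^ p))"
        by (auto simp: eventually_sequentially)
      show "\<forall>\<^sub>F n in sequentially. dist ((\<integral>t. \<bar>orbit_sum n t y\<bar> \<partial>leb01) / b n) 0 < e"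
      proof (rule eventually_mono[OF eventually_ge_at_top[of "2 ^ P"]])
        fix n :: nat assume n: "2 ^ P \<le> n"
        obtain p where p: "2 ^ p \<le> n" "n < 2 ^ Suc p"
          using ex_power_ivl1[of 2 n] n by (metis Suc_eq_plus1 le_refl less_le_trans not_less_eq_eq one_le_numeral one_le_power order_trans)
        then have "P < Suc p" using n power_less_imp_less_exp[of "2::nat" P "Suc p"] by linarith
        then have "P \<le> p" by simp
        have bn: "b (2 ^ p) \<le> b n" using p by (intro b_mono) auto
        have b0: "0 < b n" using P(1)[OF \<open>P \<le> p\<close>] bn by linarith
        have "(\<integral>t. \<bar>orbit_sum n t y\<bar> \<partial>leb01) \<le> 6 * (\<epsilon> k * b (2 ^ p))"
          using P(2)[OF \<open>P \<le> p\<close>, of n] p by simp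
        also have "\<dots> \<le> 6 * (\<epsilon> k * b n)" using bn by (simp add: \<epsilon>_def divide_right_mono)
        also have "\<dots> < e * b n" using mult_strict_right_mono[OF k b0] by simp
        finally have "(\<integral>t. \<bar>orbit_sum n t y\<bar> \<partial>leb01) / b n < e" using b0 by (simp add: field_simps)
        moreover have "0 \<le> (\<integral>t. \<bar>orbit_sum n t y\<bar> \<partial>leb01) / b n" using b0 by simp
        ultimately show "dist ((\<integral>t. \<bar>orbit_sum n t y\<bar> \<partial>leb01) / b n) 0 < e" by simp
      qed
    qed
  qed
qed

lemma orbit_law_of_large_numbers:
  "AE y in leb01. (\<lambda>n. (\<integral>t. \<bar>orbit_sum n t y\<bar> \<partial>leb01) / real n) \<longlonglongrightarrow> 0"
proof (rule orbit_sum_negligible)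
  show "filterlim (\<lambda>p. real (2 ^ p)) at_top sequentially"
    by (simp add: filterlim_2_power)
  fix \<epsilon> :: real assume \<epsilon>: "0 < \<epsilon>"
  \<comment> \<open>half of the margin \<open>\<alpha> - 1\<close> absorbs the logarithm, the other half makes the series geometric\<close>
  define \<beta> where "\<beta> = (\<alpha> - 1) / 2"
  have \<beta>: "0 < \<beta>" using \<alpha> by (simp add: \<beta>_def)
  have "\<forall>\<^sub>F x in at_top. (if \<alpha> = 2 then ln x else 1) \<le> x powr \<beta>"
  proof (cases "\<alpha> = 2")
    case True
    then have "\<beta> = 1/2" by (simp add: \<beta>_def)
    then show ?thesis using True eventually_ln_le_sqrt by (simp only: if_True simp_thms)
  next
    case False
    show ?thesis
      using eventually_ge_at_top[of 1] by eventually_elim (use False \<beta> in \<open>auto intro: ge_one_powr_ge_zero\<close>)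
  qed
  moreover have "filterlim (\<lambda>p. \<epsilon> * 2 ^ p) at_top sequentially"
    by (rule filterlim_tendsto_pos_mult_at_top[OF tendsto_const \<epsilon>]) (simp add: filterlim_2_power)
  ultimately have "\<forall>\<^sub>F p in sequentially. (if \<alpha> = 2 then ln (\<epsilon> * 2 ^ p) else 1) \<le> (\<epsilon> * 2 ^ p) powr \<beta>"
    by (rule eventually_compose_filterlim)
  moreover have "\<forall>\<^sub>F p in sequentially. 3 \<le> \<epsilon> * 2 ^ p"
    using \<open>filterlim (\<lambda>p. \<epsilon> * 2 ^ p) at_top sequentially\<close> by (simp add: filterlim_at_top)
  ultimately have ev: "\<forall>\<^sub>F p in sequentially. norm (2 ^ p * rate (\<epsilon> * 2 ^ p)) \<le> \<epsilon> powr (\<beta> - \<alpha>) * (2 powr -\<beta>) ^ p"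
  proof eventually_elim
    case (elim p)
    have x0: "0 < \<epsilon> * 2 ^ p" using \<epsilon> by simp
    have "rate (\<epsilon> * 2 ^ p) \<le> (\<epsilon> * 2 ^ p) powr \<beta> * (\<epsilon> * 2 ^ p) powr -\<alpha>"
      unfolding rate_def using elim(1) by (intro mult_right_mono) auto
    also have "\<dots> = (\<epsilon> * 2 ^ p) powr (\<beta> - \<alpha>)" using x0 by (simp add: powr_add[symmetric])
    also have "\<dots> = \<epsilon> powr (\<beta> - \<alpha>) * 2 powr (real p * (\<beta> - \<alpha>))"
      using \<epsilon> by (simp add: powr_mult powr_powr flip: powr_realpow)
    finally have "2 ^ p * rate (\<epsilon> * 2 ^ p) \<le> 2 powr real p * (\<epsilon> powr (\<beta> - \<alpha>) * 2 powr (real p * (\<beta> - \<alpha>)))"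
      by (simp add: powr_realpow)
    also have "\<dots> = \<epsilon> powr (\<beta> - \<alpha>) * 2 powr (real p + real p * (\<beta> - \<alpha>))"
      by (simp add: powr_add)
    also have "real p + real p * (\<beta> - \<alpha>) = real p * -\<beta>" by (simp add: \<beta>_def field_simps)
    also have "2 powr (real p * -\<beta>) = (2 powr -\<beta>) ^ p" by (simp add: powr_powr mult.commute flip: powr_realpow)
    finally have "2 ^ p * rate (\<epsilon> * 2 ^ p) \<le> \<epsilon> powr (\<beta> - \<alpha>) * (2 powr -\<beta>) ^ p" .
    moreover have "0 \<le> rate (\<epsilon> * 2 ^ p)" using log_factor_ge_1[OF elim(2)] by (simp add: rate_def)
    ultimately show ?case by simp
  qed
  have "2 powr -\<beta> < 1" using powr_less_mono[of "-\<beta>" 0 2] \<beta> by simp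
  then have "summable (\<lambda>p. \<epsilon> powr (\<beta> - \<alpha>) * (2 powr -\<beta>) ^ p)"
    by (intro summable_mult summable_geometric) simp
  from summable_comparison_test_ev[OF ev this]
  show "summable (\<lambda>p. 2 ^ p * rate (\<epsilon> * real (2 ^ p)))" by simp
qed auto

end

section \<open>The inverse branches of the intermittent map\<close>

definition left_branch :: "real \<Rightarrow> real \<Rightarrow> real" where
  "left_branch \<gamma> x = x * (1 + 2 powr \<gamma> * x powr \<gamma>)"

definition left_branch_deriv :: "real \<Rightarrow> real \<Rightarrow> real" where
  "left_branch_deriv \<gamma> x = 1 + (1 + \<gamma>) * 2 powr \<gamma> * x powr \<gamma>"

text \<open>
  The formula of the left branch is inverted on the whole half-line, which makes the inverse
  differentiable at 1, too; the value 0 elsewhere makes it monotone on the real line.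
\<close>

definition left_inverse :: "real \<Rightarrow> real \<Rightarrow> real" where
  "left_inverse \<gamma> z = (if z \<le> 0 then 0 else (THE x. 0 \<le> x \<and> left_branch \<gamma> x = z))"

fun branch :: "real \<Rightarrow> nat \<Rightarrow> real \<Rightarrow> real" where
  "branch \<gamma> 0 z = (1 + z) / 2"
| "branch \<gamma> (Suc r) z = left_inverse \<gamma> (branch \<gamma> r z)"

fun branch_deriv :: "real \<Rightarrow> nat \<Rightarrow> real \<Rightarrow> real" where
  "branch_deriv \<gamma> 0 z = 1 / 2"
| "branch_deriv \<gamma> (Suc r) z = branch_deriv \<gamma> r z / left_branch_deriv \<gamma> (branch \<gamma> (Suc r) z)"

context
  fixes \<gamma> :: real
  assumes \<gamma>: "0 < \<gamma>" "\<gamma> < 1"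
begin

lemma left_branch_expand:
  assumes "0 \<le> x" "x \<le> x'"
  shows "x' - x \<le> left_branch \<gamma> x' - left_branch \<gamma> x"
proof -
  have "x powr \<gamma> \<le> x' powr \<gamma>" using assms \<gamma> by (intro powr_mono2) auto
  then have "x * (2 powr \<gamma> * x powr \<gamma>) \<le> x' * (2 powr \<gamma> * x' powr \<gamma>)"
    using assms by (intro mult_mono) auto
  then show ?thesis by (simp add: left_branch_def algebra_simps)
qed

lemma left_branch_has_derivative:
  assumes "0 < x"
  shows "(left_branch \<gamma> has_real_derivative left_branch_deriv \<gamma> x) (at x)"
proof -
  have "((\<lambda>x. x + 2 powr \<gamma> * x powr (1 + \<gamma>)) has_real_derivative (1 + 2 powr \<gamma> * ((1 + \<gamma>) * x powr (1 + \<gamma> - 1)))) (at x)"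
    using assms by (auto intro!: derivative_eq_intros)
  moreover have "\<forall>\<^sub>F y in nhds x. y + 2 powr \<gamma> * y powr (1 + \<gamma>) = left_branch \<gamma> y"
    using eventually_nhds_in_open[of "{0<..}" x] assms
    by (auto elim!: eventually_mono simp: left_branch_def powr_add algebra_simps)
  ultimately show ?thesis
    by (simp add: left_branch_deriv_def mult_ac DERIV_cong_ev[OF refl _ refl])
qed

lemma left_inverse_ex1:
  assumes "0 < z"
  shows "\<exists>!x. 0 \<le> x \<and> left_branch \<gamma> x = z"
proof -
  have "continuous_on {0..z} (left_branch \<gamma>)"
    unfolding left_branch_def using \<gamma> by (intro continuous_intros continuous_on_powr') auto
  moreover have "left_branch \<gamma> 0 \<le> z" "z \<le> left_branch \<gamma> z"
    using left_branch_expand[of 0 z] assms by (auto simp: left_branch_def)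
  ultimately obtain x where "0 \<le> x" "left_branch \<gamma> x = z"
    using IVT'[of "left_branch \<gamma>" 0 z z] assms by auto
  moreover have "x' = y'" if "0 \<le> x'" "0 \<le> y'" "left_branch \<gamma> x' = left_branch \<gamma> y'" for x' y'
  proof (cases "x' \<le> y'")
    case True
    show ?thesis using left_branch_expand[OF that(1) True] that(3) True by linarith
  next
    case False
    then show ?thesis using left_branch_expand[of y' x'] that by linarith
  qed
  ultimately show ?thesis by blast
qed

lemma left_branch_inverse:
  assumes "0 < z"
  shows "0 < left_inverse \<gamma> z" "left_branch \<gamma> (left_inverse \<gamma> z) = z"
proof -
  have *: "0 \<le> left_inverse \<gamma> z \<and> left_branch \<gamma> (left_inverse \<gamma> z) = z"
    using theI'[OF left_inverse_ex1[OF assms]] assms by (simp add: left_inverse_def)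
  then show "left_branch \<gamma> (left_inverse \<gamma> z) = z" by simp
  with * assms show "0 < left_inverse \<gamma> z"
    by (cases "left_inverse \<gamma> z = 0") (auto simp: left_branch_def)
qed

lemma left_inverse_eqI: "0 < z \<Longrightarrow> 0 \<le> x \<Longrightarrow> left_branch \<gamma> x = z \<Longrightarrow> left_inverse \<gamma> z = x"
  using left_inverse_ex1[of z] left_branch_inverse[of z] by (auto intro: less_imp_le)

lemma left_inverse_contract:
  assumes "0 < z" "z \<le> z'"
  shows "0 \<le> left_inverse \<gamma> z' - left_inverse \<gamma> z" "left_inverse \<gamma> z' - left_inverse \<gamma> z \<le> z' - z"
proof -
  note a = left_branch_inverse[OF assms(1)] and b = left_branch_inverse[of z']
  show mono: "0 \<le> left_inverse \<gamma> z' - left_inverse \<gamma> z"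
  proof (rule ccontr)
    assume "\<not> ?thesis"
    then show False
      using left_branch_expand[of "left_inverse \<gamma> z'" "left_inverse \<gamma> z"] a b assms by linarith
  qed
  show "left_inverse \<gamma> z' - left_inverse \<gamma> z \<le> z' - z"
    using left_branch_expand[of "left_inverse \<gamma> z" "left_inverse \<gamma> z'"] a b assms mono by linarith
qed

lemma mono_left_inverse: "mono (left_inverse \<gamma>)"
proof (rule monoI)
  fix z z' :: real assume "z \<le> z'"
  then show "left_inverse \<gamma> z \<le> left_inverse \<gamma> z'"
    using left_inverse_contract(1)[of z z'] left_branch_inverse(1)[of z']
    by (cases "0 < z"; cases "0 < z'") (auto simp: left_inverse_def)
qed

lemma left_branch_deriv_ge_1: "1 \<le> left_branch_deriv \<gamma> x"
  using \<gamma> by (simp add: left_branch_deriv_def)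

lemma left_branch_deriv_mono: "0 \<le> x \<Longrightarrow> x \<le> y \<Longrightarrow> left_branch_deriv \<gamma> x \<le> left_branch_deriv \<gamma> y"
  using \<gamma> by (auto simp: left_branch_deriv_def intro!: mult_left_mono powr_mono2)

lemma left_inverse_has_derivative:
  assumes "0 < z"
  shows "(left_inverse \<gamma> has_real_derivative inverse (left_branch_deriv \<gamma> (left_inverse \<gamma> z))) (at z)"
proof (rule DERIV_inverse_function[where a = 0 and b = "z + 1"])
  show "(left_branch \<gamma> has_real_derivative left_branch_deriv \<gamma> (left_inverse \<gamma> z)) (at (left_inverse \<gamma> z))"
    by (rule left_branch_has_derivative[OF left_branch_inverse(1)[OF assms]])
  show "left_branch_deriv \<gamma> (left_inverse \<gamma> z) \<noteq> 0" using left_branch_deriv_ge_1[of "left_inverse \<gamma> z"] by linarith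
  show "isCont (left_inverse \<gamma>) z"
  proof -
    have "continuous_on {0<..} (left_inverse \<gamma>)"
    proof (rule continuous_onI)
      fix x e :: real assume "x \<in> {0<..}" "0 < e"
      moreover have "dist (left_inverse \<gamma> x') (left_inverse \<gamma> x) \<le> dist x' x" if "0 < x'" "0 < x" for x' x
        using left_inverse_contract[of x x'] left_inverse_contract[of x' x] that
        by (cases "x \<le> x'") (auto simp: dist_real_def)
      ultimately show "\<exists>d>0. \<forall>x'\<in>{0<..}. dist x' x < d \<longrightarrow> dist (left_inverse \<gamma> x') (left_inverse \<gamma> x) \<le> e"
        by (intro exI[of _ e]) force
    qed
    then show ?thesis using assms by (auto simp: continuous_on_eq_continuous_at)
  qed
qed (use assms left_branch_inverse(2) in auto)

lemma left_branch_half: "left_branch \<gamma> (1/2) = 1"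
  by (simp add: left_branch_def powr_divide)

lemma left_inverse_1: "left_inverse \<gamma> 1 = 1/2"
  using left_branch_half by (intro left_inverse_eqI) auto

lemma left_inverse_le_half: "z \<le> 1 \<Longrightarrow> left_inverse \<gamma> z \<le> 1/2"
  using monoD[OF mono_left_inverse, of z 1] by (simp add: left_inverse_1)

lemma left_inverse_less_half:
  assumes "z < 1"
  shows "left_inverse \<gamma> z < 1/2"
proof (cases "0 < z")
  case True
  then show ?thesis
    using left_branch_inverse(2)[of z] left_branch_half left_inverse_le_half[of z] assms
    by (cases "left_inverse \<gamma> z = 1/2") auto
qed (simp add: left_inverse_def)

lemma branch_pos: "0 \<le> z \<Longrightarrow> 0 < branch \<gamma> r z"
  by (induction r) (auto simp: left_branch_inverse)

lemma branch_le_1: "z \<le> 1 \<Longrightarrow> branch \<gamma> r z \<le> 1"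
proof (induction r)
  case (Suc r)
  then show ?case using left_inverse_le_half[of "branch \<gamma> r z"] by simp
qed simp

lemma branch_less_1: "z < 1 \<Longrightarrow> branch \<gamma> r z < 1"
proof (induction r)
  case (Suc r)
  then show ?case using left_inverse_less_half[of "branch \<gamma> r z"] by simp
qed simp

lemma mono_branch: "mono (branch \<gamma> r)"
proof (induction r)
  case (Suc r)
  then show ?case by (auto intro!: monoI intro: monoD[OF mono_left_inverse] monoD)
qed (auto intro: monoI)

lemma branch_has_derivative:
  assumes "z \<in> {0..1}"
  shows "(branch \<gamma> r has_real_derivative branch_deriv \<gamma> r z) (at z)"
proof (induction r)
  case 0
  have "((\<lambda>z. (1 + z) / 2) has_real_derivative 1/2) (at z)"
    by (auto intro!: derivative_eq_intros)
  moreover have "branch \<gamma> 0 = (\<lambda>z. (1 + z) / 2)" by auto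
  ultimately show ?case by simp
next
  case (Suc r)
  have "0 < branch \<gamma> r z" using branch_pos assms by simp
  from DERIV_chain2[OF left_inverse_has_derivative[OF this] Suc]
  have "((\<lambda>z. branch \<gamma> (Suc r) z) has_real_derivative
      inverse (left_branch_deriv \<gamma> (left_inverse \<gamma> (branch \<gamma> r z))) * branch_deriv \<gamma> r z) (at z)" by simp
  then show ?case by (simp add: field_simps)
qed

lemma branch_deriv_pos: "0 < branch_deriv \<gamma> r z"
proof (induction r)
  case (Suc r)
  then show ?case using left_branch_deriv_ge_1[of "branch \<gamma> (Suc r) z"] by simp
qed simp

lemma branch_deriv_le: "branch_deriv \<gamma> r z \<le> 1/2"
proof (induction r)
  case (Suc r)
  have "branch_deriv \<gamma> (Suc r) z \<le> branch_deriv \<gamma> r z"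
    using left_branch_deriv_ge_1[of "branch \<gamma> (Suc r) z"] branch_deriv_pos[of r z] by (simp add: divide_le_eq mult_le_cancel_left1)
  with Suc show ?case by linarith
qed simp

lemma branch_deriv_antimono: "antimono_on {0..1} (branch_deriv \<gamma> r)"
proof (induction r)
  case (Suc r)
  show ?case
  proof (rule monotone_onI)
    fix x y :: real assume xy: "x \<in> {0..1}" "y \<in> {0..1}" "x \<le> y"
    have "branch_deriv \<gamma> r y \<le> branch_deriv \<gamma> r x" using monotone_onD[OF Suc xy] .
    moreover have "left_branch_deriv \<gamma> (branch \<gamma> (Suc r) x) \<le> left_branch_deriv \<gamma> (branch \<gamma> (Suc r) y)"
      using xy branch_pos[of x "Suc r"] monoD[OF mono_branch xy(3), of "Suc r"] by (intro left_branch_deriv_mono) auto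
    ultimately show "branch_deriv \<gamma> (Suc r) y \<le> branch_deriv \<gamma> (Suc r) x"
      using branch_deriv_pos[of r y] left_branch_deriv_ge_1[of "branch \<gamma> (Suc r) x"]
      by (simp del: branch.simps) (rule frac_le, auto)
  qed
qed (auto intro: monotone_onI)

lemma branch_adj: "branch \<gamma> (Suc r) 1 = branch \<gamma> r 0"
  by (induction r) (simp_all add: left_inverse_1)

text \<open>
  Bounded distortion without any estimate: the backward orbit of 1 under the left branch is the
  sequence of the \<open>branch \<gamma> r 0\<close>, so the two products of derivatives have all factors in common
  except for the derivative \<open>2 + \<gamma>\<close> of the left branch at \<open>1/2\<close>.
\<close>

lemma branch_deriv_adj: "branch_deriv \<gamma> r 0 = (2 + \<gamma>) * branch_deriv \<gamma> (Suc r) 1"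
proof (induction r)
  case 0
  have "left_branch_deriv \<gamma> (1/2) = 2 + \<gamma>" by (simp add: left_branch_deriv_def powr_divide)
  then show ?case using \<gamma> by (simp add: left_inverse_1)
next
  case (Suc r)
  have "branch_deriv \<gamma> (Suc (Suc r)) 1 = branch_deriv \<gamma> (Suc r) 1 / left_branch_deriv \<gamma> (branch \<gamma> (Suc r) 0)"
    by (subst branch_deriv.simps(2), subst branch_adj) (rule refl)
  moreover have "branch_deriv \<gamma> (Suc r) 0 = branch_deriv \<gamma> r 0 / left_branch_deriv \<gamma> (branch \<gamma> (Suc r) 0)"
    by (rule branch_deriv.simps(2))
  ultimately show ?case using Suc by (simp del: branch.simps branch_deriv.simps)
qed

lemma branch_measurable: "branch \<gamma> r \<in> borel_measurable borel"
  by (rule borel_measurable_mono[OF mono_branch])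

lemma branch_deriv_measurable: "branch_deriv \<gamma> r \<in> borel_measurable borel"
proof (induction r)
  case (Suc r)
  note [measurable] = Suc branch_measurable[of "Suc r"]
  have "(\<lambda>z. branch_deriv \<gamma> r z / left_branch_deriv \<gamma> (branch \<gamma> (Suc r) z)) \<in> borel_measurable borel"
    unfolding left_branch_deriv_def by measurable
  then show ?case by simp
qed simp

lemma branch_deriv_continuous: "continuous_on {0..1} (branch_deriv \<gamma> r)"
proof (induction r)
  case (Suc r)
  have c: "continuous_on {0..1} (branch \<gamma> (Suc r))"
    using branch_has_derivative by (intro continuous_at_imp_continuous_on ballI DERIV_isCont) blast
  have "continuous_on {0..1} (\<lambda>z. branch_deriv \<gamma> r z / left_branch_deriv \<gamma> (branch \<gamma> (Suc r) z))"
  proof (intro continuous_intros Suc)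
    show "continuous_on {0..1} (\<lambda>z. left_branch_deriv \<gamma> (branch \<gamma> (Suc r) z))"
      unfolding left_branch_deriv_def
      by (intro continuous_intros c ballI) (use branch_pos[of _ "Suc r"] in force)
    show "\<forall>z\<in>{0..1}. left_branch_deriv \<gamma> (branch \<gamma> (Suc r) z) \<noteq> 0"
      using left_branch_deriv_ge_1 by (metis not_one_le_zero)
  qed
  then show ?case by simp
qed simp

text \<open>
  If \<open>t = s * (1 + q)\<close> with \<open>q = (2 s)^\<gamma>\<close>, then \<open>s^(-\<gamma>) = t^(-\<gamma>) * (1 + q)^\<gamma>\<close> exceeds \<open>t^(-\<gamma>)\<close> by
  about \<open>\<gamma> * q * t^(-\<gamma>)\<close>, where \<open>q * t^(-\<gamma>) \<ge> 1\<close> because \<open>t \<le> 2 * s\<close>. So \<open>s^(-\<gamma>)\<close> grows at least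
  linearly along the backward orbit.
\<close>

lemma branch_0_powr_ge: "\<gamma> / 2 * real (Suc r) \<le> branch \<gamma> r 0 powr -\<gamma>"
proof (induction r)
  case 0
  have "(1/2) powr -\<gamma> = 2 powr \<gamma>" by (simp add: powr_divide powr_minus)
  moreover have "1 \<le> 2 powr \<gamma>" using \<gamma> by (intro ge_one_powr_ge_zero) auto
  ultimately show ?case using \<gamma> by simp
next
  case (Suc r)
  define s where "s = branch \<gamma> (Suc r) 0"
  define t where "t = branch \<gamma> r 0"
  define q where "q = 2 powr \<gamma> * s powr \<gamma>"
  have s: "0 < s" and t: "0 < t" using branch_pos[of 0] by (auto simp: s_def t_def simp del: branch.simps)
  have "s \<le> 1/2" using left_inverse_le_half[OF branch_le_1[of 0 r]] by (simp add: s_def)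
  have ts: "t = s * (1 + q)"
    using left_branch_inverse(2)[OF t] by (simp add: s_def t_def q_def left_branch_def)
  have q0: "0 < q" using s by (simp add: q_def)
  have q1: "q \<le> 1"
  proof -
    have "q = (2 * s) powr \<gamma>" using s by (simp add: q_def powr_mult)
    also have "\<dots> \<le> 1" using s \<open>s \<le> 1/2\<close> \<gamma> by (intro powr_le1) auto
    finally show ?thesis .
  qed
  have ln_q: "q / 2 \<le> ln (1 + q)"
  proof -
    have "ln (1 / (1 + q)) \<le> 1 / (1 + q) - 1" using q0 by (intro ln_le_minus_one) auto
    also have "\<dots> = - (q / (1 + q))" using q0 by (simp add: field_simps)
    finally have "q / (1 + q) \<le> ln (1 + q)" using q0 by (simp add: ln_div)
    moreover have "q / 2 \<le> q / (1 + q)" using q0 q1 by (intro divide_left_mono) auto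
    ultimately show ?thesis by linarith
  qed
  have "1 + \<gamma> * (q / 2) \<le> 1 + \<gamma> * ln (1 + q)" using ln_q \<gamma> by simp
  also have "\<dots> \<le> exp (\<gamma> * ln (1 + q))" by (rule exp_ge_add_one_self)
  also have "\<dots> = (1 + q) powr \<gamma>" using q0 by (simp add: powr_def)
  finally have bern: "1 + \<gamma> * (q / 2) \<le> (1 + q) powr \<gamma>" .
  have st: "s powr -\<gamma> = t powr -\<gamma> * (1 + q) powr \<gamma>"
  proof -
    have "t powr -\<gamma> = s powr -\<gamma> * (1 + q) powr -\<gamma>" unfolding ts by (rule powr_mult)
    moreover have "(1 + q) powr -\<gamma> * (1 + q) powr \<gamma> = 1" using q0 by (simp flip: powr_add)
    ultimately show ?thesis by simp
  qed
  have tq: "1 \<le> t powr -\<gamma> * q"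
  proof -
    have "t \<le> 2 * s" using ts q1 s by (simp add: algebra_simps)
    then have "t powr \<gamma> \<le> (2 * s) powr \<gamma>" using t \<gamma> by (intro powr_mono2) auto
    then have "t powr \<gamma> \<le> q" using s by (simp add: q_def powr_mult)
    then show ?thesis using t by (simp add: powr_minus field_simps)
  qed
  have "t powr -\<gamma> + \<gamma> / 2 \<le> t powr -\<gamma> + \<gamma> / 2 * (t powr -\<gamma> * q)"
    using tq \<gamma> by (intro add_left_mono) (simp add: mult_le_cancel_left1)
  also have "\<dots> = t powr -\<gamma> * (1 + \<gamma> * (q / 2))" by (simp add: algebra_simps)
  also have "\<dots> \<le> s powr -\<gamma>" unfolding st using bern by (intro mult_left_mono) auto
  finally show ?case using Suc by (simp add: s_def t_def algebra_simps)
qed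

lemma branch_0_le: "branch \<gamma> r 0 \<le> (\<gamma> / 2) powr -(1/\<gamma>) * real (Suc r) powr -(1/\<gamma>)"
proof -
  let ?s = "branch \<gamma> r 0"
  have s: "0 < ?s" by (rule branch_pos) simp
  have "?s = (?s powr -\<gamma>) powr -(1/\<gamma>)" using s \<gamma> by (simp add: powr_powr)
  also have "\<dots> \<le> (\<gamma> / 2 * real (Suc r)) powr -(1/\<gamma>)"
    using branch_0_powr_ge[of r] \<gamma> by (intro powr_mono2') auto
  also have "\<dots> = (\<gamma> / 2) powr -(1/\<gamma>) * real (Suc r) powr -(1/\<gamma>)"
    by (rule powr_mult)
  finally show ?thesis .
qed

lemma decreasing_branch_map_intermittent:
  "decreasing_branch_map (intermittent_map \<gamma>) (branch \<gamma>) (branch_deriv \<gamma>)"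
proof
  show "intermittent_map \<gamma> \<in> borel_measurable borel"
    unfolding intermittent_map_def by measurable
  show "branch \<gamma> r \<in> borel_measurable borel" "branch_deriv \<gamma> r \<in> borel_measurable borel" for r
    by (rule branch_measurable branch_deriv_measurable)+
  show "intermittent_map \<gamma> (branch \<gamma> 0 z) = z" if "z \<in> {0..<1}" for z
    using that by (simp add: intermittent_map_def field_simps)
  show "intermittent_map \<gamma> (branch \<gamma> (Suc r) z) = branch \<gamma> r z" if "z \<in> {0..<1}" for r z
    using left_inverse_less_half[OF branch_less_1[of z r]] left_branch_inverse(2)[OF branch_pos[of z r]] that
    by (simp add: intermittent_map_def left_branch_def)
  show "(branch \<gamma> r has_real_derivative branch_deriv \<gamma> r z) (at z)" if "z \<in> {0..1}" for r z
    by (rule branch_has_derivative[OF that])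
  show "branch_deriv \<gamma> r 0 \<le> 3 * branch_deriv \<gamma> (Suc r) 1" for r
    using branch_deriv_adj[of r] branch_deriv_pos[of "Suc r" 1] \<gamma> by (simp del: branch_deriv.simps)
  show "(\<lambda>r. branch \<gamma> r 0) \<longlonglongrightarrow> 0"
  proof (rule tendsto_sandwich[of "\<lambda>_. 0"])
    have "filterlim (\<lambda>r. real (Suc r)) at_top sequentially"
      by (rule filterlim_compose[OF filterlim_real_sequentially filterlim_Suc])
    then have "(\<lambda>r. real (Suc r) powr -(1/\<gamma>)) \<longlonglongrightarrow> 0"
      using \<gamma> by (intro tendsto_neg_powr) auto
    then show "(\<lambda>r. (\<gamma> / 2) powr -(1/\<gamma>) * real (Suc r) powr -(1/\<gamma>)) \<longlonglongrightarrow> 0"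
      by (rule tendsto_mult_right_zero)
    show "\<forall>\<^sub>F r in sequentially. 0 \<le> branch \<gamma> r 0"
      using branch_pos[of 0] by (intro always_eventually allI less_imp_le) auto
    show "\<forall>\<^sub>F r in sequentially. branch \<gamma> r 0 \<le> (\<gamma> / 2) powr -(1/\<gamma>) * real (Suc r) powr -(1/\<gamma>)"
      using branch_0_le by (intro always_eventually allI)
  qed auto
  show "continuous_on {0..1} (branch_deriv \<gamma> r)" for r by (rule branch_deriv_continuous)
  show "antimono_on {0..1} (branch_deriv \<gamma> r)" for r by (rule branch_deriv_antimono)
  show "0 < branch_deriv \<gamma> r z" "branch_deriv \<gamma> r z \<le> 1/2" for r z
    by (rule branch_deriv_pos, rule branch_deriv_le)
  show "branch \<gamma> (Suc r) 1 = branch \<gamma> r 0" for r by (rule branch_adj)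
qed simp

lemma polynomial_branch_map_intermittent:
  assumes "1/2 \<le> \<gamma>"
  shows "polynomial_branch_map (intermittent_map \<gamma>) (branch \<gamma>) (branch_deriv \<gamma>) (1/\<gamma>) ((\<gamma> / 2) powr -(1/\<gamma>))"
  using assms \<gamma> branch_0_le
  by (intro polynomial_branch_map.intro decreasing_branch_map_intermittent polynomial_branch_map_axioms.intro)
     (auto simp: field_simps)

end

section \<open>The Wasserstein distance and distribution functions\<close>

lemma measurable_ident_unit_borel:
  assumes "sets \<mu> = sets unit_borel"
  shows "(\<lambda>x. x) \<in> borel_measurable \<mu>"
  by (subst measurable_cong_sets[OF assms refl], rule measurable_restrict_space1) simp

lemma emeasure_distr_borel:
  assumes "sets \<mu> = sets unit_borel" "A \<in> sets \<mu>"
  shows "A \<in> sets borel" "emeasure (distr \<mu> borel (\<lambda>x. x)) A = emeasure \<mu> A"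
proof -
  have sp: "space \<mu> = {0..1}" using sets_eq_imp_space_eq[OF assms(1)] by (simp add: space_restrict_space)
  have id: "(\<lambda>x. x) \<in> borel_measurable \<mu>"
    by (rule measurable_ident_unit_borel[OF assms(1)])
  show A: "A \<in> sets borel" using assms by (auto simp: sets_restrict_space)
  have "A \<subseteq> space \<mu>" by (rule sets.sets_into_space[OF assms(2)])
  then show "emeasure (distr \<mu> borel (\<lambda>x. x)) A = emeasure \<mu> A"
    using emeasure_distr[OF id A] by (simp add: Int_absorb2)
qed

text \<open>
  The coupling is the joint law of the two quantile functions under the uniform law of \<open>\<omega>\<close>. Its
  cost is \<open>\<integral>\<integral> \<bar>[X \<omega> \<le> t] - [Y \<omega> \<le> t]\<bar> dt d\<omega>\<close>, and \<open>X \<omega> \<le> t\<close> is equivalent to \<open>\<omega> \<le> F t\<close>, so integrating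
  over \<open>\<omega>\<close> first gives the distance of the distribution functions.
\<close>

lemma W1_le_cdf_distance:
  assumes "prob_space \<mu>" "sets \<mu> = sets unit_borel" "prob_space \<nu>" "sets \<nu> = sets unit_borel"
  shows "0 \<le> W1 \<mu> \<nu>"
    and "W1 \<mu> \<nu> \<le> (\<integral>t. \<bar>measure \<mu> ({0..1} \<inter> {..t}) - measure \<nu> ({0..1} \<inter> {..t})\<bar> \<partial>leb01)"
proof -
  let ?\<Omega> = "restrict_space lborel {0<..<1::real}"
  have \<Omega>: "prob_space ?\<Omega>"
    by (auto simp: space_restrict_space emeasure_restrict_space intro!: prob_spaceI)
  interpret \<Omega>: prob_space ?\<Omega> by (rule \<Omega>)
  have quantile: "\<exists>X. X \<in> measurable ?\<Omega> borel \<and> (\<forall>\<omega>. X \<omega> \<in> {0..1}) \<and> distr ?\<Omega> m X = m \<and>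
      (\<forall>\<omega>\<in>{0<..<1}. \<forall>t. X \<omega> \<le> t \<longleftrightarrow> \<omega> \<le> measure m ({0..1} \<inter> {..t}))"
    if m: "prob_space m" "sets m = sets unit_borel" for m :: "real measure"
  proof -
    interpret m: prob_space m by (rule m(1))
    have sp: "space m = {0..1}" using sets_eq_imp_space_eq[OF m(2)] by (simp add: space_restrict_space)
    have id: "(\<lambda>x. x) \<in> borel_measurable m"
      by (rule measurable_ident_unit_borel[OF m(2)])
    let ?M = "distr m borel (\<lambda>x. x)"
    interpret M: cdf_distribution ?M
      by (intro cdf_distribution.intro real_distribution.intro real_distribution_axioms.intro m.prob_space_distr id) auto
    have cdf: "cdf ?M t = measure m ({0..1} \<inter> {..t})" for t
      unfolding cdf_def using measure_distr[OF id, of "{..t}"] by (simp add: sp Int_commute)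
    have I: "\<omega> \<le> measure m ({0..1} \<inter> {..t}) \<longleftrightarrow> M.I \<omega> \<le> t" if "\<omega> \<in> {0<..<1}" for \<omega> t
      using M.pseudoinverse' that unfolding cdf by blast
    have I01: "M.I \<omega> \<in> {0..1}" if \<omega>: "\<omega> \<in> {0<..<1}" for \<omega>
    proof -
      have "{0..1} \<inter> {..1::real} = space m" unfolding sp by auto
      then have "measure m ({0..1} \<inter> {..1}) = 1" by (simp only: m.prob_space)
      then have "M.I \<omega> \<le> 1" using I[OF \<omega>, of 1] \<omega> by simp
      moreover have "0 \<le> M.I \<omega>"
      proof (rule ccontr)
        assume neg: "\<not> 0 \<le> M.I \<omega>"
        then have "{0..1} \<inter> {..M.I \<omega>} = {}" by auto
        then show False using I[OF \<omega>, of "M.I \<omega>"] \<omega> by simp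
      qed
      ultimately show ?thesis by simp
    qed
    define X where "X \<omega> = max 0 (min 1 (M.I \<omega>))" for \<omega>
    have Xeq: "X \<omega> = M.I \<omega>" if "\<omega> \<in> {0<..<1}" for \<omega> using I01[OF that] by (simp add: X_def)
    have Im: "M.I \<in> measurable ?\<Omega> borel"
      by (subst measurable_cong_sets[OF sets_restrict_space_cong[OF sets_lborel] refl]) (rule M.measurable_CI)
    then have Xm: "X \<in> measurable ?\<Omega> borel" unfolding X_def by measurable
    have Xmm: "X \<in> measurable ?\<Omega> m"
    proof -
      have "X \<in> measurable ?\<Omega> unit_borel"
        by (rule measurable_restrict_space2[OF _ Xm]) (auto simp: X_def)
      then show ?thesis using measurable_cong_sets[OF refl m(2)] by blast
    qed
    have "distr ?\<Omega> m X = m"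
    proof (rule measure_eqI)
      fix A assume "A \<in> sets (distr ?\<Omega> m X)"
      then have A: "A \<in> sets m" by simp
      note Ab = emeasure_distr_borel[OF m(2) A]
      have "emeasure (distr ?\<Omega> m X) A = emeasure ?\<Omega> (X -` A \<inter> space ?\<Omega>)" by (rule emeasure_distr[OF Xmm A])
      also have "X -` A \<inter> space ?\<Omega> = M.I -` A \<inter> space ?\<Omega>" using Xeq by (auto simp: space_restrict_space)
      also have "emeasure ?\<Omega> (M.I -` A \<inter> space ?\<Omega>) = emeasure (distr ?\<Omega> borel M.I) A"
        by (rule emeasure_distr[OF Im Ab(1), symmetric])
      also have "\<dots> = emeasure m A" using M.distr_I_eq_M Ab(2) by simp
      finally show "emeasure (distr ?\<Omega> m X) A = emeasure m A" .
    qed simp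
    moreover have "\<forall>\<omega>\<in>{0<..<1}. \<forall>t. X \<omega> \<le> t \<longleftrightarrow> \<omega> \<le> measure m ({0..1} \<inter> {..t})"
      using I Xeq by simp
    moreover have "\<forall>\<omega>. X \<omega> \<in> {0..1}" by (simp add: X_def)
    ultimately show ?thesis using Xm by blast
  qed
  obtain X where X: "X \<in> measurable ?\<Omega> borel" "\<And>\<omega>. X \<omega> \<in> {0..1}" "distr ?\<Omega> \<mu> X = \<mu>"
    "\<And>\<omega> t. \<omega> \<in> {0<..<1} \<Longrightarrow> X \<omega> \<le> t \<longleftrightarrow> \<omega> \<le> measure \<mu> ({0..1} \<inter> {..t})"
    using quantile[OF assms(1,2)] by blast
  obtain Y where Y: "Y \<in> measurable ?\<Omega> borel" "\<And>\<omega>. Y \<omega> \<in> {0..1}" "distr ?\<Omega> \<nu> Y = \<nu>"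
    "\<And>\<omega> t. \<omega> \<in> {0<..<1} \<Longrightarrow> Y \<omega> \<le> t \<longleftrightarrow> \<omega> \<le> measure \<nu> ({0..1} \<inter> {..t})"
    using quantile[OF assms(3,4)] by blast
  note [measurable] = X(1) Y(1)
  have Xm: "X \<in> measurable ?\<Omega> \<mu>" and Ym: "Y \<in> measurable ?\<Omega> \<nu>"
    using measurable_restrict_space2[OF _ X(1), of "{0..1}"] measurable_restrict_space2[OF _ Y(1), of "{0..1}"] X(2) Y(2)
      measurable_cong_sets[OF refl assms(2)] measurable_cong_sets[OF refl assms(4)] by blast+
  have XY: "(\<lambda>\<omega>. (X \<omega>, Y \<omega>)) \<in> measurable ?\<Omega> (\<mu> \<Otimes>\<^sub>M \<nu>)" using Xm Ym by simp
  define \<pi> where "\<pi> = distr ?\<Omega> (\<mu> \<Otimes>\<^sub>M \<nu>) (\<lambda>\<omega>. (X \<omega>, Y \<omega>))"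
  have "\<pi> \<in> couplings \<mu> \<nu>"
    unfolding couplings_def
  proof (intro CollectI conjI)
    show "prob_space \<pi>" unfolding \<pi>_def by (rule \<Omega>.prob_space_distr[OF XY])
    show "sets \<pi> = sets (\<mu> \<Otimes>\<^sub>M \<nu>)" by (simp add: \<pi>_def)
    show "distr \<pi> \<mu> fst = \<mu>" unfolding \<pi>_def by (subst distr_distr[OF _ XY]) (auto simp: o_def X(3))
    show "distr \<pi> \<nu> snd = \<nu>" unfolding \<pi>_def by (subst distr_distr[OF _ XY]) (auto simp: o_def Y(3))
  qed
  then have ne: "couplings \<mu> \<nu> \<noteq> {}" and W: "W1 \<mu> \<nu> \<le> (\<integral>p. \<bar>fst p - snd p\<bar> \<partial>\<pi>)"
    unfolding W1_def by (auto intro!: cINF_lower bdd_belowI2[of _ 0])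
  show "0 \<le> W1 \<mu> \<nu>" unfolding W1_def by (rule cINF_greatest[OF ne]) simp
  have "(\<lambda>x. x) \<in> borel_measurable \<mu>" "(\<lambda>x. x) \<in> borel_measurable \<nu>"
    by (rule measurable_ident_unit_borel, rule assms)+
  then have [measurable]: "fst \<in> borel_measurable (\<mu> \<Otimes>\<^sub>M \<nu>)" "snd \<in> borel_measurable (\<mu> \<Otimes>\<^sub>M \<nu>)"
    by (auto intro: measurable_compose[OF measurable_fst] measurable_compose[OF measurable_snd])
  have "(\<integral>p. \<bar>fst p - snd p\<bar> \<partial>\<pi>) = (\<integral>\<omega>. \<bar>X \<omega> - Y \<omega>\<bar> \<partial>?\<Omega>)"
    unfolding \<pi>_def by (subst integral_distr[OF XY]) auto
  with W have W: "W1 \<mu> \<nu> \<le> (\<integral>\<omega>. \<bar>X \<omega> - Y \<omega>\<bar> \<partial>?\<Omega>)" by simp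
  define F where "F t = measure \<mu> ({0..1} \<inter> {..t})" for t
  define G where "G t = measure \<nu> ({0..1} \<inter> {..t})" for t
  have XF: "X \<omega> \<le> t \<longleftrightarrow> \<omega> \<le> F t" and YG: "Y \<omega> \<le> t \<longleftrightarrow> \<omega> \<le> G t" if "\<omega> \<in> {0<..<1}" for \<omega> t
    unfolding F_def G_def by (rule X(4)[OF that], rule Y(4)[OF that])
  have int: "{0..1} \<inter> {..t} \<in> sets unit_borel" for t :: real by (auto simp: sets_restrict_space)
  interpret \<mu>: prob_space \<mu> by (rule assms(1))
  interpret \<nu>: prob_space \<nu> by (rule assms(3))
  have "mono F"
    unfolding F_def by (rule monoI, rule \<mu>.finite_measure_mono, force, simp only: assms(2) int)
  moreover have "mono G"
    unfolding G_def by (rule monoI, rule \<nu>.finite_measure_mono, force, simp only: assms(4) int)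
  ultimately have [measurable]: "F \<in> borel_measurable borel" "G \<in> borel_measurable borel"
    by (auto intro: borel_measurable_mono)
  have "0 \<le> F t" "F t \<le> 1" "0 \<le> G t" "G t \<le> 1" for t
    unfolding F_def G_def by simp_all
  then have FG: "\<bar>F t - G t\<bar> \<le> 1" for t
    by (simp add: abs_le_iff) (smt (verit))
  interpret P: pair_sigma_finite ?\<Omega> leb01 ..
  have step_m: "(\<lambda>(\<omega>, t). ennreal \<bar>of_bool (X \<omega> \<le> t) - of_bool (Y \<omega> \<le> t)\<bar>) \<in> borel_measurable (?\<Omega> \<Otimes>\<^sub>M leb01)"
    by measurable
  have "ennreal (\<integral>\<omega>. \<bar>X \<omega> - Y \<omega>\<bar> \<partial>?\<Omega>) = (\<integral>\<^sup>+\<omega>. ennreal \<bar>X \<omega> - Y \<omega>\<bar> \<partial>?\<Omega>)"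
  proof (rule nn_integral_eq_integral[symmetric])
    have "\<bar>X \<omega> - Y \<omega>\<bar> \<le> 1" for \<omega> using X(2)[of \<omega>] Y(2)[of \<omega>] by (auto simp: abs_le_iff)
    then show "integrable ?\<Omega> (\<lambda>\<omega>. \<bar>X \<omega> - Y \<omega>\<bar>)"
      by (intro \<Omega>.integrable_const_bound[of _ 1]) auto
  qed auto
  also have "\<dots> = (\<integral>\<^sup>+\<omega>. \<integral>\<^sup>+t. ennreal \<bar>of_bool (X \<omega> \<le> t) - of_bool (Y \<omega> \<le> t)\<bar> \<partial>leb01 \<partial>?\<Omega>)"
    by (simp only: integral_step_difference[OF X(2) Y(2)])
  also have "\<dots> = (\<integral>\<^sup>+t. \<integral>\<^sup>+\<omega>. ennreal \<bar>of_bool (X \<omega> \<le> t) - of_bool (Y \<omega> \<le> t)\<bar> \<partial>?\<Omega> \<partial>leb01)"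
    by (rule P.Fubini'[OF step_m, symmetric])
  also have "\<dots> \<le> (\<integral>\<^sup>+t. ennreal \<bar>F t - G t\<bar> \<partial>leb01)"
  proof (rule nn_integral_mono)
    fix t
    have "(\<integral>\<^sup>+\<omega>. ennreal \<bar>of_bool (X \<omega> \<le> t) - of_bool (Y \<omega> \<le> t)\<bar> \<partial>?\<Omega>)
        = (\<integral>\<^sup>+\<omega>. indicator {min (F t) (G t)<..max (F t) (G t)} \<omega> \<partial>?\<Omega>)"
      by (intro nn_integral_cong) (auto simp: XF YG space_restrict_space split: split_indicator)
    also have "\<dots> \<le> (\<integral>\<^sup>+\<omega>. indicator {min (F t) (G t)<..max (F t) (G t)} \<omega> \<partial>lborel)"
    proof (subst nn_integral_restrict_space)
      show "(\<integral>\<^sup>+\<omega>. indicator {min (F t) (G t)<..max (F t) (G t)} \<omega> * indicator {0<..<1} \<omega> \<partial>lborel)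
          \<le> (\<integral>\<^sup>+\<omega>. indicator {min (F t) (G t)<..max (F t) (G t)} \<omega> \<partial>lborel)"
        by (rule nn_integral_mono) (auto split: split_indicator)
    qed simp
    also have "\<dots> = ennreal \<bar>F t - G t\<bar>" by (auto simp: max_def min_def)
    finally show "(\<integral>\<^sup>+\<omega>. ennreal \<bar>of_bool (X \<omega> \<le> t) - of_bool (Y \<omega> \<le> t)\<bar> \<partial>?\<Omega>) \<le> ennreal \<bar>F t - G t\<bar>" .
  qed
  also have "\<dots> = ennreal (\<integral>t. \<bar>F t - G t\<bar> \<partial>leb01)"
    using FG by (intro nn_integral_eq_integral integrable_leb01_bounded[of _ 1]) auto
  finally have "(\<integral>\<omega>. \<bar>X \<omega> - Y \<omega>\<bar> \<partial>?\<Omega>) \<le> (\<integral>t. \<bar>F t - G t\<bar> \<partial>leb01)"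
    by (subst (asm) ennreal_le_iff) auto
  with W show "W1 \<mu> \<nu> \<le> (\<integral>t. \<bar>measure \<mu> ({0..1} \<inter> {..t}) - measure \<nu> ({0..1} \<inter> {..t})\<bar> \<partial>leb01)"
    unfolding F_def G_def by (rule order_trans)
qed

lemma measure_empirical_measure:
  assumes "0 < \<gamma>" "x \<in> {0..1}" "0 < n"
  shows "measure (empirical_measure \<gamma> n x) ({0..1} \<inter> {..t}) = (\<Sum>k=1..n. of_bool ((intermittent_map \<gamma> ^^ k) x \<le> t)) / real n"
proof -
  have "{0..1} \<inter> {..t} \<in> sets unit_borel" by (auto simp: sets_restrict_space)
  then have "emeasure (empirical_measure \<gamma> n x) ({0..1} \<inter> {..t})
      = ennreal (1 / real n) * (\<Sum>k=1..n. indicator ({0..1} \<inter> {..t}) ((intermittent_map \<gamma> ^^ k) x))"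
    by (rule emeasure_empirical_measure)
  also have "(\<Sum>k=1..n. indicator ({0..1} \<inter> {..t}) ((intermittent_map \<gamma> ^^ k) x))
      = (\<Sum>k=1..n. ennreal (of_bool ((intermittent_map \<gamma> ^^ k) x \<le> t)))"
    using intermittent_map_funpow_in[OF assms(1,2)] by (intro sum.cong) (auto simp: indicator_def)
  also have "\<dots> = ennreal (\<Sum>k=1..n. of_bool ((intermittent_map \<gamma> ^^ k) x \<le> t))"
    by (rule sum_ennreal) simp
  also have "ennreal (1 / real n) * \<dots> = ennreal ((\<Sum>k=1..n. of_bool ((intermittent_map \<gamma> ^^ k) x \<le> t)) / real n)"
    by (subst ennreal_mult[symmetric]) (auto intro!: sum_nonneg simp del: sum_of_bool_eq)
  finally show ?thesis unfolding measure_def by (subst enn2real_ennreal[symmetric]) (auto intro!: sum_nonneg divide_nonneg_nonneg simp del: sum_of_bool_eq)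
qed

section \<open>Almost sure convergence for the intermittent map\<close>

locale intermittent_system =
  fixes \<gamma> :: real and \<nu> :: "real measure"
  assumes \<gamma>: "1/2 \<le> \<gamma>" "\<gamma> < 1" and inv: "invariant_ac_prob \<gamma> \<nu>"

sublocale intermittent_system \<subseteq>
  polynomial_branch_map "intermittent_map \<gamma>" "branch \<gamma>" "branch_deriv \<gamma>" "1/\<gamma>" "(\<gamma> / 2) powr -(1/\<gamma>)"
  using \<gamma> by (intro polynomial_branch_map_intermittent) auto

context intermittent_system
begin

abbreviation T :: "real \<Rightarrow> real" where "T \<equiv> intermittent_map \<gamma>"

definition F\<nu> :: "real \<Rightarrow> real" where
  "F\<nu> t = measure \<nu> ({0..1} \<inter> {..t})"

lemma \<gamma>_pos: "0 < \<gamma>" using \<gamma> by simp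

lemma \<nu>_prob: "prob_space \<nu>" and \<nu>_sets: "sets \<nu> = sets unit_borel"
  and \<nu>_inv: "distr \<nu> \<nu> T = \<nu>" and \<nu>_ac: "absolutely_continuous unit_lebesgue \<nu>"
  using inv by (auto simp: invariant_ac_prob_def)

lemma \<nu>_space: "space \<nu> = {0..1}"
  using sets_eq_imp_space_eq[OF \<nu>_sets] by (simp add: space_restrict_space)

lemma borel_measurable_\<nu>:
  assumes "f \<in> borel_measurable borel"
  shows "f \<in> borel_measurable \<nu>"
  by (subst measurable_cong_sets[OF \<nu>_sets refl]) (rule measurable_restrict_space1[OF assms])

lemma T_measurable_\<nu>: "T \<in> measurable \<nu> \<nu>"
  by (subst measurable_cong_sets[OF \<nu>_sets \<nu>_sets]) (rule intermittent_map_measurable[OF \<gamma>_pos])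

lemma distr_funpow_T: "distr \<nu> \<nu> (T ^^ k) = \<nu>" and funpow_T_measurable_\<nu>: "T ^^ k \<in> measurable \<nu> \<nu>"
proof -
  have "T ^^ k \<in> measurable \<nu> \<nu> \<and> distr \<nu> \<nu> (T ^^ k) = \<nu>"
  proof (induction k)
    case (Suc k)
    then have "distr \<nu> \<nu> (T \<circ> T ^^ k) = distr (distr \<nu> \<nu> (T ^^ k)) \<nu> T"
      by (subst distr_distr[OF T_measurable_\<nu>]) auto
    with Suc show ?case using \<nu>_inv measurable_comp[OF _ T_measurable_\<nu>, of "T ^^ k" \<nu>] by (simp add: o_def)
  qed (auto simp: distr_id id_def)
  then show "distr \<nu> \<nu> (T ^^ k) = \<nu>" "T ^^ k \<in> measurable \<nu> \<nu>" by auto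
qed

lemma F\<nu>_range: "0 \<le> F\<nu> t" "F\<nu> t \<le> 1"
  unfolding F\<nu>_def using prob_space.prob_le_1[OF \<nu>_prob] by auto

lemma F\<nu>_measurable [measurable]: "F\<nu> \<in> borel_measurable borel"
proof (rule borel_measurable_mono[OF monoI])
  interpret prob_space \<nu> by (rule \<nu>_prob)
  fix s t :: real assume "s \<le> t"
  then show "F\<nu> s \<le> F\<nu> t"
    unfolding F\<nu>_def by (intro finite_measure_mono) (auto simp: \<nu>_sets sets_restrict_space)
qed

lemma integral_visit: "(\<integral>x. of_bool ((T ^^ k) x \<le> t) \<partial>\<nu>) = F\<nu> t"
proof -
  have A: "{0..1} \<inter> {..t} \<in> sets \<nu>" by (auto simp: \<nu>_sets sets_restrict_space)
  have "(\<integral>x. of_bool ((T ^^ k) x \<le> t) \<partial>\<nu>) = (\<integral>x. indicat_real ({0..1} \<inter> {..t}) ((T ^^ k) x) \<partial>\<nu>)"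
    using intermittent_map_funpow_in[OF \<gamma>_pos]
    by (intro Bochner_Integration.integral_cong) (auto simp: indicator_def \<nu>_space)
  also have "\<dots> = (\<integral>x. indicat_real ({0..1} \<inter> {..t}) x \<partial>distr \<nu> \<nu> (T ^^ k))"
    using A by (intro integral_distr[symmetric] funpow_T_measurable_\<nu>) auto
  also have "\<dots> = F\<nu> t" using A sets.sets_into_space[OF A] by (simp add: distr_funpow_T F\<nu>_def Int_absorb2)
  finally show ?thesis .
qed

lemma orbit_sum_measurable2 [measurable]:
  "(\<lambda>(x, t). orbit_sum n t x) \<in> borel_measurable (borel \<Otimes>\<^sub>M borel)"
  unfolding orbit_sum_def case_prod_beta' by measurable

text \<open>
  By invariance the mean of \<open>orbit_sum n t\<close> under \<open>\<nu>\<close> is \<open>n * (F\<nu> t - Fstar t)\<close>. By absolute continuity, the law of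
  large numbers holds \<open>\<nu>\<close>-almost everywhere, so these means are \<open>o(n)\<close> in \<open>L\<^sup>1(dt)\<close>.
\<close>

lemma Fstar_eq_cdf: "AE t in leb01. Fstar t = F\<nu> t"
proof -
  interpret \<nu>: prob_space \<nu> by (rule \<nu>_prob)
  interpret P: pair_prob_space \<nu> leb01 ..
  define g where "g n x = (\<integral>t. \<bar>orbit_sum n t x\<bar> \<partial>leb01) / real n" for n x
  have m2: "(\<lambda>(x, t). orbit_sum n t x) \<in> borel_measurable (\<nu> \<Otimes>\<^sub>M leb01)" for n
  proof -
    have "fst \<in> borel_measurable (\<nu> \<Otimes>\<^sub>M leb01)"
      using measurable_compose[OF measurable_fst borel_measurable_\<nu>[OF measurable_ident]] by simp
    moreover have "snd \<in> borel_measurable (\<nu> \<Otimes>\<^sub>M leb01)" by measurable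
    ultimately have "(\<lambda>p. (fst p, snd p)) \<in> \<nu> \<Otimes>\<^sub>M leb01 \<rightarrow>\<^sub>M borel \<Otimes>\<^sub>M borel"
      by (rule measurable_Pair)
    from measurable_compose[OF this orbit_sum_measurable2[of n]] show ?thesis by (simp add: case_prod_beta')
  qed
  have g_meas: "g n \<in> borel_measurable \<nu>" for n
    unfolding g_def using leb01.borel_measurable_lebesgue_integral[of "\<lambda>x t. \<bar>orbit_sum n t x\<bar>" \<nu>] m2[of n] by measurable
  have g01: "0 \<le> g n x" "g n x \<le> 1" for n x
  proof -
    show "0 \<le> g n x" by (simp add: g_def)
    have "(\<integral>t. \<bar>orbit_sum n t x\<bar> \<partial>leb01) \<le> (\<integral>t. real n \<partial>leb01)"
      by (intro integral_mono integrable_abs integrable_leb01_bounded[OF orbit_sum_measurable_t orbit_sum_bound]) (auto intro: orbit_sum_bound)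
    then show "g n x \<le> 1" by (simp add: g_def divide_le_eq)
  qed
  have "AE x in unit_lebesgue. (\<lambda>n. g n x) \<longlonglongrightarrow> 0"
    unfolding AE_unit_lebesgue_iff g_def by (rule orbit_law_of_large_numbers)
  then have "AE x in \<nu>. (\<lambda>n. g n x) \<longlonglongrightarrow> 0"
    by (rule absolutely_continuous_AE[rotated 2]) (auto simp: \<nu>_ac \<nu>_sets sets_restrict_space)
  then have lim: "(\<lambda>n. \<integral>x. g n x \<partial>\<nu>) \<longlonglongrightarrow> (\<integral>x. 0 \<partial>\<nu>)"
    by (intro integral_dominated_convergence[where w = "\<lambda>_. 1"]) (use g_meas g01 in auto)
  have "(\<integral>t. \<bar>F\<nu> t - Fstar t\<bar> \<partial>leb01) \<le> (\<integral>x. g n x \<partial>\<nu>)" if n: "0 < n" for n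
  proof -
    have I2: "integrable (\<nu> \<Otimes>\<^sub>M leb01) (\<lambda>(x, t). \<bar>orbit_sum n t x\<bar>)"
      using m2[of n] orbit_sum_bound by (intro P.integrable_const_bound[of _ "real n"]) (auto simp: case_prod_beta')
    have Ix: "integrable \<nu> (\<lambda>x. orbit_sum n t x)" for t
    proof (rule \<nu>.integrable_const_bound)
      show "AE x in \<nu>. norm (orbit_sum n t x) \<le> real n" by (simp add: orbit_sum_bound)
      show "(\<lambda>x. orbit_sum n t x) \<in> borel_measurable \<nu>"
        unfolding orbit_sum_def by (rule borel_measurable_\<nu>) measurable
    qed
    have mean: "(\<integral>x. orbit_sum n t x \<partial>\<nu>) = real n * (F\<nu> t - Fstar t)" for t
    proof -
      have Ik: "integrable \<nu> (\<lambda>x. of_bool ((T ^^ k) x \<le> t) :: real)" for k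
        by (rule \<nu>.integrable_const_bound[of _ 1]) (auto intro!: borel_measurable_\<nu>)
      have "(\<integral>x. orbit_sum n t x \<partial>\<nu>) = (\<Sum>k<n. (\<integral>x. of_bool ((T ^^ k) x \<le> t) \<partial>\<nu>) - Fstar t)"
        unfolding orbit_sum_def using Ik by (subst Bochner_Integration.integral_sum) (auto simp: \<nu>.prob_space)
      then show ?thesis by (simp add: integral_visit)
    qed
    have "real n * (\<integral>t. \<bar>F\<nu> t - Fstar t\<bar> \<partial>leb01) = (\<integral>t. \<bar>\<integral>x. orbit_sum n t x \<partial>\<nu>\<bar> \<partial>leb01)"
      by (simp add: mean abs_mult)
    also have "\<dots> \<le> (\<integral>t. (\<integral>x. \<bar>orbit_sum n t x\<bar> \<partial>\<nu>) \<partial>leb01)"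
    proof (rule integral_mono)
      show "integrable leb01 (\<lambda>t. \<bar>\<integral>x. orbit_sum n t x \<partial>\<nu>\<bar>)"
      proof (rule integrable_leb01_bounded)
        show "\<bar>\<bar>\<integral>x. orbit_sum n t x \<partial>\<nu>\<bar>\<bar> \<le> real n * 1" for t
          unfolding mean abs_abs abs_mult using F\<nu>_range[of t] Fstar_nonneg[of t] Fstar_le_1[of t]
          by (intro mult_mono) (auto simp: abs_le_iff)
      qed (unfold mean, measurable)
      show "integrable leb01 (\<lambda>t. \<integral>x. \<bar>orbit_sum n t x\<bar> \<partial>\<nu>)"
        using P.integrable_snd[OF I2] by simp
      show "\<bar>\<integral>x. orbit_sum n t x \<partial>\<nu>\<bar> \<le> (\<integral>x. \<bar>orbit_sum n t x\<bar> \<partial>\<nu>)" for t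
        by (rule integral_abs_bound)
    qed
    also have "\<dots> = (\<integral>x. (\<integral>t. \<bar>orbit_sum n t x\<bar> \<partial>leb01) \<partial>\<nu>)"
      using P.Fubini_integral[OF I2] by simp
    also have "\<dots> = real n * (\<integral>x. g n x \<partial>\<nu>)" using n by (simp add: g_def)
    finally show ?thesis using n by simp
  qed
  then have "(\<integral>t. \<bar>F\<nu> t - Fstar t\<bar> \<partial>leb01) \<le> 0"
    using lim by (intro LIMSEQ_le_const[of "\<lambda>n. \<integral>x. g n x \<partial>\<nu>"]) (auto intro!: exI[of _ 1])
  then have "(\<integral>t. \<bar>F\<nu> t - Fstar t\<bar> \<partial>leb01) = 0" by (intro antisym) auto
  moreover have "integrable leb01 (\<lambda>t. \<bar>F\<nu> t - Fstar t\<bar>)"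
  proof (rule integrable_leb01_bounded)
    show "\<bar>\<bar>F\<nu> t - Fstar t\<bar>\<bar> \<le> 1" for t
      using F\<nu>_range[of t] Fstar_nonneg[of t] Fstar_le_1[of t] unfolding abs_abs abs_le_iff by (intro conjI; linarith)
  qed measurable
  ultimately have "AE t in leb01. \<bar>F\<nu> t - Fstar t\<bar> = 0"
    by (subst (asm) integral_nonneg_eq_0_iff_AE) auto
  then show ?thesis by eventually_elim simp
qed

text \<open>
  The empirical measure consists of the times \<open>1\<close> to \<open>n\<close> and the orbit sum of the times \<open>0\<close> to
  \<open>n - 1\<close>, which accounts for the additional 1.
\<close>

lemma W1_le_orbit_sum:
  assumes x: "x \<in> {0..1}" and n: "0 < n"
  shows "0 \<le> W1 (empirical_measure \<gamma> n x) \<nu>"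
    and "real n * W1 (empirical_measure \<gamma> n x) \<nu> \<le> (\<integral>t. \<bar>orbit_sum n t x\<bar> \<partial>leb01) + 1"
proof -
  have \<mu>: "prob_space (empirical_measure \<gamma> n x)" by (rule prob_space_empirical_measure[OF \<gamma>_pos x n])
  note W = W1_le_cdf_distance[OF \<mu> sets_empirical_measure \<nu>_prob \<nu>_sets]
  show "0 \<le> W1 (empirical_measure \<gamma> n x) \<nu>" by (rule W(1))
  define E where "E t = (\<Sum>k=1..n. of_bool ((T ^^ k) x \<le> t)) / real n" for t
  have E_meas [measurable]: "E \<in> borel_measurable borel" unfolding E_def by measurable
  have "real n * W1 (empirical_measure \<gamma> n x) \<nu> \<le> real n * (\<integral>t. \<bar>E t - F\<nu> t\<bar> \<partial>leb01)"
    using W(2) unfolding measure_empirical_measure[OF \<gamma>_pos x n] E_def F\<nu>_def by (intro mult_left_mono) auto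
  also have "(\<integral>t. \<bar>E t - F\<nu> t\<bar> \<partial>leb01) = (\<integral>t. \<bar>E t - Fstar t\<bar> \<partial>leb01)"
    by (intro integral_cong_AE) (use Fstar_eq_cdf in \<open>auto elim: eventually_mono\<close>)
  also have "real n * \<dots> = (\<integral>t. \<bar>real n * (E t - Fstar t)\<bar> \<partial>leb01)"
    by (simp add: abs_mult)
  also have "\<dots> \<le> (\<integral>t. \<bar>orbit_sum n t x\<bar> + 1 \<partial>leb01)"
  proof (rule integral_mono)
    have shift: "real n * (E t - Fstar t) = orbit_sum n t x + of_bool ((T ^^ n) x \<le> t) - of_bool (x \<le> t)" for t
    proof -
      have "(\<Sum>k=1..n. of_bool ((T ^^ k) x \<le> t)) = (\<Sum>k<n. of_bool ((T ^^ k) x \<le> t)) + of_bool ((T ^^ n) x \<le> t) - (of_bool (x \<le> t) :: real)"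
        by (induction n) (auto simp del: sum_of_bool_eq)
      moreover have "real n * E t = (\<Sum>k=1..n. of_bool ((T ^^ k) x \<le> t))" using n by (simp add: E_def)
      moreover have "orbit_sum n t x = (\<Sum>k<n. of_bool ((T ^^ k) x \<le> t)) - real n * Fstar t"
        by (simp add: orbit_sum_def sum_subtractf del: sum_of_bool_eq)
      ultimately show ?thesis by (simp only: right_diff_distrib)
    qed
    show bd: "\<bar>real n * (E t - Fstar t)\<bar> \<le> \<bar>orbit_sum n t x\<bar> + 1" for t
      unfolding shift by (auto simp: of_bool_def)
    show "integrable leb01 (\<lambda>t. \<bar>real n * (E t - Fstar t)\<bar>)"
    proof (rule integrable_leb01_bounded)
      show "\<bar>\<bar>real n * (E t - Fstar t)\<bar>\<bar> \<le> real n + 1" for t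
        using bd[of t] orbit_sum_bound[of n t x] by linarith
    qed measurable
    show "integrable leb01 (\<lambda>t. \<bar>orbit_sum n t x\<bar> + 1)"
      using integrable_leb01_bounded[OF orbit_sum_measurable_t orbit_sum_bound] by simp
  qed
  also have "\<dots> = (\<integral>t. \<bar>orbit_sum n t x\<bar> \<partial>leb01) + 1"
    using integrable_leb01_bounded[OF orbit_sum_measurable_t orbit_sum_bound] by simp
  finally show "real n * W1 (empirical_measure \<gamma> n x) \<nu> \<le> (\<integral>t. \<bar>orbit_sum n t x\<bar> \<partial>leb01) + 1" .
qed

theorem W1_negligible:
  fixes b :: "nat \<Rightarrow> real"
  assumes b_mono: "\<And>m n. 1 \<le> m \<Longrightarrow> m \<le> n \<Longrightarrow> b m \<le> b n"
    and b_lim: "filterlim (\<lambda>p. b (2 ^ p)) at_top sequentially"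
    and sm: "\<And>\<epsilon>. 0 < \<epsilon> \<Longrightarrow> summable (\<lambda>p. 2 ^ p * rate (\<epsilon> * b (2 ^ p)))"
  shows "AE x in unit_lebesgue. (\<lambda>n. real n / b n * W1 (empirical_measure \<gamma> n x) \<nu>) \<longlonglongrightarrow> 0"
proof -
  have b_top: "filterlim b at_top sequentially"
    unfolding filterlim_at_top
  proof
    fix Z
    have "\<forall>\<^sub>F p in sequentially. Z \<le> b (2 ^ p)" using b_lim by (simp add: filterlim_at_top)
    then obtain p where "Z \<le> b (2 ^ p)" by (auto simp: eventually_sequentially)
    then show "\<forall>\<^sub>F n in sequentially. Z \<le> b n"
      by (intro eventually_mono[OF eventually_ge_at_top[of "2 ^ p"]]) (use b_mono[of "2 ^ p"] in \<open>force intro: order_trans\<close>)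
  qed
  have "AE x in unit_lebesgue. (\<lambda>n. (\<integral>t. \<bar>orbit_sum n t x\<bar> \<partial>leb01) / b n) \<longlonglongrightarrow> 0"
    unfolding AE_unit_lebesgue_iff by (rule orbit_sum_negligible[OF assms])
  moreover have "AE x in unit_lebesgue. x \<in> {0..1}" by (auto simp: space_restrict_space intro!: AE_I2)
  ultimately show ?thesis
  proof eventually_elim
    case (elim x)
    have "(\<lambda>n. 1 / b n) \<longlonglongrightarrow> 0" by (intro tendsto_divide_0[OF tendsto_const] filterlim_at_top_imp_at_infinity b_top)
    from tendsto_add[OF elim(1) this]
    have up: "(\<lambda>n. (\<integral>t. \<bar>orbit_sum n t x\<bar> \<partial>leb01) / b n + 1 / b n) \<longlonglongrightarrow> 0" by simp
    have "\<forall>\<^sub>F n in sequentially. 0 < b n" using b_top by (simp add: filterlim_at_top_dense)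
    then have ev: "\<forall>\<^sub>F n in sequentially. 0 < b n \<and> 0 < n"
      by (rule eventually_conj) (rule eventually_gt_at_top)
    show ?case
    proof (rule tendsto_sandwich[OF _ _ tendsto_const up])
      show "\<forall>\<^sub>F n in sequentially. 0 \<le> real n / b n * W1 (empirical_measure \<gamma> n x) \<nu>"
        using ev by eventually_elim (use W1_le_orbit_sum(1)[OF elim(2)] in auto)
      show "\<forall>\<^sub>F n in sequentially. real n / b n * W1 (empirical_measure \<gamma> n x) \<nu>
          \<le> (\<integral>t. \<bar>orbit_sum n t x\<bar> \<partial>leb01) / b n + 1 / b n"
        using ev
      proof eventually_elim
        case (elim n)
        then show ?case
          using divide_right_mono[OF W1_le_orbit_sum(2)[OF \<open>x \<in> {0..1}\<close>, of n], of "b n"] by (simp add: add_divide_distrib)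
      qed
    qed
  qed
qed

end

text \<open>
  Cauchy condensation.
\<close>

lemma summable_dyadic:
  fixes a :: "nat \<Rightarrow> real"
  assumes a: "mono_on {1..} a" "\<And>n. 1 \<le> n \<Longrightarrow> 0 < a n" and "0 \<le> s"
    and sm: "summable (\<lambda>n. 1 / (real n * a n powr s))"
  shows "summable (\<lambda>p. 1 / a (2 ^ p) powr s)"
proof -
  let ?f = "\<lambda>n. 1 / (real n * a n powr s)"
  have "summable ?f \<longleftrightarrow> summable (\<lambda>p. 2 ^ p * ?f (2 ^ p))"
  proof (rule condensation_test)
    fix m :: nat assume m: "0 < m"
    have "a m \<le> a (Suc m)" using m by (intro mono_onD[OF a(1)]) auto
    then have "a m powr s \<le> a (Suc m) powr s" using a(2)[of m] m \<open>0 \<le> s\<close> by (intro powr_mono2) auto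
    then show "?f (Suc m) \<le> ?f m"
      using m a(2)[of m] by (intro divide_left_mono mult_mono mult_pos_pos) auto
  qed auto
  then show ?thesis using sm by simp
qed

lemma filterlim_dyadic:
  fixes a g :: "nat \<Rightarrow> real"
  assumes "\<And>n. 1 \<le> n \<Longrightarrow> \<delta> \<le> a n" "0 < \<delta>" and g: "filterlim (\<lambda>p. g (2 ^ p)) at_top sequentially" "\<And>n. 0 \<le> g n"
  shows "filterlim (\<lambda>p. g (2 ^ p) * a (2 ^ p)) at_top sequentially"
proof (rule filterlim_at_top_mono)
  show "filterlim (\<lambda>p. \<delta> * g (2 ^ p)) at_top sequentially"
    by (rule filterlim_tendsto_pos_mult_at_top[OF tendsto_const assms(2) g(1)])
  show "\<forall>\<^sub>F p in sequentially. \<delta> * g (2 ^ p) \<le> g (2 ^ p) * a (2 ^ p)"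
    using assms(1) g(2) by (intro always_eventually allI) (subst mult.commute, rule mult_left_mono, auto)
qed

theorem corollary2p2:
  fixes \<gamma> :: real and \<nu> :: "real measure"
  assumes "\<gamma> \<in> {0<..<1}"
    and "invariant_ac_prob \<gamma> \<nu>"
  shows
    "(\<gamma> = 1/2 \<longrightarrow>
       (\<forall>a :: nat \<Rightarrow> real.
          mono_on {1..} a \<and>
          (\<exists>\<alpha>>0. \<forall>n\<ge>1. a n \<ge> \<alpha>) \<and>
          summable (\<lambda>n. 1 / (real n * (a n)\<^sup>2)) \<and>
          (\<exists>c\<ge>1. \<forall>n\<ge>1. even n \<longrightarrow> a n \<le> c * a (n div 2)) \<longrightarrow>
          (AE x in unit_lebesgue.
             (\<lambda>n. sqrt (real n) / (a n * sqrt (ln (real n))) * W1 (empirical_measure \<gamma> n x) \<nu>)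
               \<longlonglongrightarrow> 0)))
     \<and>
     (\<gamma> \<in> {1/2<..<1} \<longrightarrow>
       (\<forall>a :: nat \<Rightarrow> real.
          mono_on {1..} a \<and>
          (\<forall>n\<ge>1. a n > 0) \<and>
          summable (\<lambda>n. 1 / (real n * a n powr (1/\<gamma>))) \<and>
          (\<exists>c\<ge>1. \<forall>n\<ge>1. even n \<longrightarrow> a n \<le> c * a (n div 2)) \<longrightarrow>
          (AE x in unit_lebesgue.
             (\<lambda>n. real n powr (1 - \<gamma>) / a n * W1 (empirical_measure \<gamma> n x) \<nu>)
               \<longlonglongrightarrow> 0)))"
proof (intro conjI impI allI; elim conjE exE)
  fix a :: "nat \<Rightarrow> real" and \<delta> c :: real
  assume half: "\<gamma> = 1/2" and mono: "mono_on {1..} a" and \<delta>: "0 < \<delta>" "\<forall>n\<ge>1. \<delta> \<le> a n"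
    and sm: "summable (\<lambda>n. 1 / (real n * (a n)\<^sup>2))"
    and c: "1 \<le> c" "\<forall>n\<ge>1. even n \<longrightarrow> a n \<le> c * a (n div 2)"
  interpret intermittent_system \<gamma> \<nu> by unfold_locales (use half assms in auto)
  have a_pos: "0 < a n" if "1 \<le> n" for n using \<delta> that by (auto intro: less_le_trans)
  define b where "b n = sqrt (real n * ln (real n)) * a n" for n
  have b_top: "filterlim (\<lambda>p. b (2 ^ p)) at_top sequentially"
    unfolding b_def
  proof (rule filterlim_dyadic[of \<delta>])
    show "filterlim (\<lambda>p. sqrt (real (2 ^ p) * ln (real (2 ^ p)))) at_top sequentially"
    proof (rule filterlim_at_top_mono)
      show "filterlim (\<lambda>p. sqrt (real p * ln 2)) at_top sequentially"
        by (rule filterlim_compose[OF sqrt_at_top])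
           (subst mult.commute, rule filterlim_tendsto_pos_mult_at_top[OF tendsto_const _ filterlim_real_sequentially], simp)
      show "\<forall>\<^sub>F p in sequentially. sqrt (real p * ln 2) \<le> sqrt (real (2 ^ p) * ln (real (2 ^ p)))"
      proof (intro always_eventually allI real_sqrt_le_mono)
        fix p :: nat
        have "1 * (real p * ln 2) \<le> 2 ^ p * (real p * ln 2)" by (intro mult_right_mono) auto
        then show "real p * ln 2 \<le> real (2 ^ p) * ln (real (2 ^ p))" by (simp add: ln_realpow)
      qed
    qed
  next
    show "0 \<le> sqrt (real n * ln (real n))" for n by (cases "n = 0") auto
  qed (use \<delta> in auto)
  have "AE x in unit_lebesgue. (\<lambda>n. real n / b n * W1 (empirical_measure \<gamma> n x) \<nu>) \<longlonglongrightarrow> 0"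
  proof (rule W1_negligible)
    fix m n :: nat assume mn: "1 \<le> m" "m \<le> n"
    then have "a m \<le> a n" by (intro mono_onD[OF mono]) auto
    then show "b m \<le> b n"
      unfolding b_def using mn a_pos[of m] by (intro mult_mono real_sqrt_le_mono) auto
  next
    show "filterlim (\<lambda>p. b (2 ^ p)) at_top sequentially" by (rule b_top)
  next
    fix \<epsilon> :: real assume \<epsilon>: "0 < \<epsilon>"
    \<comment> \<open>the doubling condition makes \<open>a\<close> polynomially bounded, so that \<open>ln (\<epsilon> * b (2 ^ p))\<close> is \<open>O(p)\<close>\<close>
    have a_growth: "a (2 ^ p) \<le> c ^ p * a 1" for p
    proof (induction p)
      case (Suc p)
      have "a (2 ^ Suc p) \<le> c * a (2 ^ p)" using c(2)[rule_format, of "2 ^ Suc p"] by simp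
      also have "\<dots> \<le> c * (c ^ p * a 1)" using Suc c by (intro mult_left_mono) auto
      finally show ?case by simp
    qed simp
    define E A where "E = max 0 (ln \<epsilon>)" and "A = max 0 (ln (a 1))"
    define K where "K = E + 2 + ln c + A"
    have bound: "norm (2 ^ p * rate (\<epsilon> * b (2 ^ p))) \<le> K / (\<epsilon>\<^sup>2 * ln 2) * (1 / a (2 ^ p) powr 2)"
      if p: "1 \<le> p" "1 \<le> \<epsilon> * b (2 ^ p)" for p
    proof -
      let ?a = "a (2 ^ p)" and ?x = "\<epsilon> * b (2 ^ p)"
      have ap: "0 < ?a" by (rule a_pos) simp
      have b_eq: "b (2 ^ p) = sqrt (2 ^ p * (real p * ln 2)) * ?a" by (simp add: b_def ln_realpow)
      have sq: "?x\<^sup>2 = \<epsilon>\<^sup>2 * (2 ^ p * (real p * ln 2)) * ?a\<^sup>2"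
        by (simp add: b_eq power_mult_distrib)
      have ln_le: "ln ?x \<le> K * real p"
      proof -
        have r0: "0 < 2 ^ p * (real p * ln 2)" using p by simp
        have "ln ?x = ln \<epsilon> + (ln (2 ^ p * (real p * ln 2)) / 2 + ln ?a)"
          using \<epsilon> ap r0 p by (simp add: b_eq ln_mult ln_sqrt)
        also have "ln (2 ^ p * (real p * ln 2)) = real p * ln 2 + (ln (real p) + ln (ln 2))"
          using p by (simp add: ln_mult ln_realpow)
        also have "ln ?a \<le> ln (c ^ p * a 1)" using a_growth[of p] ap by simp
        also have "ln (c ^ p * a 1) = real p * ln c + ln (a 1)"
          using c a_pos[of 1] by (simp add: ln_mult ln_realpow)
        finally have 1: "ln ?x \<le> ln \<epsilon> + ((real p * ln 2 + (ln (real p) + ln (ln 2))) / 2 + (real p * ln c + ln (a 1)))" by simp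
        have l2: "0 < ln (2::real)" "ln (2::real) \<le> 1" using ln_le_minus_one[of 2] by auto
        then have "ln (ln (2::real)) \<le> 0" by simp
        moreover have "ln (real p) \<le> real p" using ln_le_minus_one[of "real p"] p by simp
        moreover have "real p * ln 2 \<le> real p * 1" using l2 by (intro mult_left_mono) auto
        moreover have "E * 1 \<le> E * real p" "A * 1 \<le> A * real p"
          using p by (intro mult_left_mono; simp add: E_def A_def)+
        moreover have "ln \<epsilon> \<le> E" "ln (a 1) \<le> A" by (simp_all add: E_def A_def)
        moreover have "K * real p = E * real p + 2 * real p + real p * ln c + A * real p"
          by (simp add: K_def algebra_simps)
        moreover have "0 \<le> real p" by simp
        ultimately show ?thesis using 1 by (simp only: mult_1_right) argo
      qed
      have inv_\<gamma>: "1 / \<gamma> = 2" unfolding half by simp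
      have x2: "?x powr -2 = 1 / ?x\<^sup>2" using p by (simp add: powr_minus_divide powr_numeral)
      have "rate ?x = (if 1 / \<gamma> = 2 then ln ?x else 1) * ?x powr -(1 / \<gamma>)" by (rule rate_def)
      also have "\<dots> = ln ?x / ?x\<^sup>2" unfolding inv_\<gamma> x2 by simp
      finally have rate_eq: "rate ?x = ln ?x / ?x\<^sup>2" .
      have "rate ?x \<le> K * real p / ?x\<^sup>2"
        unfolding rate_eq by (intro divide_right_mono ln_le) simp
      then have "2 ^ p * rate ?x \<le> 2 ^ p * (K * real p / ?x\<^sup>2)" by (rule mult_left_mono) simp
      also have "\<dots> = K / (\<epsilon>\<^sup>2 * ln 2) * (1 / ?a powr 2)"
        unfolding sq using p \<epsilon> ap by (simp add: field_simps powr_numeral)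
      finally have "2 ^ p * rate ?x \<le> K / (\<epsilon>\<^sup>2 * ln 2) * (1 / ?a powr 2)" .
      moreover have "0 \<le> rate ?x" using p by (simp add: rate_eq)
      ultimately show ?thesis by simp
    qed
    have "\<forall>\<^sub>F p in sequentially. 1 \<le> \<epsilon> * b (2 ^ p)"
    proof -
      have "filterlim (\<lambda>p. \<epsilon> * b (2 ^ p)) at_top sequentially"
        by (rule filterlim_tendsto_pos_mult_at_top[OF tendsto_const \<epsilon> b_top])
      then show ?thesis unfolding filterlim_at_top by blast
    qed
    with eventually_ge_at_top[of 1]
    have ev: "\<forall>\<^sub>F p in sequentially. norm (2 ^ p * rate (\<epsilon> * b (2 ^ p))) \<le> K / (\<epsilon>\<^sup>2 * ln 2) * (1 / a (2 ^ p) powr 2)"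
      by eventually_elim (rule bound)
    have "summable (\<lambda>p. 1 / a (2 ^ p) powr 2)"
    proof (rule summable_dyadic[OF mono a_pos])
      have pw_eq: "1 / (real n * a n powr 2) = 1 / (real n * (a n)\<^sup>2)" for n
        using a_pos[of n] by (cases "n = 0") (auto simp: powr_numeral)
      show "summable (\<lambda>n. 1 / (real n * a n powr 2))" unfolding pw_eq by (rule sm)
    qed auto
    then show "summable (\<lambda>p. 2 ^ p * rate (\<epsilon> * b (2 ^ p)))"
      by (intro summable_comparison_test_ev[OF ev] summable_mult)
  qed
  moreover have "real n / b n = sqrt (real n) / (a n * sqrt (ln (real n)))" for n
    by (simp add: b_def real_sqrt_mult real_div_sqrt flip: divide_divide_eq_left) (simp add: mult.commute)
  ultimately show "AE x in unit_lebesgue.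
      (\<lambda>n. sqrt (real n) / (a n * sqrt (ln (real n))) * W1 (empirical_measure \<gamma> n x) \<nu>) \<longlonglongrightarrow> 0"
    by simp
next
  fix a :: "nat \<Rightarrow> real" and c :: real
  assume gt_half: "\<gamma> \<in> {1/2<..<1}" and mono: "mono_on {1..} a" and a_pos: "\<forall>n\<ge>1. 0 < a n"
    and sm: "summable (\<lambda>n. 1 / (real n * a n powr (1/\<gamma>)))"
  interpret intermittent_system \<gamma> \<nu> by unfold_locales (use gt_half assms in auto)
  define b where "b n = real n powr \<gamma> * a n" for n
  have g0: "0 < \<gamma>" using gt_half by simp
  have "AE x in unit_lebesgue. (\<lambda>n. real n / b n * W1 (empirical_measure \<gamma> n x) \<nu>) \<longlonglongrightarrow> 0"
  proof (rule W1_negligible)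
    fix m n :: nat assume mn: "1 \<le> m" "m \<le> n"
    then have "a m \<le> a n" by (intro mono_onD[OF mono]) auto
    then show "b m \<le> b n"
      unfolding b_def using mn a_pos g0 by (intro mult_mono powr_mono2) (auto intro: less_imp_le)
  next
    show "filterlim (\<lambda>p. b (2 ^ p)) at_top sequentially"
      unfolding b_def
    proof (rule filterlim_dyadic[of "a 1"])
      show "a 1 \<le> a n" if "1 \<le> n" for n using that by (intro mono_onD[OF mono]) auto
      have "filterlim (\<lambda>x::real. x powr \<gamma>) at_top at_top" by (rule real_powr_at_top[OF g0])
      from filterlim_compose[OF this filterlim_2_power]
      show "filterlim (\<lambda>p. real (2 ^ p) powr \<gamma>) at_top sequentially" by simp
    qed (use a_pos in auto)
  next
    fix \<epsilon> :: real assume \<epsilon>: "0 < \<epsilon>"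
    have "2 ^ p * rate (\<epsilon> * b (2 ^ p)) = \<epsilon> powr -(1/\<gamma>) * (1 / a (2 ^ p) powr (1/\<gamma>))" for p
    proof -
      have "rate (\<epsilon> * b (2 ^ p)) = \<epsilon> powr -(1/\<gamma>) * ((((2::real) ^ p) powr \<gamma>) powr -(1/\<gamma>) * a (2 ^ p) powr -(1/\<gamma>))"
        using gt_half by (simp add: rate_def b_def powr_mult field_simps)
      also have "(((2::real) ^ p) powr \<gamma>) powr -(1/\<gamma>) = 1 / (2 ^ p :: real)"
        using g0 by (simp add: powr_powr powr_minus_divide)
      finally show ?thesis by (simp add: powr_minus_divide)
    qed
    moreover have "summable (\<lambda>p. 1 / a (2 ^ p) powr (1/\<gamma>))"
      using g0 a_pos by (intro summable_dyadic[OF mono _ _ sm]) auto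
    ultimately show "summable (\<lambda>p. 2 ^ p * rate (\<epsilon> * b (2 ^ p)))" by (simp only: summable_mult)
  qed
  moreover have "real n / b n = real n powr (1 - \<gamma>) / a n" for n
    by (cases "n = 0") (auto simp: b_def powr_diff)
  ultimately show "AE x in unit_lebesgue.
      (\<lambda>n. real n powr (1 - \<gamma>) / a n * W1 (empirical_measure \<gamma> n x) \<nu>) \<longlonglongrightarrow> 0"
    by simp
qed

end
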